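(* Let $\Omega\subset\mathbf{R}^d$ be an open set with boundary $\Gamma$. For all $i,j\in\{1,\ldots,d\}$ let $a_{ij}\in L_\infty(\Omega,\mathbf{C})$, let $\theta\in[0,\frac\pi2)$ and suppose $\sum_{i,j=1}^d a_{ij}(x)\,\xi_i\,\overline{\xi_j}\in\Sigma_\theta$ for all $\xi\in\mathbf{C}^d$ and a.e. $x\in\Omega$. Let $\mu$ be a positive Borel measure on $\Gamma$ such that $\mu(K)<\infty$ for every compact $K\subset\Gamma$. Define the form $a$ by $D(a)=\{u\in H^1(\Omega)\cap C(\overline\Omega):\int_\Gamma|u|^2\,d\mu<\infty\}$ and $a(u,v)=\sum_{i,j=1}^d\int_\Omega(\partial_iu)\,a_{ij}\,\overline{\partial_jv}+\int_\Gamma u\,\overline v\,d\mu$, and let $A$ be the operator in $L_2(\Omega)$ associated with $a$. Suppose that the Neumann form $a_N$, given by $D(a_N)=H^1(\Omega)$ and $a_N(u,v)=\sum_{i,j=1}^d\int_\Omega(\partial_iu)\,a_{ij}\,\overline{\partial_jv}$, is closable. Let $u,f\in L_2(\Omega)$. Then $u\in D(A)$ and $Au=f$ if and only if $u\in H^1_{a,\mu}(\Omega)$, $\mathcal{A}u=f$ weakly on $\Omega$ and $$\overline{a_N}(u,v)-\int_\Omega(\mathcal{A}u)\,\overline v=-\int_\Gamma(\operatorname{Tr}_{a,\mu}u)\,\overline v\,d\mu$$ for all $v\in D(a)$.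
   Context: $\Sigma_\theta=\{re^{i\alpha}:r\ge0,\ |\alpha|\le\theta\}$. The form $a$ is densely defined and sectorial in $L_2(\Omega)$ with vertex $0$, possibly not closable. The operator $A$ associated with $a$ is the well-defined $m$-sectorial operator in $L_2(\Omega)$ such that $x\in D(A)$ and $Ax=f$ if and only if there exist $u_1,u_2,\ldots\in D(a)$ with $(\operatorname{Re}a(u_n,u_n))_n$ bounded, $u_n\to x$ in $L_2(\Omega)$ and $a(u_n,v)\to(f,v)_{L_2(\Omega)}$ for all $v\in D(a)$. The closure $\overline{a_N}$ has domain $D(\overline{a_N})\subset L_2(\Omega)$, with norm $(\operatorname{Re}\overline{a_N}(u,u)+\|u\|_2^2)^{1/2}$. For $u\in D(\overline{a_N})$ and $f\in L_2(\Omega)$, "$\mathcal{A}u=f$ weakly on $\Omega$" means $\overline{a_N}(u,v)=\int_\Omega f\,\overline v$ for all $v\in C_c^\infty(\Omega)$; such $f$ is unique and denoted $\mathcal{A}u$. For $u\in D(\overline{a_N})$ and $\varphi\in L_2(\Gamma,\mu)$, $\varphi$ is a trace of $u$ if there exist $u_1,u_2,\ldots\in D(a)$ with $u_n\to u$ in $D(\overline{a_N})$ and $u_n|_\Gamma\to\varphi$ in $L_2(\Gamma,\mu)$. $H^1_{a,\mu}(\Omega)$ is the set of all $u\in D(\overline{a_N})$ that have a trace in $L_2(\Gamma,\mu)$. There is a Borel set $\Gamma_{a,\mu}\subset\Gamma$, unique up to $\mu$-null sets, such that the set of all traces of $0$ equals $L_2(\Gamma\setminus\Gamma_{a,\mu},\mu)$;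 for $u\in H^1_{a,\mu}(\Omega)$, $\operatorname{Tr}_{a,\mu}u$ denotes the unique $\varphi\in L_2(\Gamma_{a,\mu},\mu)$ (extended by $0$ to $\Gamma$) that is a trace of $u$. *)

theory Defs
  imports "HOL-Analysis.Analysis"
begin

text \<open>
  Elements of \<open>L\<^sub>2\<close> are represented by square-integrable functions; the notions below depend on
  them only up to almost-everywhere equality.  The exception is \<open>form_dom\<close>, whose elements are
  continuous on the closure of \<open>\<Omega>\<close>, so that their values on the boundary are meaningful.
\<close>

definition L2 :: "'a measure \<Rightarrow> ('a \<Rightarrow> complex) set" where
  "L2 M = {f \<in> borel_measurable M. integrable M (\<lambda>x. (cmod (f x))\<^sup>2)}"

definition L2_inner :: "'a measure \<Rightarrow> ('a \<Rightarrow> complex) \<Rightarrow> ('a \<Rightarrow> complex) \<Rightarrow> complex" where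
  "L2_inner M f g = (\<integral>x. f x * cnj (g x) \<partial>M)"

definition L2_norm :: "'a measure \<Rightarrow> ('a \<Rightarrow> complex) \<Rightarrow> real" where
  "L2_norm M f = sqrt (\<integral>x. (cmod (f x))\<^sup>2 \<partial>M)"

definition L2_tendsto :: "'a measure \<Rightarrow> (nat \<Rightarrow> 'a \<Rightarrow> complex) \<Rightarrow> ('a \<Rightarrow> complex) \<Rightarrow> bool" where
  "L2_tendsto M u x \<longleftrightarrow> (\<lambda>n. L2_norm M (\<lambda>y. u n y - x y)) \<longlonglongrightarrow> 0"

definition Linfty :: "'a measure \<Rightarrow> ('a \<Rightarrow> complex) set" where
  "Linfty M = {f \<in> borel_measurable M. \<exists>C. AE x in M. cmod (f x) \<le> C}"

definition sector :: "real \<Rightarrow> complex set" where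
  "sector \<theta> = {of_real r * cis \<alpha> | r \<alpha>. r \<ge> 0 \<and> \<bar>\<alpha>\<bar> \<le> \<theta>}"


section \<open>Sectorial forms with vertex 0\<close>

text \<open>A form in \<open>L2 M\<close> is given by a domain \<open>D\<close> and a sesquilinear map \<open>a\<close> on \<open>D\<close>, antilinear in
  the second argument.\<close>

type_synonym 'a form = "('a \<Rightarrow> complex) \<Rightarrow> ('a \<Rightarrow> complex) \<Rightarrow> complex"

text \<open>The graph of the operator associated with a densely defined sectorial form, which need not
  be closable.\<close>

definition form_operator ::
    "'a measure \<Rightarrow> ('a \<Rightarrow> complex) set \<Rightarrow> 'a form \<Rightarrow> (('a \<Rightarrow> complex) \<times> ('a \<Rightarrow> complex)) set" where
  "form_operator M D a = {(x, f). x \<in> L2 M \<and> f \<in> L2 M \<and>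
     (\<exists>u. (\<forall>n. u n \<in> D) \<and> bounded (range (\<lambda>n. Re (a (u n) (u n)))) \<and> L2_tendsto M u x \<and>
          (\<forall>v\<in>D. (\<lambda>n. a (u n) v) \<longlonglongrightarrow> L2_inner M f v))}"

definition form_norm :: "'a measure \<Rightarrow> 'a form \<Rightarrow> ('a \<Rightarrow> complex) \<Rightarrow> real" where
  "form_norm M a u = sqrt (Re (a u u) + (L2_norm M u)\<^sup>2)"

definition form_Cauchy :: "'a measure \<Rightarrow> 'a form \<Rightarrow> (nat \<Rightarrow> 'a \<Rightarrow> complex) \<Rightarrow> bool" where
  "form_Cauchy M a u \<longleftrightarrow>
     (\<forall>e>0. \<exists>N. \<forall>m\<ge>N. \<forall>n\<ge>N. form_norm M a (\<lambda>y. u m y - u n y) < e)"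

definition form_approx ::
    "'a measure \<Rightarrow> ('a \<Rightarrow> complex) set \<Rightarrow> 'a form \<Rightarrow> (nat \<Rightarrow> 'a \<Rightarrow> complex) \<Rightarrow> ('a \<Rightarrow> complex) \<Rightarrow> bool"
  where
  "form_approx M D a u x \<longleftrightarrow> (\<forall>n. u n \<in> D) \<and> form_Cauchy M a u \<and> L2_tendsto M u x"

definition closable :: "'a measure \<Rightarrow> ('a \<Rightarrow> complex) set \<Rightarrow> 'a form \<Rightarrow> bool" where
  "closable M D a \<longleftrightarrow>
     (\<forall>u. form_approx M D a u (\<lambda>_. 0) \<longrightarrow> (\<lambda>n. a (u n) (u n)) \<longlonglongrightarrow> 0)"

definition closure_dom :: "'a measure \<Rightarrow> ('a \<Rightarrow> complex) set \<Rightarrow> 'a form \<Rightarrow> ('a \<Rightarrow> complex) set" where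
  "closure_dom M D a = {x \<in> L2 M. \<exists>u. form_approx M D a u x}"

text \<open>Meaningful if the form is closable; then the limit is independent of the approximating
  sequences.\<close>

definition closure_form :: "'a measure \<Rightarrow> ('a \<Rightarrow> complex) set \<Rightarrow> 'a form \<Rightarrow> 'a form" where
  "closure_form M D a x y = (THE c. \<exists>u v. form_approx M D a u x \<and> form_approx M D a v y \<and>
     (\<lambda>n. a (u n) (v n)) \<longlonglongrightarrow> c)"


section \<open>Test functions and the Sobolev space \<open>H\<^sup>1\<close>\<close>

definition partial_deriv :: "'n \<Rightarrow> (real^'n \<Rightarrow> complex) \<Rightarrow> real^'n \<Rightarrow> complex" where
  "partial_deriv i f x = frechet_derivative f (at x) (axis i 1)"

text \<open>\<open>k\<close>-times continuously differentiable on the whole space.\<close>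

primrec Ck :: "nat \<Rightarrow> (real^'n \<Rightarrow> complex) \<Rightarrow> bool" where
  "Ck 0 f \<longleftrightarrow> continuous_on UNIV f"
| "Ck (Suc k) f \<longleftrightarrow> (\<forall>x. f differentiable (at x)) \<and> (\<forall>i. Ck k (partial_deriv i f))"

text \<open>\<open>C\<^sub>c\<^sup>\<infinity>(\<Omega>)\<close>, its elements being extended by zero to the whole space.\<close>

definition test_functions :: "(real^'n) set \<Rightarrow> (real^'n \<Rightarrow> complex) set" where
  "test_functions \<Omega> = {\<phi>. (\<forall>k. Ck k \<phi>) \<and>
     compact (closure {x. \<phi> x \<noteq> 0}) \<and> closure {x. \<phi> x \<noteq> 0} \<subseteq> \<Omega>}"

definition has_weak_deriv ::
    "(real^'n) set \<Rightarrow> 'n \<Rightarrow> (real^'n \<Rightarrow> complex) \<Rightarrow> (real^'n \<Rightarrow> complex) \<Rightarrow> bool" where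
  "has_weak_deriv \<Omega> i u g \<longleftrightarrow> (\<forall>\<phi>\<in>test_functions \<Omega>.
     (\<integral>x. u x * partial_deriv i \<phi> x \<partial>lebesgue_on \<Omega>) = - (\<integral>x. g x * \<phi> x \<partial>lebesgue_on \<Omega>))"

definition H1 :: "(real^'n) set \<Rightarrow> (real^'n \<Rightarrow> complex) set" where
  "H1 \<Omega> = {u \<in> L2 (lebesgue_on \<Omega>). \<forall>i. \<exists>g\<in>L2 (lebesgue_on \<Omega>). has_weak_deriv \<Omega> i u g}"

text \<open>A representative of the weak derivative, which is unique almost everywhere on \<open>\<Omega>\<close>.\<close>

definition weak_deriv :: "(real^'n) set \<Rightarrow> 'n \<Rightarrow> (real^'n \<Rightarrow> complex) \<Rightarrow> real^'n \<Rightarrow> complex" where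
  "weak_deriv \<Omega> i u = (SOME g. g \<in> L2 (lebesgue_on \<Omega>) \<and> has_weak_deriv \<Omega> i u g)"


section \<open>The Neumann form and the form with boundary term\<close>

text \<open>Throughout, \<open>c\<close> is the coefficient matrix and \<open>\<mu>\<close> a measure on \<open>\<Gamma> = frontier \<Omega>\<close>.\<close>

definition neumann_form :: "(real^'n) set \<Rightarrow> ('n \<Rightarrow> 'n \<Rightarrow> real^'n \<Rightarrow> complex) \<Rightarrow> (real^'n) form" where
  "neumann_form \<Omega> c u v = (\<Sum>i\<in>UNIV. \<Sum>j\<in>UNIV.
     \<integral>x. weak_deriv \<Omega> i u x * c i j x * cnj (weak_deriv \<Omega> j v x) \<partial>lebesgue_on \<Omega>)"

definition form_dom :: "(real^'n) set \<Rightarrow> (real^'n) measure \<Rightarrow> (real^'n \<Rightarrow> complex) set" where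
  "form_dom \<Omega> \<mu> = {u \<in> H1 \<Omega>. continuous_on (closure \<Omega>) u \<and>
     (\<integral>\<^sup>+x. ennreal ((cmod (u x))\<^sup>2) \<partial>\<mu>) < \<infinity>}"

definition robin_form ::
    "(real^'n) set \<Rightarrow> ('n \<Rightarrow> 'n \<Rightarrow> real^'n \<Rightarrow> complex) \<Rightarrow> (real^'n) measure \<Rightarrow> (real^'n) form" where
  "robin_form \<Omega> c \<mu> u v = neumann_form \<Omega> c u v + (\<integral>x. u x * cnj (v x) \<partial>\<mu>)"

definition neumann_closure_dom ::
    "(real^'n) set \<Rightarrow> ('n \<Rightarrow> 'n \<Rightarrow> real^'n \<Rightarrow> complex) \<Rightarrow> (real^'n \<Rightarrow> complex) set" where
  "neumann_closure_dom \<Omega> c = closure_dom (lebesgue_on \<Omega>) (H1 \<Omega>) (neumann_form \<Omega> c)"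

definition neumann_closure ::
    "(real^'n) set \<Rightarrow> ('n \<Rightarrow> 'n \<Rightarrow> real^'n \<Rightarrow> complex) \<Rightarrow> (real^'n) form" where
  "neumann_closure \<Omega> c = closure_form (lebesgue_on \<Omega>) (H1 \<Omega>) (neumann_form \<Omega> c)"

text \<open>\<open>weakly_eq \<Omega> c u f\<close> is ``\<open>\<A>u = f\<close> weakly on \<open>\<Omega>\<close>''; \<open>weak_operator \<Omega> c u\<close> is a representative
  of \<open>\<A>u\<close>, which is unique almost everywhere on \<open>\<Omega>\<close>.\<close>

definition weakly_eq ::
    "(real^'n) set \<Rightarrow> ('n \<Rightarrow> 'n \<Rightarrow> real^'n \<Rightarrow> complex) \<Rightarrow>
      (real^'n \<Rightarrow> complex) \<Rightarrow> (real^'n \<Rightarrow> complex) \<Rightarrow> bool" where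
  "weakly_eq \<Omega> c u f \<longleftrightarrow> u \<in> neumann_closure_dom \<Omega> c \<and> f \<in> L2 (lebesgue_on \<Omega>) \<and>
     (\<forall>v\<in>test_functions \<Omega>. neumann_closure \<Omega> c u v = (\<integral>x. f x * cnj (v x) \<partial>lebesgue_on \<Omega>))"

definition weak_operator ::
    "(real^'n) set \<Rightarrow> ('n \<Rightarrow> 'n \<Rightarrow> real^'n \<Rightarrow> complex) \<Rightarrow>
      (real^'n \<Rightarrow> complex) \<Rightarrow> real^'n \<Rightarrow> complex" where
  "weak_operator \<Omega> c u = (SOME f. weakly_eq \<Omega> c u f)"


section \<open>Traces\<close>

definition is_trace ::
    "(real^'n) set \<Rightarrow> ('n \<Rightarrow> 'n \<Rightarrow> real^'n \<Rightarrow> complex) \<Rightarrow> (real^'n) measure \<Rightarrow>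
      (real^'n \<Rightarrow> complex) \<Rightarrow> (real^'n \<Rightarrow> complex) \<Rightarrow> bool" where
  "is_trace \<Omega> c \<mu> u \<phi> \<longleftrightarrow> u \<in> neumann_closure_dom \<Omega> c \<and> \<phi> \<in> L2 \<mu> \<and>
     (\<exists>w. (\<forall>n. w n \<in> form_dom \<Omega> \<mu>) \<and>
       (\<lambda>n. form_norm (lebesgue_on \<Omega>) (neumann_closure \<Omega> c) (\<lambda>y. w n y - u y)) \<longlonglongrightarrow> 0 \<and>
       L2_tendsto \<mu> w \<phi>)"

definition H1_trace ::
    "(real^'n) set \<Rightarrow> ('n \<Rightarrow> 'n \<Rightarrow> real^'n \<Rightarrow> complex) \<Rightarrow> (real^'n) measure \<Rightarrow>
      (real^'n \<Rightarrow> complex) set" where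
  "H1_trace \<Omega> c \<mu> = {u \<in> neumann_closure_dom \<Omega> c. \<exists>\<phi>\<in>L2 \<mu>. is_trace \<Omega> c \<mu> u \<phi>}"

text \<open>A version of \<open>\<Gamma>\<^bsub>a,\<mu>\<^esub>\<close>, which is unique up to \<open>\<mu>\<close>-null sets. \<open>L\<^sub>2(\<Gamma> - G, \<mu>)\<close> is regarded as the
  subspace of those elements of \<open>L\<^sub>2(\<Gamma>, \<mu>)\<close> that vanish almost everywhere on \<open>G\<close>.\<close>

definition trace_set ::
    "(real^'n) set \<Rightarrow> ('n \<Rightarrow> 'n \<Rightarrow> real^'n \<Rightarrow> complex) \<Rightarrow> (real^'n) measure \<Rightarrow> (real^'n) set" where
  "trace_set \<Omega> c \<mu> = (SOME G. G \<in> sets \<mu> \<and>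
     {\<phi>. is_trace \<Omega> c \<mu> (\<lambda>_. 0) \<phi>} = {\<phi> \<in> L2 \<mu>. AE x in \<mu>. x \<in> G \<longrightarrow> \<phi> x = 0})"

definition Tr ::
    "(real^'n) set \<Rightarrow> ('n \<Rightarrow> 'n \<Rightarrow> real^'n \<Rightarrow> complex) \<Rightarrow> (real^'n) measure \<Rightarrow>
      (real^'n \<Rightarrow> complex) \<Rightarrow> real^'n \<Rightarrow> complex" where
  "Tr \<Omega> c \<mu> u = (SOME \<phi>. \<phi> \<in> L2 \<mu> \<and>
     (\<forall>x\<in>frontier \<Omega> - trace_set \<Omega> c \<mu>. \<phi> x = 0) \<and> is_trace \<Omega> c \<mu> u \<phi>)"

end

(*
  For v in D(a) put q(v) = Re a(v,v) + |v|^2, the square of the form norm.  If u in D(A) is reached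
  by a sequence (u_n) with bounded Re a(u_n,u_n), the parallelogram law yields almost minimizers of q
  in the midpoint-convex hulls of the tails of (u_n) that form a Cauchy sequence for q and keep the
  limits of (u_n).  Along them both the Neumann part and the boundary values converge, which gives
  a trace phi of u with a_N(u,v) + (phi,v) = (f,v) for all v in D(a).  Inserting approximations of
  traces of 0 shows that phi is orthogonal to all traces of 0, so that phi = Tr u.

  That the traces of 0 are exactly the functions vanishing on some Borel set follows because they form
  a closed subspace of L2(mu) that is invariant under multiplication by test functions, hence under
  multiplication by indicator functions of Borel sets.
*)
theory Submission
  imports Defs
begin

text \<open>The form \<open>a\<close> need not be closable: elements of D(a) may tend to 0 for the
  Neumann form while their boundary values tend to a nonzero function. The completion of D(a) for q
  therefore consists of pairs (u, phi), where phi is a trace of u but is not determined by u. The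
  traces of 0 measure exactly this ambiguity, and the equation itself removes it by forcing phi to
  be orthogonal to them.

  The converse needs no minimization: a sequence that witnesses Tr u as a trace of u is already
  admissible in the definition of A.

  A second difficulty is that weak derivatives, \<A>u, the set \<Gamma>_{a,\<mu>} and the trace are
  chosen representatives. A choice is usable only once a witness is known to exist, and the
  statements must not depend on it up to null sets. For weak derivatives and \<A>u the latter is the
  fundamental lemma of the calculus of variations, which comes from the same argument on closed
  invariant subspaces as the set \<Gamma>_{a,\<mu>}.\<close>

section \<open>Sectorial forms and the parallelogram law\<close>

text \<open>The bound \<open>t\<close> is the tangent of the half-angle of the sector. Keeping it as
  a parameter lets the same facts serve the Neumann form, the form with boundary term and, with
  \<open>t = 0\<close>, inner products of L2. Elements are functions and not classes, so the
  quadratic form may vanish on nonzero functions and is used as a seminorm only.\<close>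

locale nonneg_form =
  fixes D :: "('a \<Rightarrow> complex) set" and a :: "'a form" and t :: real
  assumes zero_mem: "(\<lambda>_. 0) \<in> D"
    and add_mem: "\<And>u v. u \<in> D \<Longrightarrow> v \<in> D \<Longrightarrow> (\<lambda>x. u x + v x) \<in> D"
    and scale_mem: "\<And>u k. u \<in> D \<Longrightarrow> (\<lambda>x. k * u x) \<in> D"
    and add_left: "\<And>u v w. u \<in> D \<Longrightarrow> v \<in> D \<Longrightarrow> w \<in> D \<Longrightarrow> a (\<lambda>x. u x + v x) w = a u w + a v w"
    and add_right: "\<And>u v w. u \<in> D \<Longrightarrow> v \<in> D \<Longrightarrow> w \<in> D \<Longrightarrow> a w (\<lambda>x. u x + v x) = a w u + a w v"
    and scale_left: "\<And>u w k. u \<in> D \<Longrightarrow> w \<in> D \<Longrightarrow> a (\<lambda>x. k * u x) w = k * a u w"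
    and scale_right: "\<And>u w k. u \<in> D \<Longrightarrow> w \<in> D \<Longrightarrow> a w (\<lambda>x. k * u x) = cnj k * a w u"
    and nonneg: "\<And>u. u \<in> D \<Longrightarrow> 0 \<le> Re (a u u)"
    and angle_nonneg: "0 \<le> t"
    and sectorial: "\<And>u. u \<in> D \<Longrightarrow> \<bar>Im (a u u)\<bar> \<le> t * Re (a u u)"
begin

lemma minus_mem: "u \<in> D \<Longrightarrow> v \<in> D \<Longrightarrow> (\<lambda>x. u x - v x) \<in> D"
  using add_mem[OF _ scale_mem[of v "-1"], of u] by simp

lemma minus_left: "u \<in> D \<Longrightarrow> v \<in> D \<Longrightarrow> w \<in> D \<Longrightarrow> a (\<lambda>x. u x - v x) w = a u w - a v w"
  using add_left[OF _ scale_mem[of v "-1"], of u w] scale_left[of v w "-1"] by simp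

lemma minus_right: "u \<in> D \<Longrightarrow> v \<in> D \<Longrightarrow> w \<in> D \<Longrightarrow> a w (\<lambda>x. u x - v x) = a w u - a w v"
  using add_right[OF _ scale_mem[of v "-1"], of u w] scale_right[of v w "-1"] by simp

lemma half_mem: "u \<in> D \<Longrightarrow> (\<lambda>x. u x / 2) \<in> D"
  using scale_mem[of u "1/2"] by simp

lemma half_left: "u \<in> D \<Longrightarrow> w \<in> D \<Longrightarrow> a (\<lambda>x. u x / 2) w = a u w / 2"
  using scale_left[of u w "1/2"] by simp

lemma half_right: "u \<in> D \<Longrightarrow> w \<in> D \<Longrightarrow> a w (\<lambda>x. u x / 2) = a w u / 2"
  using scale_right[of u w "1/2"] by simp

lemmas mem = zero_mem add_mem scale_mem minus_mem half_mem
lemmas linear = add_left add_right scale_left scale_right minus_left minus_right half_left half_right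

lemma zero_form: "u \<in> D \<Longrightarrow> a (\<lambda>_. 0) u = 0" "u \<in> D \<Longrightarrow> a u (\<lambda>_. 0) = 0"
  using scale_left[OF zero_mem, of u 0] scale_right[OF zero_mem, of u 0] by simp_all

lemma quadratic_scale:
  assumes "u \<in> D"
  shows "Re (a (\<lambda>x. k * u x) (\<lambda>x. k * u x)) = (cmod k)\<^sup>2 * Re (a u u)"
proof -
  have "a (\<lambda>x. k * u x) (\<lambda>x. k * u x) = of_real ((cmod k)\<^sup>2) * a u u"
    using assms by (simp add: scale_left scale_right mem complex_norm_square mult.assoc del: of_real_power)
  then show ?thesis by (simp del: of_real_power)
qed

lemma parallelogram:
  assumes "u \<in> D" "v \<in> D"
  shows "Re (a (\<lambda>x. u x + v x) (\<lambda>x. u x + v x)) + Re (a (\<lambda>x. u x - v x) (\<lambda>x. u x - v x))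
    = 2 * Re (a u u) + 2 * Re (a v v)"
  using assms by (simp add: linear mem)

lemma quadratic_add_le:
  assumes "u \<in> D" "v \<in> D"
  shows "Re (a (\<lambda>x. u x + v x) (\<lambda>x. u x + v x)) \<le> 2 * Re (a u u) + 2 * Re (a v v)"
  using parallelogram[OF assms] nonneg[OF minus_mem[OF assms]] by linarith

lemma quadratic_diff_le:
  assumes "u \<in> D" "v \<in> D"
  shows "Re (a (\<lambda>x. u x - v x) (\<lambda>x. u x - v x)) \<le> 2 * Re (a u u) + 2 * Re (a v v)"
  using parallelogram[OF assms] nonneg[OF add_mem[OF assms]] by linarith

lemma quadratic_triangle:
  assumes "u \<in> D" "v \<in> D" "w \<in> D"
  shows "Re (a (\<lambda>x. u x - w x) (\<lambda>x. u x - w x))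
    \<le> 2 * Re (a (\<lambda>x. u x - v x) (\<lambda>x. u x - v x)) + 2 * Re (a (\<lambda>x. v x - w x) (\<lambda>x. v x - w x))"
  using quadratic_add_le[OF minus_mem[OF assms(1,2)] minus_mem[OF assms(2,3)]] by simp

lemma quadratic_minus_commute:
  assumes "u \<in> D" "v \<in> D"
  shows "a (\<lambda>x. u x - v x) (\<lambda>x. u x - v x) = a (\<lambda>x. v x - u x) (\<lambda>x. v x - u x)"
  using assms by (simp add: linear mem)

text \<open>The parallelogram law solved for the difference: two elements whose midpoint is not much
  smaller than they are must be close to each other.\<close>

lemma quadratic_midpoint:
  assumes "u \<in> D" "v \<in> D"
  shows "Re (a (\<lambda>x. u x - v x) (\<lambda>x. u x - v x))
    = 2 * Re (a u u) + 2 * Re (a v v) - 4 * Re (a (\<lambda>x. (u x + v x) / 2) (\<lambda>x. (u x + v x) / 2))"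
proof -
  have m: "(\<lambda>x. u x + v x) \<in> D" using assms by (rule add_mem)
  show ?thesis
    using parallelogram[OF assms] m by (simp add: half_left half_right half_mem)
qed

text \<open>The form is not hermitian, so Cauchy-Schwarz does not apply directly. Sectoriality gives
  \<open>cmod (a w w) \<le> (1 + t) * Re (a w w)\<close>, polarization expresses
  \<open>a u v\<close> by four such values, and the parallelogram law adds up their real
  parts.\<close>

lemma cmod_le_sum:
  assumes "u \<in> D" "v \<in> D"
  shows "cmod (a u v) \<le> (1 + t) * (Re (a u u) + Re (a v v))"
proof -
  have iv: "(\<lambda>x. \<i> * v x) \<in> D" using assms by (simp add: mem)
  let ?q = "\<lambda>w. a w w"
  have b: "cmod (?q w) \<le> (1 + t) * Re (?q w)" if "w \<in> D" for w
    using cmod_le[of "?q w"] nonneg[OF that] sectorial[OF that] by (simp add: algebra_simps)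
  let ?z1 = "?q (\<lambda>x. u x + v x)" and ?z2 = "?q (\<lambda>x. u x - v x)"
  let ?z3 = "?q (\<lambda>x. u x + \<i> * v x)" and ?z4 = "?q (\<lambda>x. u x - \<i> * v x)"
  have polarization: "4 * a u v = ?z1 - ?z2 + \<i> * ?z3 - \<i> * ?z4"
  proof -
    have plus: "?q (\<lambda>x. u x + w x) = a u u + a u w + a w u + a w w"
      and minus: "?q (\<lambda>x. u x - w x) = a u u - a u w - a w u + a w w" if "w \<in> D" for w
      using assms that by (simp_all add: linear mem)
    have "a u (\<lambda>x. \<i> * v x) = - \<i> * a u v" "a (\<lambda>x. \<i> * v x) u = \<i> * a v u"
      using assms by (simp_all add: scale_left scale_right)
    then show ?thesis
      unfolding plus[OF assms(2)] minus[OF assms(2)] plus[OF iv] minus[OF iv] by (simp add: algebra_simps)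
  qed
  have tri: "cmod (z1 - z2 + \<i> * z3 - \<i> * z4) \<le> cmod z1 + cmod z2 + cmod z3 + cmod z4" for z1 z2 z3 z4
    using norm_triangle_ineq4[of "z1 - z2 + \<i> * z3" "\<i> * z4"] norm_triangle_ineq[of "z1 - z2" "\<i> * z3"]
      norm_triangle_ineq4[of z1 z2] by (simp add: norm_mult)
  have "cmod (4 * a u v) \<le> cmod ?z1 + cmod ?z2 + cmod ?z3 + cmod ?z4"
    unfolding polarization using tri[of ?z1 ?z2 ?z3 ?z4] by assumption
  moreover have "cmod ?z1 + cmod ?z2 + cmod ?z3 + cmod ?z4 \<le> (1 + t) * (Re ?z1 + Re ?z2 + Re ?z3 + Re ?z4)"
    unfolding distrib_left by (intro add_mono b mem assms iv)
  moreover have "Re ?z1 + Re ?z2 + Re ?z3 + Re ?z4 = 4 * (Re (a u u) + Re (a v v))"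
    using parallelogram[OF assms] parallelogram[OF assms(1) iv] quadratic_scale[OF assms(2), of \<i>]
    by simp
  ultimately show ?thesis by (simp add: norm_mult distrib_left)
qed

text \<open>Replacing \<open>u\<close> by \<open>s * u\<close> and \<open>v\<close> by
  \<open>v / s\<close> does not change \<open>a u v\<close>, so the sum in
  \<open>cmod_le_sum\<close> may be optimized over \<open>s\<close>.\<close>

lemma cmod_le_sqrt:
  assumes "u \<in> D" "v \<in> D"
  shows "cmod (a u v) \<le> 2 * (1 + t) * (sqrt (Re (a u u)) * sqrt (Re (a v v)))"
proof -
  define p q where "p = Re (a u u)" and "q = Re (a v v)"
  have pq: "p \<ge> 0" "q \<ge> 0" using assms nonneg by (auto simp: p_def q_def)
  have s: "cmod (a u v) \<le> (1 + t) * (s\<^sup>2 * p + q / s\<^sup>2)" if "s > 0" for s :: real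
  proof -
    have "cmod (a (\<lambda>x. of_real s * u x) (\<lambda>x. of_real (1/s) * v x)) \<le>
      (1 + t) * (Re (a (\<lambda>x. of_real s * u x) (\<lambda>x. of_real s * u x)) + Re (a (\<lambda>x. of_real (1/s) * v x) (\<lambda>x. of_real (1/s) * v x)))"
      by (intro cmod_le_sum mem assms)
    also have "a (\<lambda>x. of_real s * u x) (\<lambda>x. of_real (1/s) * v x) = a u v"
      using that assms by (simp add: scale_left scale_right mem del: times_divide_eq_left divide_inverse)
    finally show ?thesis
      unfolding quadratic_scale[OF assms(1)] quadratic_scale[OF assms(2)]
      using that by (simp add: p_def q_def power_divide norm_divide)
  qed
  have "cmod (a u v) \<le> 2 * (1 + t) * sqrt ((p + e) * (q + e))" if "e > 0" for e
  proof -
    \<comment> \<open>This \<open>s\<close> makes the two summands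
      \<open>s\<^sup>2 * (p + e)\<close> and \<open>(q + e) / s\<^sup>2\<close> equal. Since
      \<open>p\<close> or \<open>q\<close> may be 0, both are first enlarged by \<open>e\<close>,
      which tends to 0 at the end.\<close>
    define s where "s = sqrt (sqrt ((q + e) / (p + e)))"
    have s0: "s > 0" using pq that by (simp add: s_def)
    have s2: "s\<^sup>2 = sqrt ((q + e) / (p + e))" using pq that by (simp add: s_def)
    have "cmod (a u v) \<le> (1 + t) * (s\<^sup>2 * p + q / s\<^sup>2)" using s[OF s0] .
    also have "\<dots> \<le> (1 + t) * (s\<^sup>2 * (p + e) + (q + e) / s\<^sup>2)"
      using angle_nonneg that s0 by (intro mult_left_mono add_mono divide_right_mono) auto
    also have "s\<^sup>2 * (p + e) = sqrt (q + e) * ((p + e) / sqrt (p + e))"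
      unfolding s2 by (simp add: real_sqrt_divide)
    also have "\<dots> = sqrt ((p + e) * (q + e))"
      using pq that by (simp add: real_div_sqrt real_sqrt_mult)
    also have "(q + e) / s\<^sup>2 = (q + e) / sqrt (q + e) * sqrt (p + e)"
      unfolding s2 by (simp add: real_sqrt_divide)
    also have "\<dots> = sqrt ((p + e) * (q + e))"
      using pq that by (simp add: real_div_sqrt real_sqrt_mult)
    finally show ?thesis by (simp add: algebra_simps)
  qed
  then have "\<forall>\<^sub>F e in at_right 0. cmod (a u v) \<le> 2 * (1 + t) * sqrt ((p + e) * (q + e))"
    by (auto simp: eventually_at_filter)
  moreover have "((\<lambda>e. 2 * (1 + t) * sqrt ((p + e) * (q + e))) \<longlongrightarrow> 2 * (1 + t) * sqrt ((p + 0) * (q + 0))) (at_right 0)"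
    by (intro tendsto_intros)
  ultimately have "cmod (a u v) \<le> 2 * (1 + t) * sqrt ((p + 0) * (q + 0))"
    using tendsto_lowerbound trivial_limit_at_right_real by blast
  then show ?thesis by (simp add: p_def q_def real_sqrt_mult)
qed

text \<open>The substitute for weak compactness: in a decreasing sequence of midpoint-convex sets, almost
  minimizing elements form a Cauchy sequence by the parallelogram law.\<close>

lemma almost_minimizers_Cauchy:
  assumes C: "\<And>n. C n \<subseteq> D" "\<And>n. C (Suc n) \<subseteq> C n" "\<And>n. C n \<noteq> {}"
    and mid: "\<And>n u v. u \<in> C n \<Longrightarrow> v \<in> C n \<Longrightarrow> (\<lambda>x. (u x + v x) / 2) \<in> C n"
    and B: "\<And>n. \<exists>u\<in>C n. Re (a u u) \<le> B"
  obtains g where "\<And>n. g n \<in> C n"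
    "\<And>n. Re (a (g n) (g n)) \<le> (INF u\<in>C n. Re (a u u)) + inverse (Suc n)"
    "\<And>e. e > 0 \<Longrightarrow> \<exists>N. \<forall>m\<ge>N. \<forall>n\<ge>N. Re (a (\<lambda>x. g m x - g n x) (\<lambda>x. g m x - g n x)) < e"
proof -
  let ?q = "\<lambda>u. Re (a u u)"
  define d where "d n = (INF u\<in>C n. ?q u)" for n
  have bdd: "bdd_below (?q ` C n)" for n
    using C(1) nonneg by (intro bdd_belowI2[of _ 0]) auto
  have d_le: "d n \<le> ?q u" if "u \<in> C n" for n u
    unfolding d_def using bdd that by (rule cINF_lower)
  have C_anti: "C n \<subseteq> C m" if "m \<le> n" for m n
    using lift_Suc_antimono_le[of C m n] C(2) that by auto
  have d_mono: "d m \<le> d n" if "m \<le> n" for m n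
    unfolding d_def using C(3) C_anti[OF that] bdd by (intro cINF_superset_mono) auto
  have d_B: "d n \<le> B" for n
    using B[of n] d_le[of _ n] by force
  \<comment> \<open>The sets shrink, so their infima increase, and \<open>B\<close> bounds them.
    Convergence of the infima is what makes elements taken from different sets close to each
    other.\<close>
  obtain l where l: "d \<longlonglongrightarrow> l"
    using incseq_convergent[of d B] d_mono d_B by (metis incseq_def)
  have "\<exists>u\<in>C n. ?q u < d n + inverse (Suc n)" for n
    using cInf_lessD[of "?q ` C n" "d n + inverse (Suc n)"] C(3)[of n] by (auto simp: d_def)
  then obtain g where g: "\<And>n. g n \<in> C n" "\<And>n. ?q (g n) < d n + inverse (Suc n)"
    by metis
  \<comment> \<open>For \<open>m \<le> n\<close> both elements and hence their midpoint lie in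
    \<open>C m\<close>, so the midpoint has value at least \<open>d m\<close>. The parallelogram law
    then leaves \<open>2 * (d n - d m)\<close> and the two slacks. The absolute value makes the
    bound symmetric, which removes the order of the indices afterwards.\<close>
  have est: "?q (\<lambda>x. g m x - g n x) \<le> 4 * \<bar>d n - d m\<bar> + 2 * inverse (Suc m) + 2 * inverse (Suc n)"
    (is "_ \<le> ?R m n") if "m \<le> n" for m n
  proof -
    have "g n \<in> C m" using g C_anti[OF that] by auto
    then have "d m \<le> ?q (\<lambda>x. (g m x + g n x) / 2)" by (intro d_le mid g)
    then show ?thesis
      using quadratic_midpoint[of "g m" "g n"] g(1)[of m] g(1)[of n] C(1) g(2)[of m] g(2)[of n] d_mono[OF that]
      by (simp add: subset_iff)
  qed
  have est: "?q (\<lambda>x. g m x - g n x) \<le> 4 * \<bar>d n - d m\<bar> + 2 * inverse (Suc m) + 2 * inverse (Suc n)" for m n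
  proof (cases "m \<le> n")
    case False
    have "g m \<in> D" "g n \<in> D" using g C by auto
    then have "?q (\<lambda>x. g m x - g n x) = ?q (\<lambda>x. g n x - g m x)"
      by (simp only: quadratic_minus_commute[of "g m" "g n"])
    with est[of n m] False show ?thesis by (simp add: abs_minus_commute)
  qed (rule est)
  have "\<exists>N. \<forall>m\<ge>N. \<forall>n\<ge>N. ?q (\<lambda>x. g m x - g n x) < e" if "e > 0" for e
  proof -
    have "Cauchy d" using l by (simp add: LIMSEQ_imp_Cauchy)
    from CauchyD[OF this, of "e/16"] that obtain N1 where N1: "\<And>m n. m \<ge> N1 \<Longrightarrow> n \<ge> N1 \<Longrightarrow> \<bar>d m - d n\<bar> < e / 16"
      by (auto simp: )
    obtain N2 where N2: "inverse (real (Suc N2)) < e / 16"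
      using reals_Archimedean[of "e/16"] \<open>e > 0\<close> by auto
    have N2': "inverse (real (Suc n)) < e / 16" if "n \<ge> N2" for n
    proof -
      have "inverse (real (Suc n)) \<le> inverse (real (Suc N2))"
        using that by (intro le_imp_inverse_le) auto
      with N2 show ?thesis by linarith
    qed
    have "?q (\<lambda>x. g m x - g n x) < e" if "m \<ge> max N1 N2" "n \<ge> max N1 N2" for m n
      using est[of m n] N1[of n m] N2'[of m] N2'[of n] that \<open>e > 0\<close> by simp
    then show ?thesis by blast
  qed
  with g show ?thesis by (intro that[of g]) (auto simp: d_def less_imp_le)
qed

end

lemma nonneg_form_sum:
  assumes "nonneg_form D a s" "nonneg_form E b t" "D \<subseteq> E"
  shows "nonneg_form D (\<lambda>u v. a u v + b u v) (max s t)"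
proof -
  interpret A: nonneg_form D a s by fact
  interpret B: nonneg_form E b t by fact
  show ?thesis
  proof
    fix u assume u: "u \<in> D"
    have "s * Re (a u u) \<le> max s t * Re (a u u)" "t * Re (b u u) \<le> max s t * Re (b u u)"
      using A.nonneg[OF u] B.nonneg[of u] u \<open>D \<subseteq> E\<close> by (auto intro!: mult_right_mono)
    then show "\<bar>Im (a u u + b u u)\<bar> \<le> max s t * Re (a u u + b u u)"
      using A.sectorial[OF u] B.sectorial[of u] u \<open>D \<subseteq> E\<close> abs_triangle_ineq[of "Im (a u u)" "Im (b u u)"]
      by (auto simp: distrib_left)
  next
    fix u v w k assume "u \<in> D" "v \<in> D" "w \<in> D"
    then show "a (\<lambda>x. u x + v x) w + b (\<lambda>x. u x + v x) w = a u w + b u w + (a v w + b v w)"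
      using \<open>D \<subseteq> E\<close> by (simp add: A.add_left B.add_left subset_iff)
    show "a w (\<lambda>x. u x + v x) + b w (\<lambda>x. u x + v x) = a w u + b w u + (a w v + b w v)"
      using \<open>D \<subseteq> E\<close> \<open>u \<in> D\<close> \<open>v \<in> D\<close> \<open>w \<in> D\<close> by (simp add: A.add_right B.add_right subset_iff)
  qed (use \<open>D \<subseteq> E\<close> A.nonneg B.nonneg A.angle_nonneg in
      \<open>auto simp: A.mem A.scale_left A.scale_right B.scale_left B.scale_right subset_iff algebra_simps\<close>)
qed

lemma nonneg_form_subset:
  assumes "nonneg_form E b t" "D \<subseteq> E" "(\<lambda>_. 0) \<in> D"
    "\<And>u v. u \<in> D \<Longrightarrow> v \<in> D \<Longrightarrow> (\<lambda>x. u x + v x) \<in> D"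
    "\<And>u k. u \<in> D \<Longrightarrow> (\<lambda>x. k * u x) \<in> D"
  shows "nonneg_form D b t"
proof -
  interpret B: nonneg_form E b t by fact
  show ?thesis
    using assms(2-5) B.nonneg B.angle_nonneg B.sectorial
    by unfold_locales (auto simp: B.linear subset_iff)
qed

section \<open>Square-integrable functions\<close>

lemma borel_measurable_cnj [measurable (raw)]:
  fixes f :: "'a \<Rightarrow> complex"
  assumes "f \<in> borel_measurable M"
  shows "(\<lambda>x. cnj (f x)) \<in> borel_measurable M"
  using borel_measurable_continuous_on[OF continuous_on_cnj[OF continuous_on_id] assms] by simp

lemma L2_measurable: "f \<in> L2 M \<Longrightarrow> f \<in> borel_measurable M"
  and L2_square_integrable: "f \<in> L2 M \<Longrightarrow> integrable M (\<lambda>x. (cmod (f x))\<^sup>2)"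
  by (auto simp: L2_def)

text \<open>The majorant carries a factor \<open>C\<close> and holds only almost everywhere, in
  order to cover the products with the essentially bounded coefficients of the Neumann form.\<close>

lemma integrable_product_L2:
  assumes f: "f \<in> L2 M" and g: "g \<in> L2 M" and k: "k \<in> borel_measurable M"
    and le: "AE x in M. cmod (k x) \<le> C * (cmod (f x) * cmod (g x))"
  shows "integrable M k"
proof (rule Bochner_Integration.integrable_bound[OF _ k])
  show "integrable M (\<lambda>x. \<bar>C\<bar> * ((cmod (f x))\<^sup>2 + (cmod (g x))\<^sup>2))"
    using f g by (simp add: L2_square_integrable)
  show "AE x in M. norm (k x) \<le> norm (\<bar>C\<bar> * ((cmod (f x))\<^sup>2 + (cmod (g x))\<^sup>2))"
    using le
  proof eventually_elim
    case (elim x)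
    have "2 * (cmod (f x) * cmod (g x)) \<le> (cmod (f x))\<^sup>2 + (cmod (g x))\<^sup>2"
      using sum_squares_bound[of "cmod (f x)" "cmod (g x)"] by (simp add: mult.assoc)
    moreover have "0 \<le> cmod (f x) * cmod (g x)" by simp
    ultimately have le': "cmod (f x) * cmod (g x) \<le> (cmod (f x))\<^sup>2 + (cmod (g x))\<^sup>2" by linarith
    have "C * (cmod (f x) * cmod (g x)) \<le> \<bar>C\<bar> * (cmod (f x) * cmod (g x))"
      by (intro mult_right_mono) auto
    also have "\<dots> \<le> \<bar>C\<bar> * ((cmod (f x))\<^sup>2 + (cmod (g x))\<^sup>2)"
      using le' by (intro mult_left_mono) auto
    finally show ?case using elim by (simp add: abs_mult)
  qed
qed

lemma integrable_inner_L2: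
  assumes "f \<in> L2 M" "g \<in> L2 M"
  shows "integrable M (\<lambda>x. f x * cnj (g x))" "integrable M (\<lambda>x. f x * g x)"
proof -
  note [measurable] = assms[THEN L2_measurable]
  show "integrable M (\<lambda>x. f x * cnj (g x))"
    by (rule integrable_product_L2[OF assms, of _ 1]; measurable?; simp add: norm_mult)
  show "integrable M (\<lambda>x. f x * g x)"
    by (rule integrable_product_L2[OF assms, of _ 1]; measurable?; simp add: norm_mult)
qed

lemma L2_dominated:
  assumes f: "f \<in> L2 M" and g: "g \<in> borel_measurable M"
    and le: "AE x in M. cmod (g x) \<le> C * cmod (f x)"
  shows "g \<in> L2 M"
proof -
  have "integrable M (\<lambda>x. (cmod (g x))\<^sup>2)"
  proof (rule Bochner_Integration.integrable_bound)
    show "integrable M (\<lambda>x. C\<^sup>2 * (cmod (f x))\<^sup>2)"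
      using L2_square_integrable[OF f] by simp
    show "AE x in M. norm ((cmod (g x))\<^sup>2) \<le> norm (C\<^sup>2 * (cmod (f x))\<^sup>2)"
      using le
    proof eventually_elim
      case (elim x)
      have "(cmod (g x))\<^sup>2 \<le> (C * cmod (f x))\<^sup>2"
        using elim by (intro power_mono) auto
      then show ?case by (simp add: power_mult_distrib)
    qed
  qed (use g in measurable)
  with g show ?thesis by (simp add: L2_def)
qed

lemma L2_zero: "(\<lambda>_. 0) \<in> L2 M"
  by (simp add: L2_def)

lemma L2_scale: "f \<in> L2 M \<Longrightarrow> (\<lambda>x. k * f x) \<in> L2 M"
  using L2_measurable[of f M] by (rule_tac L2_dominated[of f M _ "cmod k"]) (auto simp: norm_mult)

lemma L2_cnj: "f \<in> L2 M \<Longrightarrow> (\<lambda>x. cnj (f x)) \<in> L2 M"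
  using L2_measurable[of f M] by (rule_tac L2_dominated[of f M _ 1]) auto

lemma L2_add:
  assumes "f \<in> L2 M" "g \<in> L2 M"
  shows "(\<lambda>x. f x + g x) \<in> L2 M"
proof -
  note [measurable] = assms[THEN L2_measurable]
  have "integrable M (\<lambda>x. (cmod (f x + g x))\<^sup>2)"
  proof (rule Bochner_Integration.integrable_bound)
    show "integrable M (\<lambda>x. 2 * ((cmod (f x))\<^sup>2 + (cmod (g x))\<^sup>2))"
      using assms by (simp add: L2_square_integrable)
    have "(cmod (x + y))\<^sup>2 \<le> 2 * ((cmod x)\<^sup>2 + (cmod y)\<^sup>2)" for x y
    proof -
      have "(cmod (x + y))\<^sup>2 \<le> (cmod x + cmod y)\<^sup>2"
        by (intro power_mono norm_triangle_ineq) auto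
      also have "\<dots> \<le> 2 * ((cmod x)\<^sup>2 + (cmod y)\<^sup>2)"
        using sum_squares_bound[of "cmod x" "cmod y"] by (simp add: power2_sum)
      finally show ?thesis .
    qed
    then show "AE x in M. norm ((cmod (f x + g x))\<^sup>2) \<le> norm (2 * ((cmod (f x))\<^sup>2 + (cmod (g x))\<^sup>2))"
      by simp
  qed measurable
  then show ?thesis by (simp add: L2_def)
qed

lemma L2_diff: "f \<in> L2 M \<Longrightarrow> g \<in> L2 M \<Longrightarrow> (\<lambda>x. f x - g x) \<in> L2 M"
  using L2_add[OF _ L2_scale[of g M "-1"], of f] by simp

lemma L2_norm_power2: "(L2_norm M f)\<^sup>2 = (\<integral>x. (cmod (f x))\<^sup>2 \<partial>M)"
  by (simp add: L2_norm_def)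

lemma L2_inner_self: "L2_inner M f f = of_real (\<integral>x. (cmod (f x))\<^sup>2 \<partial>M)"
proof -
  have "L2_inner M f f = (\<integral>x. complex_of_real ((cmod (f x))\<^sup>2) \<partial>M)"
    unfolding L2_inner_def by (simp only: complex_norm_square)
  then show ?thesis by (simp only: integral_complex_of_real)
qed

lemma Re_L2_inner_self: "Re (L2_inner M f f) = (\<integral>x. (cmod (f x))\<^sup>2 \<partial>M)"
  by (simp add: L2_inner_self)

lemma nonneg_form_L2_inner: "nonneg_form (L2 M) (L2_inner M) 0"
proof
  fix u v w k assume L2: "u \<in> L2 M" "v \<in> L2 M" "w \<in> L2 M"
  then show "L2_inner M (\<lambda>x. u x + v x) w = L2_inner M u w + L2_inner M v w"
    unfolding L2_inner_def distrib_right by (intro Bochner_Integration.integral_add integrable_inner_L2)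
  show "L2_inner M w (\<lambda>x. u x + v x) = L2_inner M w u + L2_inner M w v"
    unfolding L2_inner_def distrib_left complex_cnj_add
    by (intro Bochner_Integration.integral_add integrable_inner_L2 L2)
next
  fix u w k assume "u \<in> L2 M" "w \<in> L2 M"
  have "L2_inner M (\<lambda>x. k * u x) w = (\<integral>x. k * (u x * cnj (w x)) \<partial>M)"
    by (simp add: L2_inner_def mult.assoc)
  then show "L2_inner M (\<lambda>x. k * u x) w = k * L2_inner M u w"
    by (simp add: L2_inner_def)
  have "L2_inner M w (\<lambda>x. k * u x) = (\<integral>x. cnj k * (w x * cnj (u x)) \<partial>M)"
    by (simp add: L2_inner_def mult.left_commute)
  then show "L2_inner M w (\<lambda>x. k * u x) = cnj k * L2_inner M w u"
    by (simp add: L2_inner_def)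
qed (auto simp: L2_zero L2_add L2_scale Re_L2_inner_self L2_inner_self)

interpretation L2: nonneg_form "L2 M" "L2_inner M" 0 for M :: "'a measure"
  by (rule nonneg_form_L2_inner)

lemma tendsto_power2_0_iff:
  fixes f :: "nat \<Rightarrow> real"
  shows "(\<lambda>n. (f n)\<^sup>2) \<longlonglongrightarrow> 0 \<longleftrightarrow> f \<longlonglongrightarrow> 0"
proof
  assume "(\<lambda>n. (f n)\<^sup>2) \<longlonglongrightarrow> 0"
  then have "(\<lambda>n. sqrt ((f n)\<^sup>2)) \<longlonglongrightarrow> sqrt 0" by (rule tendsto_real_sqrt)
  then show "f \<longlonglongrightarrow> 0" by (simp add: tendsto_rabs_zero_iff)
next
  assume "f \<longlonglongrightarrow> 0"
  then have "(\<lambda>n. (f n)\<^sup>2) \<longlonglongrightarrow> 0\<^sup>2" by (rule tendsto_power)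
  then show "(\<lambda>n. (f n)\<^sup>2) \<longlonglongrightarrow> 0" by simp
qed

lemma L2_tendsto_iff: "L2_tendsto M u x \<longleftrightarrow> (\<lambda>n. \<integral>y. (cmod (u n y - x y))\<^sup>2 \<partial>M) \<longlonglongrightarrow> 0"
  using tendsto_power2_0_iff[of "\<lambda>n. L2_norm M (\<lambda>y. u n y - x y)"]
  by (simp add: L2_tendsto_def L2_norm_power2)

lemma L2_norm_nonneg: "0 \<le> L2_norm M f"
  by (simp add: L2_norm_def)

text \<open>The factor 2 is inherited from \<open>cmod_le_sqrt\<close> with \<open>t = 0\<close>;
  the bound serves to show that inner products tend to 0.\<close>

lemma cmod_L2_inner_le:
  assumes "u \<in> L2 M" "v \<in> L2 M"
  shows "cmod (L2_inner M u v) \<le> 2 * (L2_norm M u * L2_norm M v)"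
  using L2.cmod_le_sqrt[OF assms] by (simp add: Re_L2_inner_self L2_norm_def)

lemma L2_tendsto_inner:
  assumes "L2_tendsto M u x" "\<And>n. u n \<in> L2 M" "x \<in> L2 M" "v \<in> L2 M"
  shows "(\<lambda>n. L2_inner M (u n) v) \<longlonglongrightarrow> L2_inner M x v"
proof (rule LIM_zero_cancel, rule Lim_null_comparison)
  show "\<forall>\<^sub>F n in sequentially. norm (L2_inner M (u n) v - L2_inner M x v) \<le> 2 * (L2_norm M (\<lambda>y. u n y - x y) * L2_norm M v)"
  proof (intro always_eventually allI)
    fix n
    have "L2_inner M (u n) v - L2_inner M x v = L2_inner M (\<lambda>y. u n y - x y) v"
      by (rule L2.minus_left[symmetric]) (rule assms)+
    then show "norm (L2_inner M (u n) v - L2_inner M x v) \<le> 2 * (L2_norm M (\<lambda>y. u n y - x y) * L2_norm M v)"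
      using cmod_L2_inner_le[OF L2_diff[OF assms(2,3)] assms(4)] by simp
  qed
  have "(\<lambda>n. 2 * (L2_norm M (\<lambda>y. u n y - x y) * L2_norm M v)) \<longlonglongrightarrow> 2 * (0 * L2_norm M v)"
    using assms(1) unfolding L2_tendsto_def by (intro tendsto_intros)
  then show "(\<lambda>n. 2 * (L2_norm M (\<lambda>y. u n y - x y) * L2_norm M v)) \<longlonglongrightarrow> 0" by simp
qed

lemma L2_inner_commute: "L2_inner M v u = cnj (L2_inner M u v)"
proof -
  have "cnj (L2_inner M u v) = (\<integral>x. cnj (u x * cnj (v x)) \<partial>M)"
    unfolding L2_inner_def by (simp only: Bochner_Integration.integral_cnj[of M "\<lambda>x. u x * cnj (v x)"])
  then show ?thesis by (simp add: L2_inner_def mult.commute)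
qed

lemma L2_tendsto_inner_right:
  assumes "L2_tendsto M u x" "\<And>n. u n \<in> L2 M" "x \<in> L2 M" "v \<in> L2 M"
  shows "(\<lambda>n. L2_inner M v (u n)) \<longlonglongrightarrow> L2_inner M v x"
  using tendsto_cnj[OF L2_tendsto_inner[OF assms]] by (simp add: L2_inner_commute[of M v])

text \<open>The majorant is a multiple of one fixed element because the sequences in question
  multiply a single function by uniformly bounded cut-offs.\<close>

lemma L2_tendsto_dominated:
  assumes w: "w \<in> L2 M" and u: "\<And>n. u n \<in> borel_measurable M" and x: "x \<in> borel_measurable M"
    and le: "\<And>n. AE y in M. cmod (u n y) \<le> C * cmod (w y)"
    and lim: "AE y in M. (\<lambda>n. u n y) \<longlonglongrightarrow> x y"
  shows "L2_tendsto M u x" "x \<in> L2 M" "u n \<in> L2 M"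
proof -
  note [measurable] = u x L2_measurable[OF w]
  show uL: "u n \<in> L2 M" for n by (rule L2_dominated[OF w u le])
  have le': "AE y in M. \<forall>n. cmod (u n y) \<le> C * cmod (w y)" using le by (simp add: AE_all_countable)
  have lex: "AE y in M. cmod (x y) \<le> C * cmod (w y)"
    using lim le'
  proof eventually_elim
    case (elim y)
    have "(\<lambda>n. cmod (u n y)) \<longlonglongrightarrow> cmod (x y)" using elim(1) by (rule tendsto_norm)
    then show ?case using elim(2) by (intro LIMSEQ_le_const2) auto
  qed
  show xL: "x \<in> L2 M" by (rule L2_dominated[OF w x lex])
  have "(\<lambda>n. \<integral>y. (cmod (u n y - x y))\<^sup>2 \<partial>M) \<longlonglongrightarrow> (\<integral>y. 0 \<partial>M)"
  proof (rule integral_dominated_convergence)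
    show "integrable M (\<lambda>y. 4 * C\<^sup>2 * (cmod (w y))\<^sup>2)"
      using L2_square_integrable[OF w] by simp
    show "AE y in M. (\<lambda>n. (cmod (u n y - x y))\<^sup>2) \<longlonglongrightarrow> 0"
      using lim
    proof eventually_elim
      case (elim y)
      have "(\<lambda>n. (cmod (u n y - x y))\<^sup>2) \<longlonglongrightarrow> (cmod (x y - x y))\<^sup>2"
        by (intro tendsto_intros elim)
      then show ?case by simp
    qed
    show "AE y in M. norm ((cmod (u n y - x y))\<^sup>2) \<le> 4 * C\<^sup>2 * (cmod (w y))\<^sup>2" for n
      using le[of n] lex
    proof eventually_elim
      case (elim y)
      have "cmod (u n y - x y) \<le> 2 * C * cmod (w y)"
        using norm_triangle_ineq4[of "u n y" "x y"] elim by simp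
      then have "(cmod (u n y - x y))\<^sup>2 \<le> (2 * C * cmod (w y))\<^sup>2"
        by (intro power_mono) auto
      then show ?case by (simp add: power_mult_distrib)
    qed
  qed measurable
  then show "L2_tendsto M u x" by (simp add: L2_tendsto_iff)
qed

lemma L2_tendsto_triangle:
  assumes "u \<in> L2 M" "v \<in> L2 M" "w \<in> L2 M"
  shows "(\<integral>x. (cmod (u x - w x))\<^sup>2 \<partial>M) \<le> 2 * (\<integral>x. (cmod (u x - v x))\<^sup>2 \<partial>M) + 2 * (\<integral>x. (cmod (v x - w x))\<^sup>2 \<partial>M)"
  using L2.quadratic_triangle[OF assms] by (simp add: Re_L2_inner_self)

text \<open>Boundedness of the terms alone gives \<open>h k \<le> sqrt K * sqrt (1/2) ^ k\<close>, a
  geometric series. The weight \<open>2 ^ k\<close> is the device that passes from squares, which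
  integrals in L2 control, to the distances themselves.\<close>

lemma summable_dist_of_weighted_squares:
  fixes h :: "nat \<Rightarrow> real"
  assumes h: "\<And>k. 0 \<le> h k" and s: "summable (\<lambda>k. 2 ^ k * (h k)\<^sup>2)"
  shows "summable h"
proof -
  have "Bseq (\<lambda>k. 2 ^ k * (h k)\<^sup>2)"
    using summable_LIMSEQ_zero[OF s] convergent_imp_Bseq convergentI by blast
  then obtain K where K: "K > 0" "\<And>k. 2 ^ k * (h k)\<^sup>2 \<le> K"
    by (auto simp: Bseq_def)
  have "h k \<le> sqrt K * sqrt (1/2) ^ k" for k
  proof (rule power2_le_imp_le)
    have "(h k)\<^sup>2 \<le> K / 2 ^ k" using K(2)[of k] by (simp add: field_simps)
    also have "\<dots> = K * ((sqrt (1/2))\<^sup>2) ^ k"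
      by (simp add: power_divide)
    also have "\<dots> = (sqrt K * sqrt (1/2) ^ k)\<^sup>2"
      unfolding power_mult[symmetric] power_mult_distrib mult.commute[of 2 k] using K(1) by simp
    finally show "(h k)\<^sup>2 \<le> (sqrt K * sqrt (1/2) ^ k)\<^sup>2" .
  qed (use K in simp)
  moreover have "summable (\<lambda>k. sqrt K * sqrt (1/2) ^ k)"
    by (intro summable_mult summable_geometric) (simp add: real_sqrt_lt_1_iff)
  ultimately show ?thesis
    using h by (rule_tac summable_comparison_test'[where g = "\<lambda>k. sqrt K * sqrt (1/2) ^ k" and N = 0]) auto
qed

text \<open>The Riesz-Fischer argument: a fast subsequence converges almost everywhere, and Fatou's
  lemma turns the Cauchy estimate into an estimate for the limit. Squared distances below
  \<open>(1/4) ^ k\<close> leave \<open>(1/2) ^ k\<close> after the weight \<open>2 ^ k\<close>,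
  hence a convergent sum.\<close>

lemma L2_complete:
  assumes f: "\<And>n. f n \<in> L2 M"
    and Cauchy: "\<And>e. e > 0 \<Longrightarrow> \<exists>N. \<forall>m\<ge>N. \<forall>n\<ge>N. (\<integral>x. (cmod (f m x - f n x))\<^sup>2 \<partial>M) < e"
  obtains g where "g \<in> L2 M" "L2_tendsto M f g"
proof -
  note [measurable] = f[THEN L2_measurable]
  have nn: "(\<integral>\<^sup>+x. ennreal ((cmod (f m x - f n x))\<^sup>2) \<partial>M) = ennreal (\<integral>x. (cmod (f m x - f n x))\<^sup>2 \<partial>M)" for m n
    by (intro nn_integral_eq_integral L2_square_integrable L2_diff f) auto
  have "\<forall>k::nat. \<exists>N. \<forall>m\<ge>N. \<forall>n\<ge>N. (\<integral>x. (cmod (f m x - f n x))\<^sup>2 \<partial>M) < (1/4) ^ k"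
    by (intro allI Cauchy) simp
  from choice[OF this] obtain N
    where "\<forall>k::nat. \<forall>m\<ge>N k. \<forall>n\<ge>N k. (\<integral>x. (cmod (f m x - f n x))\<^sup>2 \<partial>M) < (1/4) ^ k" ..
  then have N: "\<And>k m n. m \<ge> N k \<Longrightarrow> n \<ge> N k \<Longrightarrow> (\<integral>x. (cmod (f m x - f n x))\<^sup>2 \<partial>M) < (1/4) ^ k"
    by blast
  \<comment> \<open>The sum puts \<open>r k\<close> beyond \<open>N k\<close> and makes
    \<open>r\<close> monotone; the summand \<open>k\<close> makes it unbounded.\<close>
  define r where "r k = (\<Sum>i\<le>k. N i) + k" for k
  have rN: "N k \<le> r k" for k unfolding r_def
    using member_le_sum[of k "{..k}" N] by simp
  have r_mono: "r k \<le> r (Suc k)" for k by (simp add: r_def)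
  have r_ge: "k \<le> r k" for k by (simp add: r_def)
  define h where "h k x = cmod (f (r (Suc k)) x - f (r k) x)" for k x
  have [measurable]: "h k \<in> borel_measurable M" for k unfolding h_def by measurable
  have "(\<integral>\<^sup>+x. (\<Sum>k. ennreal (2 ^ k * (h k x)\<^sup>2)) \<partial>M) = (\<Sum>k. \<integral>\<^sup>+x. ennreal (2 ^ k * (h k x)\<^sup>2) \<partial>M)"
    by (rule nn_integral_suminf) measurable
  also have "\<dots> \<le> (\<Sum>k. ennreal ((1/2) ^ k))"
  proof (intro suminf_le allI summableI)
    fix k
    have "(\<integral>\<^sup>+x. ennreal (2 ^ k * (h k x)\<^sup>2) \<partial>M) = ennreal (2 ^ k) * (\<integral>\<^sup>+x. ennreal ((h k x)\<^sup>2) \<partial>M)"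
      by (subst nn_integral_cmult[symmetric]) (auto simp: ennreal_mult)
    also have "\<dots> \<le> ennreal (2 ^ k) * ennreal ((1/4) ^ k)"
      unfolding h_def nn using N[of k "r (Suc k)" "r k"] rN[of k] r_mono[of k]
      by (intro mult_left_mono ennreal_leI) auto
    also have "\<dots> = ennreal ((1/2) ^ k)"
      by (simp add: ennreal_mult[symmetric] power_mult_distrib[symmetric])
    finally show "(\<integral>\<^sup>+x. ennreal (2 ^ k * (h k x)\<^sup>2) \<partial>M) \<le> ennreal ((1/2) ^ k)" .
  qed
  also have "\<dots> < \<infinity>"
    by (subst suminf_ennreal2) (auto intro: summable_geometric)
  finally have "AE x in M. (\<Sum>k. ennreal (2 ^ k * (h k x)\<^sup>2)) \<noteq> \<infinity>"
    by (intro nn_integral_PInf_AE) (auto simp: less_top)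
  then have conv: "AE x in M. convergent (\<lambda>k. f (r k) x)"
  proof eventually_elim
    case (elim x)
    have "summable (\<lambda>k. 2 ^ k * (h k x)\<^sup>2)"
      using elim by (intro summable_suminf_not_top) auto
    then have "summable (\<lambda>k. h k x)"
      by (rule summable_dist_of_weighted_squares[rotated]) (simp add: h_def)
    then have "summable (\<lambda>k. f (r (Suc k)) x - f (r k) x)"
      unfolding h_def by (rule summable_norm_cancel)
    then have "convergent (\<lambda>n. f (r n) x - f (r 0) x)"
      unfolding summable_iff_convergent by (simp only: sum_lessThan_telescope[of "\<lambda>k. f (r k) x"])
    from convergent_add[OF this convergent_const[of "f (r 0) x"]] show ?case by simp
  qed
  define F where "F x = lim (\<lambda>k. f (r k) x)" for x
  have [measurable]: "F \<in> borel_measurable M"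
    unfolding F_def by (intro borel_measurable_lim_metric) measurable
  have lim: "AE x in M. (\<lambda>k. f (r k) x) \<longlonglongrightarrow> F x"
    using conv by eventually_elim (simp add: F_def convergent_LIMSEQ_iff)
  \<comment> \<open>Fatou is applied in the subsequence index with \<open>n\<close> fixed, so the
    estimate holds for the whole sequence and no separate passage from the subsequence is
    required.\<close>
  have est: "(\<integral>\<^sup>+x. ennreal ((cmod (F x - f n x))\<^sup>2) \<partial>M) \<le> ennreal ((1/4) ^ k)" if "n \<ge> N k" for n k
  proof -
    have "(\<integral>\<^sup>+x. ennreal ((cmod (F x - f n x))\<^sup>2) \<partial>M) = (\<integral>\<^sup>+x. liminf (\<lambda>j. ennreal ((cmod (f (r j) x - f n x))\<^sup>2)) \<partial>M)"
    proof (rule nn_integral_cong_AE)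
      show "AE x in M. ennreal ((cmod (F x - f n x))\<^sup>2) = liminf (\<lambda>j. ennreal ((cmod (f (r j) x - f n x))\<^sup>2))"
        using lim
      proof eventually_elim
        case (elim x)
        have "(\<lambda>j. ennreal ((cmod (f (r j) x - f n x))\<^sup>2)) \<longlonglongrightarrow> ennreal ((cmod (F x - f n x))\<^sup>2)"
          by (intro tendsto_intros elim)
        then show ?case by (rule lim_imp_Liminf[OF trivial_limit_sequentially, symmetric])
      qed
    qed
    also have "\<dots> \<le> liminf (\<lambda>j. \<integral>\<^sup>+x. ennreal ((cmod (f (r j) x - f n x))\<^sup>2) \<partial>M)"
      by (intro nn_integral_liminf) measurable
    also have "\<dots> \<le> limsup (\<lambda>j. \<integral>\<^sup>+x. ennreal ((cmod (f (r j) x - f n x))\<^sup>2) \<partial>M)"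
      by (rule Liminf_le_Limsup) simp
    also have "\<dots> \<le> ennreal ((1/4) ^ k)"
    proof (rule Limsup_bounded)
      show "\<forall>\<^sub>F j in sequentially. (\<integral>\<^sup>+x. ennreal ((cmod (f (r j) x - f n x))\<^sup>2) \<partial>M) \<le> ennreal ((1/4) ^ k)"
        unfolding nn eventually_sequentially
        using N[of k _ n] r_ge that by (intro exI[of _ "N k"] allI impI ennreal_leI less_imp_le) (meson order_trans)
    qed
    finally show ?thesis .
  qed
  have diff: "(\<lambda>x. F x - f n x) \<in> L2 M" if "n \<ge> N 0" for n
    unfolding L2_def using est[OF that]
    by (auto intro!: integrableI_bounded simp: le_less_trans)
  have "F \<in> L2 M"
    using L2_add[OF diff[of "N 0"] f[of "N 0"]] by simp
  moreover have "L2_tendsto M f F"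
    unfolding L2_tendsto_iff
  proof (rule LIMSEQ_I)
    fix e :: real assume "e > 0"
    then obtain k where k: "(1/4) ^ k < e" using real_arch_pow_inv[of e "1/4"] by auto
    have "norm ((\<integral>x. (cmod (f n x - F x))\<^sup>2 \<partial>M) - 0) < e" if "n \<ge> N k" for n
    proof -
      have "ennreal (\<integral>x. (cmod (F x - f n x))\<^sup>2 \<partial>M) = (\<integral>\<^sup>+x. ennreal ((cmod (F x - f n x))\<^sup>2) \<partial>M)"
        by (intro nn_integral_eq_integral[symmetric] L2_square_integrable L2_diff f \<open>F \<in> L2 M\<close>) auto
      also have "\<dots> \<le> ennreal ((1/4) ^ k)" using est[OF that] .
      finally have "(\<integral>x. (cmod (F x - f n x))\<^sup>2 \<partial>M) \<le> (1/4) ^ k" by simp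
      then show ?thesis using k by (simp add: norm_minus_commute)
    qed
    then show "\<exists>no. \<forall>n\<ge>no. norm ((\<integral>x. (cmod (f n x - F x))\<^sup>2 \<partial>M) - 0) < e" by blast
  qed
  ultimately show ?thesis by (rule that)
qed

section \<open>Closed subspaces\<close>

definition closed_L2_subspace :: "'a measure \<Rightarrow> ('a \<Rightarrow> complex) set \<Rightarrow> bool" where
  "closed_L2_subspace M T \<longleftrightarrow> T \<subseteq> L2 M \<and> (\<lambda>_. 0) \<in> T \<and>
     (\<forall>u\<in>T. \<forall>v\<in>T. (\<lambda>x. u x + v x) \<in> T) \<and> (\<forall>u\<in>T. \<forall>k. (\<lambda>x. k * u x) \<in> T) \<and>
     (\<forall>u x. (\<forall>n. u n \<in> T) \<longrightarrow> x \<in> L2 M \<longrightarrow> L2_tendsto M u x \<longrightarrow> x \<in> T)"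

text \<open>Orthogonality to all truncations of \<open>p\<close> says that \<open>q * cnj p\<close>
  has integral 0 over every measurable set.\<close>

lemma orthogonal_indicator_multiples:
  assumes "sigma_finite_measure M" "q \<in> L2 M" "p \<in> L2 M"
    and orth: "\<And>A. A \<in> sets M \<Longrightarrow> L2_inner M q (\<lambda>x. indicator A x * p x) = 0"
  shows "AE x in M. q x * cnj (p x) = 0"
proof -
  interpret sigma_finite_measure M by fact
  show ?thesis
  proof (rule density_zero)
    show "integrable M (\<lambda>x. q x * cnj (p x))" by (rule integrable_inner_L2) fact+
    fix A assume A: "A \<in> sets M"
    have "set_lebesgue_integral M A (\<lambda>x. q x * cnj (p x)) = L2_inner M q (\<lambda>x. indicator A x * p x)"
      unfolding set_lebesgue_integral_def L2_inner_def
      by (intro Bochner_Integration.integral_cong) (auto simp: indicator_def)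
    with orth[OF A] show "set_lebesgue_integral M A (\<lambda>x. q x * cnj (p x)) = 0" by simp
  qed
qed

context
  fixes M :: "'a measure" and T
  assumes T: "closed_L2_subspace M T"
begin

lemma subspace_L2: "u \<in> T \<Longrightarrow> u \<in> L2 M"
  and subspace_zero: "(\<lambda>_. 0) \<in> T"
  and subspace_add: "u \<in> T \<Longrightarrow> v \<in> T \<Longrightarrow> (\<lambda>x. u x + v x) \<in> T"
  and subspace_scale: "u \<in> T \<Longrightarrow> (\<lambda>x. k * u x) \<in> T"
  using T by (auto simp: closed_L2_subspace_def)

lemma subspace_closed: "(\<And>n. w n \<in> T) \<Longrightarrow> x \<in> L2 M \<Longrightarrow> L2_tendsto M w x \<Longrightarrow> x \<in> T"
  using T unfolding closed_L2_subspace_def by blast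

lemma subspace_minus: "u \<in> T \<Longrightarrow> v \<in> T \<Longrightarrow> (\<lambda>x. u x - v x) \<in> T"
  using subspace_add[OF _ subspace_scale[of v "-1"], of u] by simp

text \<open>The constant sequence \<open>u\<close> converges in L2 to every function that equals
  \<open>u\<close> almost everywhere, so sequential closedness already contains this
  invariance.\<close>

lemma subspace_AE_eq:
  assumes "u \<in> T" "v \<in> borel_measurable M" "AE x in M. u x = v x"
  shows "v \<in> T"
proof -
  note [measurable] = assms(2) L2_measurable[OF subspace_L2[OF assms(1)]]
  have v: "v \<in> L2 M"
    using assms(3) by (intro L2_dominated[OF subspace_L2[OF assms(1)] assms(2), of 1]) auto
  moreover have "(\<integral>x. (cmod (u x - v x))\<^sup>2 \<partial>M) = (\<integral>x. 0 \<partial>M)"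
    by (intro integral_cong_AE) (use assms(3) in \<open>measurable, auto\<close>)
  then have "L2_tendsto M (\<lambda>_. u) v" by (simp add: L2_tendsto_iff)
  ultimately show ?thesis using subspace_closed[of "\<lambda>_. u"] assms(1) by blast
qed

text \<open>The sets \<open>h - T\<close> are midpoint-convex, so almost minimizers of the norm on
  them form a Cauchy sequence; here the decreasing sequence of sets is constant. Orthogonality is
  the usual variational argument at the minimum.\<close>

lemma orthogonal_projection:
  assumes h: "h \<in> L2 M"
  obtains p where "p \<in> T" "\<And>v. v \<in> T \<Longrightarrow> L2_inner M (\<lambda>x. h x - p x) v = 0"
proof -
  let ?q = "\<lambda>u. Re (L2_inner M u u)"
  define C where "C = (\<lambda>v x. h x - v x) ` T"
  have C_L2: "C \<subseteq> L2 M"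
    using h subspace_L2 by (auto simp: C_def intro: L2_diff)
  have mid: "(\<lambda>x. (u x + v x) / 2) \<in> C" if uv: "u \<in> C" "v \<in> C" for u v
  proof -
    obtain u' v' where u': "u = (\<lambda>x. h x - u' x)" "u' \<in> T" and v': "v = (\<lambda>x. h x - v' x)" "v' \<in> T"
      using uv by (auto simp: C_def)
    have "(\<lambda>x. 1 / 2 * (u' x + v' x)) \<in> T"
      by (intro subspace_scale subspace_add u' v')
    moreover have "(\<lambda>x. (u x + v x) / 2) = (\<lambda>x. h x - 1 / 2 * (u' x + v' x))"
      by (simp add: u' v' field_simps fun_eq_iff)
    ultimately show ?thesis unfolding C_def by (rule rev_image_eqI[where f = "\<lambda>v x. h x - v x"])
  qed
  have h_C: "h \<in> C" unfolding C_def by (rule rev_image_eqI[OF subspace_zero]) simp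
  obtain g where g: "\<And>n. g n \<in> C" "\<And>n. ?q (g n) \<le> (INF u\<in>C. ?q u) + inverse (Suc n)"
      and Cauchy: "\<And>e. e > 0 \<Longrightarrow> \<exists>N. \<forall>m\<ge>N. \<forall>n\<ge>N. ?q (\<lambda>x. g m x - g n x) < e"
    using h_C by (rule_tac L2.almost_minimizers_Cauchy[of "\<lambda>_. C" M "?q h"]) (use C_L2 mid in blast)+
  have "\<forall>n. \<exists>p. g n = (\<lambda>x. h x - p x) \<and> p \<in> T" using g(1) by (auto simp: C_def)
  from choice[OF this] obtain p where p: "\<And>n. g n = (\<lambda>x. h x - p n x)" "\<And>n. p n \<in> T" by auto
  have pL: "p n \<in> L2 M" for n using p subspace_L2 by auto
  have "\<exists>N. \<forall>m\<ge>N. \<forall>n\<ge>N. (\<integral>x. (cmod (p m x - p n x))\<^sup>2 \<partial>M) < e" if "e > 0" for e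
  proof -
    have "?q (\<lambda>x. g m x - g n x) = (\<integral>x. (cmod (p m x - p n x))\<^sup>2 \<partial>M)" for m n
      unfolding Re_L2_inner_self p by (simp add: norm_minus_commute)
    with Cauchy[OF that] show ?thesis by simp
  qed
  from L2_complete[OF pL this] obtain P where P: "P \<in> L2 M" "L2_tendsto M p P" by blast
  have PT: "P \<in> T" by (rule subspace_closed[OF p(2) P])
  have gL: "g n \<in> L2 M" for n using g C_L2 by auto
  have hP: "(\<lambda>x. h x - P x) \<in> L2 M" by (intro L2_diff h P)
  have gP: "L2_tendsto M g (\<lambda>x. h x - P x)"
    using P(2) unfolding L2_tendsto_iff p by (simp add: norm_minus_commute)
  have "L2_inner M (\<lambda>x. h x - P x) v = 0" if v: "v \<in> T" for v
  proof (rule ccontr)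
    have vL: "v \<in> L2 M" by (rule subspace_L2[OF v])
    define \<beta> where "\<beta> = L2_inner M (\<lambda>x. h x - P x) v"
    assume "L2_inner M (\<lambda>x. h x - P x) v \<noteq> 0"
    then have \<beta>: "\<beta> \<noteq> 0" by (simp add: \<beta>_def)
    \<comment> \<open>Varying in direction \<open>v\<close> by \<open>s * \<beta>\<close> leads to
      \<open>2 \<le> s * ?q v\<close> if \<open>\<beta>\<close> is not 0. This choice of
      \<open>s\<close> keeps \<open>s * ?q v\<close> below 1, and the added 1 avoids division by
      0.\<close>
    define s where "s = 1 / (?q v + 1)"
    have qv: "?q v \<ge> 0" by (rule L2.nonneg[OF vL])
    have s: "s > 0" using qv by (simp add: s_def)
    define k where "k = of_real s * \<beta>"
    \<comment> \<open>The variation is carried out at the almost minimizer \<open>g n\<close>, at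
      the cost of its slack \<open>inverse (Suc n)\<close>; the limit in \<open>n\<close> is taken
      afterwards.\<close>
    have var: "2 * Re (cnj k * L2_inner M (g n) v) \<le> (cmod k)\<^sup>2 * ?q v + inverse (Suc n)" for n
    proof -
      have kv: "(\<lambda>x. k * v x) \<in> L2 M" by (rule L2_scale[OF vL])
      have "(\<lambda>x. h x - (p n x + k * v x)) \<in> C"
        unfolding C_def by (rule imageI) (intro subspace_add p(2) subspace_scale v)
      then have "(\<lambda>x. g n x - k * v x) \<in> C" by (simp add: p diff_diff_eq)
      then have "(INF u\<in>C. ?q u) \<le> ?q (\<lambda>x. g n x - k * v x)"
        using C_L2 L2.nonneg by (intro cINF_lower bdd_belowI2[of _ 0]) blast+
      moreover have "?q (\<lambda>x. g n x - k * v x) = ?q (g n) - 2 * Re (cnj k * L2_inner M (g n) v) + (cmod k)\<^sup>2 * ?q v"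
      proof -
        have "Re (L2_inner M (\<lambda>x. k * v x) (g n)) = Re (L2_inner M (g n) (\<lambda>x. k * v x))"
          by (subst L2_inner_commute) simp
        then show ?thesis
          using L2.quadratic_scale[OF vL, of k]
          unfolding L2.minus_left[OF gL kv L2_diff[OF gL kv]] L2.minus_right[OF gL kv gL] L2.minus_right[OF gL kv kv]
          by (simp add: L2.scale_right[OF vL gL])
      qed
      ultimately show ?thesis using g(2)[of n] by linarith
    qed
    have "2 * Re (cnj k * \<beta>) \<le> (cmod k)\<^sup>2 * ?q v + 0"
    proof (rule LIMSEQ_le)
      show "(\<lambda>n. 2 * Re (cnj k * L2_inner M (g n) v)) \<longlonglongrightarrow> 2 * Re (cnj k * \<beta>)"
        unfolding \<beta>_def by (intro tendsto_intros L2_tendsto_inner[OF gP gL hP vL])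
      show "(\<lambda>n. (cmod k)\<^sup>2 * ?q v + inverse (Suc n)) \<longlonglongrightarrow> (cmod k)\<^sup>2 * ?q v + 0"
        by (intro tendsto_intros LIMSEQ_inverse_real_of_nat)
    qed (use var in auto)
    moreover have "Re (cnj k * \<beta>) = s * (cmod \<beta>)\<^sup>2"
    proof -
      have "cnj k * \<beta> = of_real s * (\<beta> * cnj \<beta>)" by (simp add: k_def)
      also have "\<dots> = of_real (s * (cmod \<beta>)\<^sup>2)" by (simp only: complex_norm_square of_real_mult)
      finally show ?thesis by simp
    qed
    moreover have "(cmod k)\<^sup>2 = s * (cmod \<beta>)\<^sup>2 * s"
      by (simp add: k_def norm_mult power_mult_distrib power2_eq_square)
    ultimately have "s * (cmod \<beta>)\<^sup>2 * 2 \<le> s * (cmod \<beta>)\<^sup>2 * (s * ?q v)"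
      by (simp add: mult_ac)
    then have "2 \<le> s * ?q v"
      using s \<beta> by (subst (asm) mult_le_cancel_left_pos) auto
    moreover have "s * ?q v \<le> 1" using qv by (simp add: s_def)
    ultimately show False by simp
  qed
  with PT show ?thesis by (rule that)
qed

text \<open>If \<open>p\<close> is the orthogonal projection onto \<open>T\<close> of a strictly positive \<open>h\<close>, then \<open>p = h\<close> on the set
  \<open>p \<noteq> 0\<close>, and this is the largest set on which elements of \<open>T\<close> live.\<close>

lemma indicator_invariant_subspace:
  assumes sf: "sigma_finite_measure M"
    and inv: "\<And>A u. A \<in> sets M \<Longrightarrow> u \<in> T \<Longrightarrow> (\<lambda>x. indicator A x * u x) \<in> T"
  obtains G where "G \<in> sets M" "T = {u \<in> L2 M. AE x in M. x \<in> G \<longrightarrow> u x = 0}"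
proof -
  interpret sigma_finite_measure M by fact
  \<comment> \<open>Sigma-finiteness provides a strictly positive integrable function; its square
    root is square-integrable and has no zeros.\<close>
  obtain h0 where h0: "h0 \<in> borel_measurable M" "\<And>x. x \<in> space M \<Longrightarrow> h0 x \<noteq> (0::complex)" "h0 \<in> L2 M"
  proof -
    obtain w :: "'a \<Rightarrow> real" where w: "w \<in> borel_measurable M" "\<And>x. 0 < w x" "integrable M w"
      by (rule obtain_positive_integrable_function) blast
    have "(\<lambda>x. complex_of_real (sqrt (w x))) \<in> borel_measurable M" using w(1) by measurable
    moreover have "complex_of_real (sqrt (w x)) \<noteq> 0" for x using w(2)[of x] by simp
    moreover have "(\<lambda>x. complex_of_real (sqrt (w x))) \<in> L2 M"
      using w by (simp add: L2_def less_imp_le)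
    ultimately show ?thesis using that by blast
  qed
  obtain p where p: "p \<in> T" "\<And>v. v \<in> T \<Longrightarrow> L2_inner M (\<lambda>x. h0 x - p x) v = 0"
    using orthogonal_projection[OF h0(3)] by blast
  have pL: "p \<in> L2 M" by (rule subspace_L2[OF p(1)])
  have [measurable]: "p \<in> borel_measurable M" by (rule L2_measurable[OF pL])
  have q: "(\<lambda>x. h0 x - p x) \<in> L2 M" by (rule L2_diff[OF h0(3) pL])
  have disj: "AE x in M. (h0 x - p x) * cnj (v x) = 0" if "v \<in> T" for v
    by (rule orthogonal_indicator_multiples[OF sf q subspace_L2[OF that] p(2)[OF inv[OF _ that]]])
  \<comment> \<open>For \<open>v\<close> in \<open>T\<close> the residual \<open>h0 - p\<close>
    vanishes almost everywhere where \<open>v\<close> does not. On \<open>G\<close> the residual is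
    \<open>h0\<close>, which has no zeros, so every \<open>v\<close> in \<open>T\<close> vanishes
    there.\<close>
  define G where "G = {x \<in> space M. p x = 0}"
  have G: "G \<in> sets M" unfolding G_def by measurable
  have vanish: "AE x in M. x \<in> G \<longrightarrow> v x = 0" if "v \<in> T" for v
    using disj[OF that] AE_space
    by eventually_elim (use h0(2) in \<open>auto simp: G_def\<close>)
  \<comment> \<open>Conversely, let \<open>r\<close> be the projection of \<open>u\<close>. The
    residual \<open>u - r\<close> is orthogonal to all truncations of \<open>p\<close>, hence 0 off
    \<open>G\<close>, while on \<open>G\<close> both \<open>u\<close> and \<open>r\<close> vanish.
    So \<open>u\<close> equals \<open>r\<close>.\<close>
  have "u \<in> T" if u: "u \<in> L2 M" "AE x in M. x \<in> G \<longrightarrow> u x = 0" for u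
  proof -
    obtain r where r: "r \<in> T" "\<And>v. v \<in> T \<Longrightarrow> L2_inner M (\<lambda>x. u x - r x) v = 0"
      using orthogonal_projection[OF u(1)] by blast
    have "AE x in M. (u x - r x) * cnj (p x) = 0"
      by (rule orthogonal_indicator_multiples[OF sf L2_diff[OF u(1) subspace_L2[OF r(1)]] pL r(2)[OF inv[OF _ p(1)]]])
    then have "AE x in M. r x = u x"
      using u(2) vanish[OF r(1)] AE_space
      by eventually_elim (auto simp: G_def)
    then show ?thesis by (rule subspace_AE_eq[OF r(1) L2_measurable[OF u(1)]])
  qed
  then have "T = {u \<in> L2 M. AE x in M. x \<in> G \<longrightarrow> u x = 0}"
    using vanish subspace_L2 by blast
  with G show ?thesis by (rule that)
qed

text \<open>Boxes are stable under intersection and generate the Borel sets, so it suffices to treat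
  complements and disjoint unions. Complements use subtraction, and unions use closedness, with
  \<open>u\<close> dominating the partial sums. The map \<open>emb\<close> gives coordinates to the
  points of an abstract measure space; in both applications it is the identity.\<close>

lemma indicator_box_invariant_imp_borel:
  fixes emb :: "'a \<Rightarrow> real^'n"
  assumes emb [measurable]: "emb \<in> borel_measurable M"
    and box: "\<And>u a b. u \<in> T \<Longrightarrow> (\<lambda>x. indicator (box a b) (emb x) * u x) \<in> T"
    and A: "A \<in> sets borel" and u: "u \<in> T"
  shows "(\<lambda>x. indicator A (emb x) * u x) \<in> T"
proof -
  let ?G = "range (\<lambda>(a, b). box a b :: (real^'n) set)"
  have "Int_stable ?G"
    by (auto simp: Int_stable_def Int_interval box_Int_box)
  moreover have "?G \<subseteq> Pow UNIV" by simp
  moreover have "A \<in> sigma_sets UNIV ?G" using A unfolding borel_eq_box by simp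
  ultimately show ?thesis
  proof (induction rule: sigma_sets_induct_disjoint)
    case (basic A)
    then show ?case using box[OF u] by auto
  next
    case empty
    then show ?case by (simp add: subspace_zero)
  next
    case (compl A)
    have "(\<lambda>x. u x - indicator A (emb x) * u x) = (\<lambda>x. indicator (UNIV - A) (emb x) * u x)"
      by (auto simp: fun_eq_iff indicator_def)
    with subspace_minus[OF u compl.IH] show ?case by simp
  next
    case (union A)
    have bo: "A i \<in> sets borel" for i using union(2) unfolding borel_eq_box by auto
    have uL: "u \<in> L2 M" by (rule subspace_L2[OF u])
    note [measurable] = L2_measurable[OF uL] bo
    have eq: "indicator (\<Union>i<n. A i) (emb x) = (\<Sum>i<n. indicator (A i) (emb x) :: complex)" for n x
      using union(1) by (intro indicator_UN_disjoint) (auto simp: disjoint_family_on_def)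
    have sumT: "(\<lambda>x. (\<Sum>i<n. indicator (A i) (emb x)) * u x) \<in> T" for n :: nat
    proof (induction n)
      case (Suc n)
      from subspace_add[OF this union.IH[of n]] show ?case by (simp add: distrib_right)
    qed (simp add: subspace_zero)
    have bU [measurable]: "(\<Union>i<n. A i) \<in> sets borel" "\<Union>(range A) \<in> sets borel" for n
      using bo by auto
    have ind: "(\<lambda>x. indicator B (emb x) * u x) \<in> borel_measurable M" if [measurable]: "B \<in> sets borel" for B
      by measurable
    have lim: "AE y in M. (\<lambda>n. indicator (\<Union>i<n. A i) (emb y) * u y) \<longlonglongrightarrow> indicator (\<Union>(range A)) (emb y) * u y"
      by (intro AE_I2 tendsto_intros LIMSEQ_indicator_UN)
    have le: "AE y in M. cmod (indicator (\<Union>i<n. A i) (emb y) * u y) \<le> 1 * cmod (u y)" for n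
      by (auto simp: norm_mult indicator_def)
    note L2_tendsto_dominated(1,2)[OF uL ind[OF bU(1)] ind[OF bU(2)] le lim]
    moreover have "(\<lambda>x. indicator (\<Union>i<n. A i) (emb x) * u x) \<in> T" for n
      using sumT[of n] by (simp only: eq)
    ultimately show ?case by (rule_tac subspace_closed)
  qed
qed

end

section \<open>Test functions\<close>

text \<open>The derivatives of \<open>t \<mapsto> exp (- 1 / t)\<close>, extended by zero, are linear combinations of these.\<close>

definition flat :: "nat \<Rightarrow> real \<Rightarrow> real" where
  "flat n t = (if t > 0 then inverse t ^ n * exp (- inverse t) else 0)"

lemma flat_tendsto_0: "(flat n \<longlongrightarrow> 0) (at 0)"
proof (rule filterlim_split_at)
  have "\<forall>\<^sub>F t in at_left (0::real). flat n t = 0"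
    by (auto simp: eventually_at_filter flat_def)
  then show "(flat n \<longlongrightarrow> 0) (at_left 0)" by (rule tendsto_eventually)
  have "((\<lambda>t. inverse t ^ n / exp (inverse t)) \<longlongrightarrow> (0::real)) (at_right 0)"
    by (rule filterlim_compose[OF tendsto_power_div_exp_0 filterlim_inverse_at_top_right])
  moreover have "\<forall>\<^sub>F t in at_right (0::real). inverse t ^ n / exp (inverse t) = flat n t"
    by (auto simp: eventually_at_filter flat_def exp_minus divide_inverse)
  ultimately show "(flat n \<longlongrightarrow> 0) (at_right 0)" by (rule Lim_transform_eventually)
qed

text \<open>Up to linear combinations the family is closed under differentiation, which is what an
  induction for smoothness requires. At the origin the difference quotient of \<open>flat n\<close>
  is \<open>flat (n + 1)\<close>, whose limit is known to be 0.\<close>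

lemma flat_has_derivative:
  "(flat n has_real_derivative flat (n + 2) t - real n * flat (n + 1) t) (at t)"
proof (rule linorder_cases[of t 0])
  assume t: "t < 0"
  have "(flat n has_real_derivative 0) (at t)"
    by (rule has_field_derivative_transform_within_open[of "\<lambda>_. 0" 0 t "{..<0}"])
      (use t in \<open>auto simp: flat_def\<close>)
  with t show ?thesis by (simp add: flat_def)
next
  assume t: "t = 0"
  have "((\<lambda>h. (flat n (0 + h) - flat n 0) / h) \<longlongrightarrow> 0) (at 0)"
  proof (rule Lim_transform_eventually[OF flat_tendsto_0[of "n + 1"]])
    show "\<forall>\<^sub>F h in at 0. flat (n + 1) h = (flat n (0 + h) - flat n 0) / h"
      by (auto simp: flat_def divide_inverse eventually_at_filter)
  qed
  with t show ?thesis by (simp add: DERIV_def flat_def)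
next
  assume t: "t > 0"
  have "((\<lambda>t. inverse t ^ n * exp (- inverse t)) has_real_derivative flat (n + 2) t - real n * flat (n + 1) t) (at t)"
    using t by (auto intro!: derivative_eq_intros simp: flat_def power2_eq_square)
      (cases n, auto simp: algebra_simps)
  then show ?thesis
    by (rule has_field_derivative_transform_within_open[of _ _ t "{0<..}"])
      (use t in \<open>auto simp: flat_def\<close>)
qed

section \<open>Calculus of k-times continuously differentiable functions\<close>

lemma partial_deriv_eq: "(f has_derivative f') (at x) \<Longrightarrow> partial_deriv i f x = f' (axis i 1)"
  by (simp add: partial_deriv_def frechet_derivative_at[symmetric])

lemma has_derivative_frechet: "f differentiable at x \<Longrightarrow> (f has_derivative frechet_derivative f (at x)) (at x)"
  by (simp add: frechet_derivative_works)

lemma differentiable_imp_Ck_0: "(\<And>x. f differentiable at x) \<Longrightarrow> Ck 0 f"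
  by (auto intro!: differentiable_imp_continuous_on differentiable_at_imp_differentiable_on)

lemma Ck_SucD: "Ck (Suc k) f \<Longrightarrow> Ck k f"
proof (induction k arbitrary: f)
  case 0
  then show ?case by (intro differentiable_imp_Ck_0) simp
next
  case (Suc k)
  then have "Ck k (partial_deriv i f)" for i by simp
  then show ?case using Suc.prems Suc.IH by auto
qed

lemma Ck_const: "Ck k (\<lambda>_::real^'n. c)"
proof (induction k arbitrary: c)
  case (Suc k)
  have "partial_deriv i (\<lambda>_::real^'n. c) = (\<lambda>_. 0)" for i
    by (simp add: fun_eq_iff partial_deriv_def)
  with Suc show ?case by simp
qed simp

lemma partial_deriv_add:
  assumes "f differentiable at x" "g differentiable at x"
  shows "partial_deriv i (\<lambda>x. f x + g x) x = partial_deriv i f x + partial_deriv i g x"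
  using partial_deriv_eq[OF has_derivative_add[OF assms[THEN has_derivative_frechet]], of i]
  by (simp add: partial_deriv_def)

lemma partial_deriv_mult:
  assumes "f differentiable at x" "g differentiable at x"
  shows "partial_deriv i (\<lambda>x. f x * g x) x = f x * partial_deriv i g x + partial_deriv i f x * g x"
  using partial_deriv_eq[OF has_derivative_mult[OF assms[THEN has_derivative_frechet]], of i]
  by (simp add: partial_deriv_def)

lemma Ck_add: "Ck k f \<Longrightarrow> Ck k g \<Longrightarrow> Ck k (\<lambda>x. f x + g x)"
proof (induction k arbitrary: f g)
  case 0
  then show ?case by (auto intro: continuous_intros)
next
  case (Suc k)
  then have d: "\<And>x. f differentiable at x" "\<And>x. g differentiable at x" by auto
  have "partial_deriv i (\<lambda>x. f x + g x) = (\<lambda>x. partial_deriv i f x + partial_deriv i g x)" for i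
    using d by (auto simp: partial_deriv_add)
  with Suc d show ?case by simp
qed

lemma Ck_mult: "Ck k f \<Longrightarrow> Ck k g \<Longrightarrow> Ck k (\<lambda>x. f x * g x)"
proof (induction k arbitrary: f g)
  case 0
  then show ?case by (auto intro: continuous_intros)
next
  case (Suc k)
  then have d: "\<And>x. f differentiable at x" "\<And>x. g differentiable at x" by auto
  have "partial_deriv i (\<lambda>x. f x * g x) = (\<lambda>x. f x * partial_deriv i g x + partial_deriv i f x * g x)" for i
    using d by (auto simp: partial_deriv_mult)
  moreover have "Ck k (\<lambda>x. f x * partial_deriv i g x + partial_deriv i f x * g x)" for i
    using Suc.prems by (intro Ck_add Suc.IH Ck_SucD[OF Suc.prems(1)] Ck_SucD[OF Suc.prems(2)]) auto
  ultimately show ?case using d by simp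
qed

lemma Ck_prod: "finite I \<Longrightarrow> (\<And>i. i \<in> I \<Longrightarrow> Ck k (f i)) \<Longrightarrow> Ck k (\<lambda>x. \<Prod>i\<in>I. f i x)"
  by (induction I rule: finite_induct) (auto intro: Ck_const Ck_mult)

lemma flat_affine_has_derivative:
  fixes x :: "real^'n"
  shows "((\<lambda>x. complex_of_real (flat n (a * x $ i + b))) has_derivative
    (\<lambda>h. of_real ((flat (n + 2) (a * x $ i + b) - real n * flat (n + 1) (a * x $ i + b)) * (a * h $ i)))) (at x)"
proof -
  have "((\<lambda>x. a * x $ i + b) has_derivative (\<lambda>h. a * h $ i)) (at x)"
    by (auto intro!: derivative_eq_intros bounded_linear.has_derivative[OF bounded_linear_vec_nth])
  from has_derivative_of_real[OF DERIV_compose_FDERIV[OF flat_has_derivative this, of n]]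
  show ?thesis by (simp add: mult_ac)
qed

text \<open>The induction over \<open>k\<close> must leave \<open>n\<close> free, since
  differentiation produces the indices \<open>n + 1\<close> and \<open>n + 2\<close>.\<close>

lemma Ck_flat_affine: "Ck k (\<lambda>x::real^'n. complex_of_real (flat n (a * x $ i + b)))"
proof (induction k arbitrary: n)
  case 0
  have "(\<lambda>x::real^'n. complex_of_real (flat n (a * x $ i + b))) differentiable at x" for x
    using flat_affine_has_derivative[of n a i b x] by (auto simp: differentiable_def)
  then show ?case by (rule differentiable_imp_Ck_0)
next
  case (Suc k)
  have "partial_deriv j (\<lambda>x::real^'n. complex_of_real (flat n (a * x $ i + b)))
    = (\<lambda>x. of_real (a * axis j 1 $ i) * of_real (flat (n + 2) (a * x $ i + b))
        + of_real (- (real n * a * axis j 1 $ i)) * of_real (flat (n + 1) (a * x $ i + b)))" for j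
    by (rule ext, subst partial_deriv_eq[OF flat_affine_has_derivative]) (simp add: algebra_simps)
  moreover have "(\<lambda>x::real^'n. complex_of_real (flat n (a * x $ i + b))) differentiable at x" for x
    using flat_affine_has_derivative[of n a i b x] by (auto simp: differentiable_def)
  ultimately show ?case by (simp only: Ck.simps) (intro conjI allI TrueI Ck_add Ck_mult Ck_const Suc.IH)
qed

text \<open>Each pair of opposite faces of the box contributes two factors, positive exactly on the
  inner side. The slope \<open>Suc m\<close> is never 0, so every \<open>box_bump m a b\<close> has
  the open box as its set of nonzero values, and inside it all arguments tend to infinity, where
  \<open>flat 0\<close> tends to 1. The arguments have the shape \<open>a * x $ i + b\<close> of
  \<open>Ck_flat_affine\<close>.\<close>

definition box_bump :: "nat \<Rightarrow> real^'n \<Rightarrow> real^'n \<Rightarrow> real^'n \<Rightarrow> complex" where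
  "box_bump m a b x = (\<Prod>i\<in>UNIV. complex_of_real (flat 0 (Suc m * x $ i + - (Suc m * a $ i)))
      * complex_of_real (flat 0 (- Suc m * x $ i + Suc m * b $ i)))"

lemma flat_0_bounds: "0 \<le> flat 0 t" "flat 0 t \<le> 1"
  by (auto simp: flat_def)

lemma flat_0_eq_0_iff: "flat 0 t = 0 \<longleftrightarrow> t \<le> 0"
  by (auto simp: flat_def)

lemma Ck_box_bump: "Ck k (box_bump m a b)"
  unfolding box_bump_def[abs_def] by (intro Ck_prod Ck_mult Ck_flat_affine) simp

lemma box_bump_eq_0_iff: "box_bump m a b x = 0 \<longleftrightarrow> x \<notin> box a b"
proof -
  have aux: "s * y + - (s * z) \<le> 0 \<longleftrightarrow> y \<le> z" "- s * y + s * z \<le> 0 \<longleftrightarrow> z \<le> y" if "s > 0" for s y z :: real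
    using mult_le_cancel_left_pos[OF that, of y z] mult_le_cancel_left_pos[OF that, of z y] by auto
  show ?thesis
    by (auto simp: box_bump_def mem_box_cart flat_0_eq_0_iff aux not_less simp del: of_nat_Suc)
qed

lemma cmod_box_bump_le: "cmod (box_bump m a b x) \<le> 1"
  unfolding box_bump_def norm_mult prod_norm[symmetric]
  by (intro prod_le_1 conjI mult_nonneg_nonneg mult_le_one) (auto simp: flat_0_bounds)

lemma box_bump_tendsto: "(\<lambda>m. box_bump m a b x) \<longlonglongrightarrow> indicator (box a b) x"
proof (cases "x \<in> box a b")
  case True
  have flat: "(\<lambda>m. flat 0 (Suc m * s)) \<longlonglongrightarrow> 1" if "s > 0" for s :: real
  proof -
    have "(\<lambda>m. exp (- (inverse (Suc m) * inverse s))) \<longlonglongrightarrow> exp (- (0 * inverse s))"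
      by (intro tendsto_intros LIMSEQ_inverse_real_of_nat)
    moreover have "exp (- (inverse (Suc m) * inverse s)) = flat 0 (Suc m * s)" for m
      using that by (simp add: flat_def zero_less_mult_iff inverse_eq_divide del: of_nat_Suc)
    ultimately show ?thesis by (simp only: mult_zero_left minus_zero exp_zero)
  qed
  have "box_bump m a b x = (\<Prod>i\<in>UNIV. complex_of_real (flat 0 (Suc m * (x $ i - a $ i)))
      * complex_of_real (flat 0 (Suc m * (b $ i - x $ i))))" for m
    by (simp add: box_bump_def algebra_simps)
  moreover have "(\<lambda>m. \<Prod>i\<in>UNIV. complex_of_real (flat 0 (Suc m * (x $ i - a $ i)))
      * complex_of_real (flat 0 (Suc m * (b $ i - x $ i)))) \<longlonglongrightarrow> (\<Prod>i\<in>(UNIV::'a set). of_real 1 * of_real 1)"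
    using True by (intro tendsto_intros flat) (auto simp: mem_box_cart)
  ultimately show ?thesis using True by simp
next
  case False
  then have "box_bump m a b x = 0" for m by (simp add: box_bump_eq_0_iff)
  with False show ?thesis by simp
qed

lemma box_bump_test_function:
  assumes "cbox a b \<subseteq> \<Omega>"
  shows "box_bump m a b \<in> test_functions \<Omega>"
proof -
  have "{x. box_bump m a b x \<noteq> 0} = box a b" by (auto simp: box_bump_eq_0_iff)
  moreover have "closure (box a b) \<subseteq> cbox a b"
    by (rule closure_minimal) (auto simp: box_subset_cbox)
  moreover have "compact (closure (box a b))" by (simp add: bounded_box)
  ultimately show ?thesis
    using assms by (auto simp: test_functions_def Ck_box_bump)
qed

section \<open>Operations on test functions and their integrability\<close>

lemma test_function_Ck: "\<phi> \<in> test_functions \<Omega> \<Longrightarrow> Ck k \<phi>"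
  by (simp add: test_functions_def)

lemma test_function_continuous: "\<phi> \<in> test_functions \<Omega> \<Longrightarrow> continuous_on S \<phi>"
  using test_function_Ck[of \<phi> \<Omega> 0] by (auto intro: continuous_on_subset)

lemma test_function_differentiable: "\<phi> \<in> test_functions \<Omega> \<Longrightarrow> \<phi> differentiable at x"
  using test_function_Ck[of \<phi> \<Omega> "Suc 0"] by simp

lemma test_function_support:
  assumes "\<phi> \<in> test_functions \<Omega>"
  obtains K where "compact K" "K \<subseteq> \<Omega>" "\<And>x. x \<notin> K \<Longrightarrow> \<phi> x = 0"
proof (rule that)
  show "compact (closure {x. \<phi> x \<noteq> 0})" "closure {x. \<phi> x \<noteq> 0} \<subseteq> \<Omega>"
    using assms by (simp_all add: test_functions_def)
  show "\<And>x. x \<notin> closure {x. \<phi> x \<noteq> 0} \<Longrightarrow> \<phi> x = 0"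
    using closure_subset[of "{x. \<phi> x \<noteq> 0}"] by auto
qed

lemma test_function_outside: "\<phi> \<in> test_functions \<Omega> \<Longrightarrow> x \<notin> \<Omega> \<Longrightarrow> \<phi> x = 0"
  by (metis test_function_support subsetD)

lemma partial_deriv_outside_support:
  assumes "x \<notin> closure {x. \<phi> x \<noteq> 0}"
  shows "partial_deriv i \<phi> x = 0"
proof -
  have "(\<phi> has_derivative (\<lambda>_. 0)) (at x)"
  proof (rule has_derivative_transform_within_open[where f = "\<lambda>_. 0"])
    show "open (- closure {x. \<phi> x \<noteq> 0})" by auto
    show "\<And>y. y \<in> - closure {x. \<phi> x \<noteq> 0} \<Longrightarrow> 0 = \<phi> y"
      using closure_subset[of "{x. \<phi> x \<noteq> 0}"] by auto
  qed (use assms in auto)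
  from partial_deriv_eq[OF this] show ?thesis by simp
qed

lemma test_functions_subset_support:
  assumes "\<phi> \<in> test_functions \<Omega>" "\<And>k. Ck k \<psi>" "{x. \<psi> x \<noteq> 0} \<subseteq> closure {x. \<phi> x \<noteq> 0}"
  shows "\<psi> \<in> test_functions \<Omega>"
proof -
  have sub: "closure {x. \<psi> x \<noteq> 0} \<subseteq> closure {x. \<phi> x \<noteq> 0}"
    using assms(3) by (rule closure_minimal) simp
  moreover have "compact (closure {x. \<psi> x \<noteq> 0})"
    using compact_Int_closed[OF _ closed_closure[of "{x. \<psi> x \<noteq> 0}"], of "closure {x. \<phi> x \<noteq> 0}"] assms(1)
    unfolding Int_absorb1[OF sub] by (simp add: test_functions_def)
  moreover have "closure {x. \<phi> x \<noteq> 0} \<subseteq> \<Omega>" using assms(1) by (simp add: test_functions_def)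
  ultimately show ?thesis using assms(2) by (simp add: test_functions_def)
qed

lemma test_function_partial_deriv:
  assumes "\<phi> \<in> test_functions \<Omega>"
  shows "partial_deriv i \<phi> \<in> test_functions \<Omega>"
proof (rule test_functions_subset_support[OF assms])
  show "Ck k (partial_deriv i \<phi>)" for k
    using test_function_Ck[OF assms, of "Suc k"] by simp
  show "{x. partial_deriv i \<phi> x \<noteq> 0} \<subseteq> closure {x. \<phi> x \<noteq> 0}"
    using partial_deriv_outside_support by blast
qed

lemma test_function_mult:
  assumes "\<phi> \<in> test_functions \<Omega>" "\<And>k. Ck k \<eta>"
  shows "(\<lambda>x. \<eta> x * \<phi> x) \<in> test_functions \<Omega>"
proof (rule test_functions_subset_support[OF assms(1)])
  show "Ck k (\<lambda>x. \<eta> x * \<phi> x)" for k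
    by (intro Ck_mult assms(2) test_function_Ck[OF assms(1)])
qed (auto intro!: closure_subset[THEN subsetD])

lemma test_function_bounded:
  assumes "\<phi> \<in> test_functions \<Omega>"
  obtains B where "B > 0" "\<And>x. cmod (\<phi> x) \<le> B"
proof -
  obtain K where K: "compact K" "\<And>x. x \<notin> K \<Longrightarrow> \<phi> x = 0"
    using test_function_support[OF assms] by metis
  have "bounded (\<phi> ` K)"
    by (intro compact_imp_bounded compact_continuous_image test_function_continuous[OF assms] K)
  then obtain B where B: "B > 0" "\<And>x. x \<in> K \<Longrightarrow> cmod (\<phi> x) \<le> B"
    unfolding bounded_pos by auto
  have "cmod (\<phi> x) \<le> B" for x
    using B K(2)[of x] by (cases "x \<in> K") auto
  with B(1) show ?thesis by (rule that)
qed

lemma test_function_borel: "\<phi> \<in> test_functions \<Omega> \<Longrightarrow> \<phi> \<in> borel_measurable borel"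
  by (rule borel_measurable_continuous_onI) (rule test_function_continuous)

lemma borel_measurable_lebesgue_onI:
  assumes "f \<in> borel_measurable borel" shows "f \<in> borel_measurable (lebesgue_on S)"
proof -
  have "f \<in> borel_measurable lborel" using assms by simp
  then show ?thesis by (intro measurable_restrict_space1 measurable_completion)
qed

text \<open>Transfers integrals over the domain to the whole space, where translation invariance is
  available.\<close>

lemma integral_lebesgue_on_eq_lborel:
  fixes f :: "real^'n \<Rightarrow> complex"
  assumes "S \<in> sets lebesgue" "f \<in> borel_measurable borel" "\<And>x. x \<notin> S \<Longrightarrow> f x = 0"
  shows "(\<integral>x. f x \<partial>lebesgue_on S) = (\<integral>x. f x \<partial>lborel)"
proof -
  have "(\<integral>x. f x \<partial>lebesgue_on S) = (\<integral>x. indicator S x *\<^sub>R f x \<partial>lebesgue)"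
    using assms by (intro integral_restrict_space) simp
  also have "\<dots> = (\<integral>x. f x \<partial>lebesgue)"
    using assms(3) by (intro Bochner_Integration.integral_cong) (auto simp: indicator_def)
  also have "\<dots> = (\<integral>x. f x \<partial>lborel)"
    using assms(2) by (intro integral_completion) simp
  finally show ?thesis .
qed

lemma test_function_integrable_lborel:
  assumes "\<phi> \<in> test_functions \<Omega>"
  shows "integrable lborel \<phi>"
proof -
  obtain K where K: "compact K" "\<And>x. x \<notin> K \<Longrightarrow> \<phi> x = 0"
    using test_function_support[OF assms] by metis
  obtain B where B: "\<And>x. cmod (\<phi> x) \<le> B" using test_function_bounded[OF assms] by blast
  show ?thesis
  proof (rule Bochner_Integration.integrable_bound)
    show "integrable lborel (\<lambda>x. B * indicator K x)"
      using K(1) emeasure_compact_finite[of K]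
      by (intro integrable_mult_right integrable_real_indicator) (auto simp: borel_compact)
    show "\<phi> \<in> borel_measurable lborel" using test_function_borel[OF assms] by simp
    show "AE x in lborel. norm (\<phi> x) \<le> norm (B * indicator K x)"
      using B K(2) by (auto simp: indicator_def intro!: AE_I2) (meson abs_ge_self order_trans)
  qed
qed

lemma test_function_L2:
  assumes "\<phi> \<in> test_functions \<Omega>" "S \<in> sets lebesgue"
  shows "\<phi> \<in> L2 (lebesgue_on S)"
proof -
  obtain B where B: "B > 0" "\<And>x. cmod (\<phi> x) \<le> B" using test_function_bounded[OF assms(1)] by blast
  have m: "\<phi> \<in> borel_measurable (lebesgue_on S)"
    by (intro borel_measurable_lebesgue_onI test_function_borel[OF assms(1)])
  have "integrable lebesgue \<phi>"
    using test_function_integrable_lborel[OF assms(1)] integrable_completion[of \<phi> lborel] test_function_borel[OF assms(1)] by simp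
  then have i: "integrable (lebesgue_on S) \<phi>"
    using assms(2) by (simp add: integrable_restrict_space integrable_mult_indicator)
  have "integrable (lebesgue_on S) (\<lambda>x. (cmod (\<phi> x))\<^sup>2)"
  proof (rule Bochner_Integration.integrable_bound)
    show "integrable (lebesgue_on S) (\<lambda>x. B * cmod (\<phi> x))" using i by simp
    have "(cmod (\<phi> x))\<^sup>2 \<le> B * cmod (\<phi> x)" for x
      using mult_right_mono[OF B(2), of "cmod (\<phi> x)" x] by (simp add: power2_eq_square)
    then show "AE x in lebesgue_on S. norm ((cmod (\<phi> x))\<^sup>2) \<le> norm (B * cmod (\<phi> x))"
      using B(1) by (auto simp: abs_mult)
  qed (use m in measurable)
  with m show ?thesis by (simp add: L2_def)
qed

section \<open>Integration by parts for test functions\<close>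

lemma difference_quotient_bound:
  fixes f :: "real^'n \<Rightarrow> complex"
  assumes d: "\<And>x. f differentiable at x" and B: "\<And>x. cmod (partial_deriv i f x) \<le> B" and h: "h > 0"
  shows "cmod (f (x + h *\<^sub>R axis i 1) - f x) \<le> B * h"
proof -
  have der: "((\<lambda>t. f (x + t *\<^sub>R axis i 1)) has_vector_derivative partial_deriv i f (x + t *\<^sub>R axis i 1)) (at t)" for t
  proof -
    have "((\<lambda>t. x + t *\<^sub>R axis i 1) has_derivative (\<lambda>t. t *\<^sub>R axis i 1)) (at t)"
      by (auto intro!: derivative_eq_intros)
    from has_derivative_compose[OF this has_derivative_frechet[OF d]]
    have "((\<lambda>t. f (x + t *\<^sub>R axis i 1)) has_derivative
       (\<lambda>s. frechet_derivative f (at (x + t *\<^sub>R axis i 1)) (s *\<^sub>R axis i 1))) (at t)" .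
    then show ?thesis
      unfolding has_vector_derivative_def partial_deriv_def
      using linear_scale[OF linear_frechet_derivative[OF d]] by simp
  qed
  have lin: "((\<lambda>t. B * t) has_vector_derivative B) (at t)" for t
    unfolding has_real_derivative_iff_has_vector_derivative[symmetric] by (auto intro!: derivative_eq_intros)
  have c: "continuous_on {0..h} (\<lambda>t. f (x + t *\<^sub>R axis i 1))"
    using der by (intro continuous_at_imp_continuous_on ballI) (meson has_vector_derivative_continuous)
  have "norm (f (x + h *\<^sub>R axis i 1) - f (x + 0 *\<^sub>R axis i 1)) \<le> B * h - B * 0"
    by (rule differentiable_bound_general[OF h c _ der lin B]) (intro continuous_intros)
  then show ?thesis by simp
qed

lemma difference_quotient_tendsto:
  fixes f :: "real^'n \<Rightarrow> complex"
  assumes "f differentiable at x"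
  shows "(\<lambda>m. of_nat (Suc m) * (f (x + inverse (Suc m) *\<^sub>R axis i 1) - f x)) \<longlonglongrightarrow> partial_deriv i f x"
proof -
  let ?e = "\<lambda>m. inverse (real (Suc m)) *\<^sub>R (axis i 1 :: real^'n)"
  let ?D = "frechet_derivative f (at x)"
  have D: "bounded_linear ?D" "(\<lambda>h. norm (f (x + h) - f x - ?D h) / norm h) \<midarrow>0\<rightarrow> 0"
    using has_derivative_frechet[OF assms] unfolding has_derivative_at by auto
  have "filterlim ?e (at 0) sequentially"
    unfolding filterlim_at
  proof
    have "?e \<longlonglongrightarrow> 0 *\<^sub>R axis i 1" by (intro tendsto_intros LIMSEQ_inverse_real_of_nat)
    then show "?e \<longlonglongrightarrow> 0" by simp
  qed (auto simp: axis_eq_0_iff)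
  from filterlim_compose[OF D(2) this]
  have "(\<lambda>m. norm (f (x + ?e m) - f x - ?D (?e m)) / norm (?e m)) \<longlonglongrightarrow> 0" .
  moreover have "norm (f (x + ?e m) - f x - ?D (?e m)) / norm (?e m)
    = norm (of_nat (Suc m) * (f (x + ?e m) - f x) - partial_deriv i f x)" for m
  proof -
    have "?D (?e m) = inverse (real (Suc m)) *\<^sub>R partial_deriv i f x"
      unfolding partial_deriv_def using linear_scale[OF linear_frechet_derivative[OF assms]] by simp
    then have "of_nat (Suc m) * (f (x + ?e m) - f x) - partial_deriv i f x = of_nat (Suc m) * (f (x + ?e m) - f x - ?D (?e m))"
      by (simp add: right_diff_distrib scaleR_conv_of_real del: of_nat_Suc)
    then show ?thesis
      by (simp add: norm_mult divide_inverse mult.commute del: of_nat_Suc)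
  qed
  ultimately show ?thesis
    by (subst tendsto_dist_iff) (simp add: dist_norm)
qed

text \<open>By translation invariance every difference quotient has integral 0, and dominated
  convergence carries this over to the derivative. This avoids iterated integrals.\<close>

lemma integral_partial_deriv_test_function:
  fixes f :: "real^'n \<Rightarrow> complex"
  assumes f: "f \<in> test_functions \<Omega>"
  shows "(\<integral>x. partial_deriv i f x \<partial>lborel) = 0"
proof -
  let ?e = "\<lambda>m. inverse (real (Suc m)) *\<^sub>R (axis i 1 :: real^'n)"
  let ?d = "\<lambda>m x. of_nat (Suc m) * (f (x + ?e m) - f x)"
  have [measurable]: "f \<in> borel_measurable borel" "partial_deriv i f \<in> borel_measurable borel"
    by (intro test_function_borel[of _ \<Omega>] test_function_partial_deriv f)+
  obtain K where K: "compact K" "\<And>x. x \<notin> K \<Longrightarrow> f x = 0"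
    using test_function_support[OF f] by metis
  obtain R where R: "\<And>x. x \<in> K \<Longrightarrow> norm x \<le> R"
    using compact_imp_bounded[OF K(1)] unfolding bounded_iff by auto
  obtain B where B: "B > 0" "\<And>x. cmod (partial_deriv i f x) \<le> B"
    using test_function_bounded[OF test_function_partial_deriv[OF f]] by blast
  have fi: "integrable lborel f" by (rule test_function_integrable_lborel[OF f])
  have shift: "integrable lborel (\<lambda>x. f (x + c))" "(\<integral>x. f (x + c) \<partial>lborel) = (\<integral>x. f x \<partial>lborel)" for c
  proof -
    have "integrable (distr lborel borel ((+) c)) f" using fi by (simp add: lborel_distr_plus)
    then show "integrable lborel (\<lambda>x. f (x + c))"
      by (subst (asm) integrable_distr_eq) (auto simp: add.commute)
    have "(\<integral>x. f x \<partial>lborel) = (\<integral>x. f x \<partial>distr lborel borel ((+) c))" by (simp add: lborel_distr_plus)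
    also have "\<dots> = (\<integral>x. f (c + x) \<partial>lborel)" by (rule integral_distr) auto
    finally show "(\<integral>x. f (x + c) \<partial>lborel) = (\<integral>x. f x \<partial>lborel)" by (simp add: add.commute)
  qed
  have "(\<lambda>m. \<integral>x. ?d m x \<partial>lborel) \<longlonglongrightarrow> (\<integral>x. partial_deriv i f x \<partial>lborel)"
  proof (rule integral_dominated_convergence)
    \<comment> \<open>The steps have length at most 1, so all difference quotients vanish outside
      the ball whose radius exceeds that of the support by 1.\<close>
    show "integrable lborel (\<lambda>x::real^'n. B * indicator (cball 0 (R + 1)) x :: real)"
      using emeasure_compact_finite[of "cball (0::real^'n) (R + 1)"]
      by (intro integrable_mult_right integrable_real_indicator) auto
    show "AE x in lborel. (\<lambda>m. ?d m x) \<longlonglongrightarrow> partial_deriv i f x"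
      by (intro AE_I2 difference_quotient_tendsto test_function_differentiable[OF f])
    have "norm (?d m x) \<le> B * indicator (cball 0 (R + 1)) x" for m x
    proof (cases "x \<in> cball 0 (R + 1)")
      case True
      have "cmod (f (x + ?e m) - f x) \<le> B * inverse (real (Suc m))"
        by (rule difference_quotient_bound) (use f B in \<open>auto intro: test_function_differentiable\<close>)
      then have "real (Suc m) * cmod (f (x + ?e m) - f x) \<le> real (Suc m) * (B * inverse (real (Suc m)))"
        by (intro mult_left_mono) auto
      also have "\<dots> = B" by (simp add: field_simps del: of_nat_Suc)
      finally show ?thesis using True by (simp add: norm_mult del: of_nat_Suc)
    next
      case False
      have "norm (?e m) \<le> 1"
        by (simp add: inverse_le_1_iff del: of_nat_Suc)
      then have "norm x - 1 \<le> norm (x + ?e m)"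
        using norm_triangle_ineq4[of "x + ?e m" "?e m"] by simp
      then have "norm (x + ?e m) > R" "norm x > R" using False by auto
      then have "f (x + ?e m) = 0" "f x = 0"
        using R K(2) by (meson not_less)+
      then show ?thesis using False by simp
    qed
    then show "AE x in lborel. norm (?d m x) \<le> B * indicator (cball 0 (R + 1)) x" for m
      by (intro AE_I2)
  qed measurable
  moreover have "(\<integral>x. ?d m x \<partial>lborel) = 0" for m
    using shift[of "?e m"] fi by simp
  ultimately show ?thesis by (simp only: LIMSEQ_const_iff)
qed

text \<open>Only the second factor must have its support in \<open>\<Omega>\<close>, because the
  product \<open>\<phi> * \<psi>\<close> inherits it; so \<open>\<phi>\<close> may be a test
  function on any other set.\<close>

lemma has_weak_deriv_test_function:
  fixes \<phi> :: "real^'n \<Rightarrow> complex"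
  assumes \<Omega>: "open \<Omega>" and \<phi>: "\<phi> \<in> test_functions \<Omega>'"
  shows "has_weak_deriv \<Omega> i \<phi> (partial_deriv i \<phi>)"
  unfolding has_weak_deriv_def
proof
  fix \<psi> assume \<psi>: "\<psi> \<in> test_functions \<Omega>"
  have \<phi>\<psi>: "(\<lambda>x. \<phi> x * \<psi> x) \<in> test_functions \<Omega>" "(\<lambda>x. \<phi> x * partial_deriv i \<psi> x) \<in> test_functions \<Omega>"
    "(\<lambda>x. partial_deriv i \<phi> x * \<psi> x) \<in> test_functions \<Omega>"
    by (intro test_function_mult test_function_partial_deriv \<psi> test_function_Ck[OF \<phi>]
        test_function_Ck[OF test_function_partial_deriv[OF \<phi>]])+
  have "partial_deriv i (\<lambda>x. \<phi> x * \<psi> x) = (\<lambda>x. \<phi> x * partial_deriv i \<psi> x + partial_deriv i \<phi> x * \<psi> x)"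
    by (intro ext partial_deriv_mult test_function_differentiable[OF \<phi>] test_function_differentiable[OF \<psi>])
  with integral_partial_deriv_test_function[OF \<phi>\<psi>(1), of i] \<phi>\<psi>(2,3)
  have "(\<integral>x. \<phi> x * partial_deriv i \<psi> x \<partial>lborel) + (\<integral>x. partial_deriv i \<phi> x * \<psi> x \<partial>lborel) = 0"
    by (simp add: test_function_integrable_lborel)
  moreover have "(\<integral>x. g x \<partial>lebesgue_on \<Omega>) = (\<integral>x. g x \<partial>lborel)" if "g \<in> test_functions \<Omega>" for g
    using \<Omega> that by (intro integral_lebesgue_on_eq_lborel) (auto intro: test_function_borel test_function_outside)
  ultimately show "(\<integral>x. \<phi> x * partial_deriv i \<psi> x \<partial>lebesgue_on \<Omega>) = - (\<integral>x. partial_deriv i \<phi> x * \<psi> x \<partial>lebesgue_on \<Omega>)"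
    using \<phi>\<psi>(2,3) by (simp add: add_eq_0_iff2)
qed

section \<open>The fundamental lemma of the calculus of variations\<close>

lemma sigma_finite_lebesgue_on:
  assumes "S \<in> sets lebesgue" shows "sigma_finite_measure (lebesgue_on S :: (real^'n) measure)"
proof -
  obtain A :: "(real^'n) set set" where A: "countable A" "A \<subseteq> sets lborel" "\<Union>A = space lborel"
      "\<forall>a\<in>A. emeasure lborel a \<noteq> \<infinity>"
    using lborel.sigma_finite_countable by blast
  have "sigma_finite_measure (lebesgue :: (real^'n) measure)"
  proof (unfold_locales, intro exI conjI ballI)
    fix a assume "a \<in> A"
    with A show "emeasure lebesgue a \<noteq> \<infinity>" by (auto simp: emeasure_completion)
  qed (use A in auto)
  then show ?thesis using assms by (rule sigma_finite_measure_restrict_space)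
qed

text \<open>Bumps converge boundedly to the indicator of their box, so closedness gives invariance
  for boxes, and hence for Borel sets. This is the bridge from smooth to measurable multipliers,
  both for the fundamental lemma and for the traces of 0.\<close>

lemma closed_L2_subspace_mult_invariant:
  assumes T: "closed_L2_subspace M T" and emb: "emb \<in> borel_measurable M"
    and inv: "\<And>\<eta> u. \<eta> \<in> test_functions UNIV \<Longrightarrow> u \<in> T \<Longrightarrow> (\<lambda>x. \<eta> (emb x) * u x) \<in> T"
    and A: "A \<in> sets borel" and u: "u \<in> T"
  shows "(\<lambda>x. indicator A (emb x) * u x) \<in> T"
proof (rule indicator_box_invariant_imp_borel[OF T emb _ A u])
  fix u and a b :: "real^'b" assume u: "u \<in> T"
  have uL: "u \<in> L2 M" by (rule subspace_L2[OF T u])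
  note [measurable] = L2_measurable[OF uL] emb
  have [measurable]: "box_bump m a b \<in> borel_measurable borel" for m
    by (rule test_function_borel[of _ UNIV]) (simp add: box_bump_test_function)
  have m1: "(\<lambda>x. box_bump m a b (emb x) * u x) \<in> borel_measurable M" for m by measurable
  have m2: "(\<lambda>x. indicator (box a b) (emb x) * u x) \<in> borel_measurable M" by measurable
  have le: "AE x in M. cmod (box_bump m a b (emb x) * u x) \<le> 1 * cmod (u x)" for m
    unfolding norm_mult by (intro AE_I2 mult_right_mono cmod_box_bump_le) simp
  have lim: "AE x in M. (\<lambda>m. box_bump m a b (emb x) * u x) \<longlonglongrightarrow> indicator (box a b) (emb x) * u x"
    by (intro AE_I2 tendsto_intros box_bump_tendsto)
  note conv = L2_tendsto_dominated(1,2)[OF uL m1 m2 le lim]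
  show "(\<lambda>x. indicator (box a b) (emb x) * u x) \<in> T"
    by (rule subspace_closed[OF T _ conv(2,1)]) (intro inv u box_bump_test_function subset_UNIV)
qed

text \<open>No mollification is used: the functions annihilated by all test functions form a closed
  subspace that is invariant under smooth multipliers, hence under indicators. So
  \<open>g * \<phi>\<close> has integral 0 over every measurable set and vanishes almost everywhere;
  suitable \<open>\<phi>\<close> without zeros on small boxes finish the proof.\<close>

lemma AE_eq_0_of_test_functions:
  fixes g :: "real^'n \<Rightarrow> complex"
  assumes \<Omega>: "open \<Omega>" and g: "g \<in> L2 (lebesgue_on \<Omega>)"
    and orth: "\<And>\<phi>. \<phi> \<in> test_functions \<Omega> \<Longrightarrow> (\<integral>x. g x * \<phi> x \<partial>lebesgue_on \<Omega>) = 0"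
  shows "AE x in lebesgue_on \<Omega>. g x = 0"
proof -
  let ?M = "lebesgue_on \<Omega>"
  have \<Omega>s: "\<Omega> \<in> sets lebesgue" using \<Omega> by simp
  \<comment> \<open>The conjugate of \<open>\<phi>\<close> cancels the one in
    \<open>L2_inner\<close>.\<close>
  define T where "T = {u \<in> L2 ?M. \<forall>\<phi>\<in>test_functions \<Omega>. L2_inner ?M u (\<lambda>x. cnj (\<phi> x)) = 0}"
  have tL: "(\<lambda>x. cnj (\<phi> x)) \<in> L2 ?M" if "\<phi> \<in> test_functions \<Omega>" for \<phi>
    using test_function_L2[OF that \<Omega>s] by (rule L2_cnj)
  have T: "closed_L2_subspace ?M T"
    unfolding closed_L2_subspace_def
  proof (intro conjI ballI allI impI)
    fix w x assume w: "\<forall>n. w n \<in> T" and x: "x \<in> L2 ?M" "L2_tendsto ?M w x"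
    have "L2_inner ?M x (\<lambda>x. cnj (\<phi> x)) = 0" if "\<phi> \<in> test_functions \<Omega>" for \<phi>
    proof -
      have "(\<lambda>n. L2_inner ?M (w n) (\<lambda>x. cnj (\<phi> x))) \<longlonglongrightarrow> L2_inner ?M x (\<lambda>x. cnj (\<phi> x))"
        using w x tL[OF that] by (intro L2_tendsto_inner) (auto simp: T_def)
      moreover have "L2_inner ?M (w n) (\<lambda>x. cnj (\<phi> x)) = 0" for n
        using w that by (auto simp: T_def)
      ultimately show ?thesis by (simp add: LIMSEQ_const_iff)
    qed
    with x show "x \<in> T" by (auto simp: T_def)
  qed (auto simp: T_def L2_zero L2_add L2_scale L2.zero_form L2.add_left L2.scale_left tL)
  have gT: "g \<in> T" using g orth by (auto simp: T_def L2_inner_def)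
  have emb: "(\<lambda>x. x) \<in> borel_measurable ?M" by (rule borel_measurable_lebesgue_onI) simp
  \<comment> \<open>The multiplier is shifted to the test function: \<open>\<eta> * \<phi>\<close>
    is again a test function on \<open>\<Omega>\<close>.\<close>
  have inv: "(\<lambda>x. \<eta> x * u x) \<in> T" if \<eta>: "\<eta> \<in> test_functions UNIV" and u: "u \<in> T" for \<eta> u
  proof -
    have uL: "u \<in> L2 ?M" using u by (simp add: T_def)
    note [measurable] = L2_measurable[OF uL] borel_measurable_lebesgue_onI[OF test_function_borel[OF \<eta>]]
    obtain B where B: "\<And>x. cmod (\<eta> x) \<le> B" using test_function_bounded[OF \<eta>] by blast
    have "(\<lambda>x. \<eta> x * u x) \<in> L2 ?M"
      by (rule L2_dominated[OF uL, of _ B]) (auto simp: norm_mult intro!: AE_I2 mult_right_mono B)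
    moreover have "L2_inner ?M (\<lambda>x. \<eta> x * u x) (\<lambda>x. cnj (\<phi> x)) = 0" if "\<phi> \<in> test_functions \<Omega>" for \<phi>
    proof -
      have "(\<lambda>x. \<eta> x * \<phi> x) \<in> test_functions \<Omega>"
        by (intro test_function_mult that test_function_Ck[OF \<eta>])
      moreover have "\<forall>\<phi>\<in>test_functions \<Omega>. L2_inner ?M u (\<lambda>x. cnj (\<phi> x)) = 0"
        using u by (simp add: T_def)
      ultimately have "L2_inner ?M u (\<lambda>x. cnj (\<eta> x * \<phi> x)) = 0" by (rule bspec[rotated])
      then show ?thesis by (simp add: L2_inner_def mult_ac)
    qed
    ultimately show ?thesis by (auto simp: T_def)
  qed
  \<comment> \<open>The invariance is known for Borel sets; a Lebesgue measurable set differs from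
    one by a null set, and \<open>T\<close> does not see null sets.\<close>
  have ind: "(\<lambda>x. indicator A x * g x) \<in> T" if A: "A \<in> sets ?M" for A
  proof -
    have A': "A \<in> sets lebesgue" using A \<Omega>s by (simp add: sets_restrict_space_iff)
    obtain S N N' where SN: "A = S \<union> N" "N \<subseteq> N'" "N' \<in> null_sets lborel" "S \<in> sets lborel"
      using sets_completionE[OF A'] by blast
    have "(\<lambda>x. indicator S x * g x) \<in> T"
      using SN(4) by (intro closed_L2_subspace_mult_invariant[OF T emb inv _ gT]) auto
    moreover have "(\<lambda>x. indicator A x * g x) \<in> borel_measurable ?M"
      using A L2_measurable[OF g] by measurable
    moreover have "AE x in ?M. indicator S x * g x = indicator A x * g x"
    proof -
      have "AE x in lebesgue. x \<notin> N'"
        using SN(3) by (intro AE_not_in null_sets_completionI)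
      then have "AE x in ?M. x \<notin> N'"
        using \<Omega>s by (subst AE_restrict_space_iff) (auto elim!: eventually_mono)
      then show ?thesis by eventually_elim (use SN in \<open>auto simp: indicator_def\<close>)
    qed
    ultimately show ?thesis by (rule subspace_AE_eq[OF T])
  qed
  have AE_\<phi>: "AE x in ?M. g x * cnj (cnj (\<phi> x)) = 0" if \<phi>: "\<phi> \<in> test_functions \<Omega>" for \<phi>
  proof (rule orthogonal_indicator_multiples[OF sigma_finite_lebesgue_on[OF \<Omega>s] g tL[OF \<phi>]])
    fix A assume "A \<in> sets ?M"
    from ind[OF this] \<phi> have "L2_inner ?M (\<lambda>x. indicator A x * g x) (\<lambda>x. cnj (\<phi> x)) = 0"
      by (simp add: T_def)
    moreover have "g x * cnj (indicator A x * cnj (\<phi> x)) = indicator A x * g x * cnj (cnj (\<phi> x))" for x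
      by (simp add: indicator_def)
    ultimately show "L2_inner ?M g (\<lambda>x. indicator A x * cnj (\<phi> x)) = 0"
      by (simp only: L2_inner_def)
  qed
  \<comment> \<open>Countably many closed boxes exhaust \<open>\<Omega>\<close>. A bump vanishes on
    the faces of its box, so these are discarded as null sets.\<close>
  obtain D where D: "countable D" "D \<subseteq> Pow \<Omega>" "\<And>X. X \<in> D \<Longrightarrow> \<exists>a b. X = cbox a b" "\<Union>D = \<Omega>"
    using open_countable_Union_open_cbox[OF \<Omega>] by blast
  have "AE x in ?M. x \<in> X \<longrightarrow> g x = 0" if X: "X \<in> D" for X
  proof -
    obtain a b where ab: "X = cbox a b" using D(3)[OF X] by blast
    have "box_bump 0 a b \<in> test_functions \<Omega>"
      using ab X D(2) by (intro box_bump_test_function) auto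
    from AE_\<phi>[OF this] have "AE x in ?M. x \<in> box a b \<longrightarrow> g x = 0"
      by eventually_elim (auto simp: box_bump_eq_0_iff)
    moreover have "AE x in ?M. x \<notin> cbox a b - box a b"
    proof -
      have "cbox a b - box a b \<in> null_sets lebesgue"
        using negligible_frontier_interval negligible_iff_null_sets by blast
      then have "AE x in lebesgue. x \<notin> cbox a b - box a b" by (rule AE_not_in)
      then show ?thesis using \<Omega>s by (subst AE_restrict_space_iff) (auto elim!: eventually_mono)
    qed
    ultimately show ?thesis by eventually_elim (auto simp: ab)
  qed
  then have "AE x in ?M. \<forall>X\<in>D. x \<in> X \<longrightarrow> g x = 0"
    unfolding AE_ball_countable[OF D(1)] by blast
  then show ?thesis using AE_space by eventually_elim (use D(4) in auto)
qed

section \<open>Closures of forms\<close>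

locale L2_form = nonneg_form D a t for D :: "('a \<Rightarrow> complex) set" and a t +
  fixes M :: "'a measure"
  assumes D_L2: "D \<subseteq> L2 M"
begin

abbreviation b :: "'a form" where "b u v \<equiv> a u v + L2_inner M u v"

text \<open>The square of the form norm. Unlike the norm itself it obeys the parallelogram law as an
  identity of quadratic forms, and the inequalities of \<open>nonneg_form\<close> apply to it; every
  triangle inequality then carries factors 2.\<close>

abbreviation q :: "('a \<Rightarrow> complex) \<Rightarrow> real" where "q u \<equiv> Re (b u u)"

abbreviation approx :: "(nat \<Rightarrow> 'a \<Rightarrow> complex) \<Rightarrow> ('a \<Rightarrow> complex) \<Rightarrow> bool" where
  "approx \<equiv> form_approx M D a"

sublocale b: nonneg_form D b "max t 0"
  by (rule nonneg_form_sum[OF nonneg_form_axioms nonneg_form_L2_inner D_L2])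

lemma L2: "u \<in> D \<Longrightarrow> u \<in> L2 M"
  using D_L2 by auto

lemma Re_le_q: "Re (a u u) \<le> q u" "(\<integral>x. (cmod (u x))\<^sup>2 \<partial>M) \<le> q u" if "u \<in> D"
  using nonneg[OF that] by (simp_all add: Re_L2_inner_self)

lemma cmod_le_q:
  assumes "u \<in> D" "v \<in> D"
  shows "cmod (a u v) \<le> 2 * (1 + t) * (sqrt (q u) * sqrt (q v))"
proof -
  have "sqrt (Re (a u u)) * sqrt (Re (a v v)) \<le> sqrt (q u) * sqrt (q v)"
    using nonneg[OF assms(1)] nonneg[OF assms(2)] Re_le_q(1)[OF assms(1)] Re_le_q(1)[OF assms(2)]
    by (intro mult_mono real_sqrt_le_mono) auto
  then have "2 * (1 + t) * (sqrt (Re (a u u)) * sqrt (Re (a v v))) \<le> 2 * (1 + t) * (sqrt (q u) * sqrt (q v))"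
    using angle_nonneg by (intro mult_left_mono) auto
  with cmod_le_sqrt[OF assms] show ?thesis by linarith
qed

end

lemma form_norm_eq: "form_norm M a u = sqrt (Re (a u u + L2_inner M u u))"
  by (simp add: form_norm_def L2_norm_power2 Re_L2_inner_self)

context L2_form
begin

definition q_Cauchy :: "(nat \<Rightarrow> 'a \<Rightarrow> complex) \<Rightarrow> bool" where
  "q_Cauchy u \<longleftrightarrow> (\<forall>e>0. \<exists>N. \<forall>m\<ge>N. \<forall>n\<ge>N. q (\<lambda>x. u m x - u n x) < e)"

lemma form_Cauchy_iff:
  assumes u: "\<And>n. u n \<in> D"
  shows "form_Cauchy M a u \<longleftrightarrow> q_Cauchy u"
proof
  assume C: "form_Cauchy M a u"
  show "q_Cauchy u" unfolding q_Cauchy_def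
  proof (intro allI impI)
    fix e :: real assume "e > 0"
    then have "sqrt e > 0" by simp
    with C obtain N where "\<forall>m\<ge>N. \<forall>n\<ge>N. form_norm M a (\<lambda>y. u m y - u n y) < sqrt e"
      unfolding form_Cauchy_def by blast
    then show "\<exists>N. \<forall>m\<ge>N. \<forall>n\<ge>N. q (\<lambda>x. u m x - u n x) < e"
      unfolding form_norm_eq real_sqrt_less_iff by blast
  qed
next
  assume C: "q_Cauchy u"
  show "form_Cauchy M a u" unfolding form_Cauchy_def
  proof (intro allI impI)
    fix e :: real assume e: "e > 0"
    then have "e\<^sup>2 > 0" by simp
    with C obtain N where N: "\<forall>m\<ge>N. \<forall>n\<ge>N. q (\<lambda>x. u m x - u n x) < e\<^sup>2"
      unfolding q_Cauchy_def by blast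
    have "form_norm M a (\<lambda>y. u m y - u n y) < e" if "m \<ge> N" "n \<ge> N" for m n
      unfolding form_norm_eq by (rule real_less_lsqrt) (use N that e in auto)
    then show "\<exists>N. \<forall>m\<ge>N. \<forall>n\<ge>N. form_norm M a (\<lambda>y. u m y - u n y) < e" by blast
  qed
qed

lemma form_approx_iff:
  "approx u x \<longleftrightarrow> (\<forall>n. u n \<in> D) \<and> q_Cauchy u \<and> L2_tendsto M u x"
  using form_Cauchy_iff[of u] unfolding form_approx_def by blast

lemma form_approxD:
  assumes "approx u x"
  shows "u n \<in> D" "q_Cauchy u" "L2_tendsto M u x"
  using assms by (auto simp: form_approx_iff)

lemma form_approx_const:
  assumes "u \<in> D" shows "approx (\<lambda>_. u) u"
proof -
  have "b (\<lambda>x. u x - u x) (\<lambda>x. u x - u x) = 0" using b.zero_form(1)[OF zero_mem] by simp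
  then show ?thesis using assms by (simp add: form_approx_iff q_Cauchy_def L2_tendsto_iff)
qed

lemma q_Cauchy_diff:
  assumes u: "\<And>n. u n \<in> D" "q_Cauchy u" and v: "\<And>n. v n \<in> D" "q_Cauchy v"
  shows "q_Cauchy (\<lambda>n x. u n x - v n x)"
  unfolding q_Cauchy_def
proof (intro allI impI)
  fix e :: real assume "e > 0"
  then have "e / 4 > 0" by simp
  with u(2) v(2) obtain N N' where N: "\<forall>m\<ge>N. \<forall>n\<ge>N. q (\<lambda>x. u m x - u n x) < e / 4"
    and N': "\<forall>m\<ge>N'. \<forall>n\<ge>N'. q (\<lambda>x. v m x - v n x) < e / 4"
    unfolding q_Cauchy_def by meson
  have "q (\<lambda>x. u m x - v m x - (u n x - v n x)) < e" if "m \<ge> max N N'" "n \<ge> max N N'" for m n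
  proof -
    have "q (\<lambda>x. (u m x - u n x) - (v m x - v n x)) \<le> 2 * q (\<lambda>x. u m x - u n x) + 2 * q (\<lambda>x. v m x - v n x)"
      by (rule b.quadratic_diff_le[OF minus_mem[OF u(1) u(1)] minus_mem[OF v(1) v(1)]])
    moreover have "(\<lambda>x. u m x - v m x - (u n x - v n x)) = (\<lambda>x. (u m x - u n x) - (v m x - v n x))"
      by (simp add: fun_eq_iff)
    moreover have "q (\<lambda>x. u m x - u n x) < e / 4" "q (\<lambda>x. v m x - v n x) < e / 4"
      using N N' that by auto
    ultimately show ?thesis by (simp only:)
  qed
  then show "\<exists>N. \<forall>m\<ge>N. \<forall>n\<ge>N. q (\<lambda>x. u m x - v m x - (u n x - v n x)) < e" by blast
qed

end

lemma L2_tendsto_diff: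
  assumes u: "\<And>n. u n \<in> L2 M" "x \<in> L2 M" "L2_tendsto M u x"
    and v: "\<And>n. v n \<in> L2 M" "y \<in> L2 M" "L2_tendsto M v y"
  shows "L2_tendsto M (\<lambda>n z. u n z - v n z) (\<lambda>z. x z - y z)"
  unfolding L2_tendsto_iff
proof (rule Lim_null_comparison)
  let ?B = "\<lambda>n. 2 * (\<integral>z. (cmod (u n z - x z))\<^sup>2 \<partial>M) + 2 * (\<integral>z. (cmod (v n z - y z))\<^sup>2 \<partial>M)"
  show "\<forall>\<^sub>F n in sequentially. norm (\<integral>z. (cmod (u n z - v n z - (x z - y z)))\<^sup>2 \<partial>M)
    \<le> ?B n"
  proof (intro always_eventually allI)
    fix n
    have eq: "u n z - v n z - (x z - y z) = (u n z - x z) - (v n z - y z)" for z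
      by simp
    from L2.quadratic_diff_le[OF L2_diff[OF u(1,2)] L2_diff[OF v(1,2)], of n n]
    show "norm (\<integral>z. (cmod (u n z - v n z - (x z - y z)))\<^sup>2 \<partial>M)
      \<le> ?B n"
      unfolding Re_L2_inner_self eq by simp
  qed
  have "?B \<longlonglongrightarrow> 2 * 0 + 2 * 0"
    using u(3) v(3) unfolding L2_tendsto_iff by (intro tendsto_intros)
  then show "?B \<longlonglongrightarrow> 0"
    by simp
qed

context L2_form
begin

lemma form_approx_diff:
  assumes "approx u x" "x \<in> L2 M" "approx v y" "y \<in> L2 M"
  shows "approx (\<lambda>n z. u n z - v n z) (\<lambda>z. x z - y z)"
  using assms unfolding form_approx_iff
  by (auto intro!: minus_mem q_Cauchy_diff L2_tendsto_diff L2)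

lemma q_Cauchy_bounded:
  assumes u: "\<And>n. u n \<in> D" "q_Cauchy u"
  obtains B where "\<And>n. q (u n) \<le> B"
proof -
  obtain N where N: "\<forall>m\<ge>N. \<forall>n\<ge>N. q (\<lambda>x. u m x - u n x) < 1"
    using u(2) unfolding q_Cauchy_def by (meson zero_less_one)
  have nn: "0 \<le> q (u i)" for i by (rule b.nonneg[OF u(1)])
  have "q (u n) \<le> 2 + 2 * q (u N) + (\<Sum>i<N. q (u i))" for n
  proof (cases "n < N")
    case True
    then have "q (u n) \<le> (\<Sum>i<N. q (u i))"
      using nn by (intro member_le_sum) auto
    then show ?thesis using nn[of N] by linarith
  next
    case False
    have "q (\<lambda>x. (u n x - u N x) + u N x) \<le> 2 * q (\<lambda>x. u n x - u N x) + 2 * q (u N)"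
      by (rule b.quadratic_add_le[OF minus_mem[OF u(1) u(1)] u(1)])
    moreover have "(\<lambda>x. (u n x - u N x) + u N x) = u n" by simp
    moreover have "q (\<lambda>x. u n x - u N x) < 1" using N False by auto
    moreover have "0 \<le> (\<Sum>i<N. q (u i))" using nn by (intro sum_nonneg) auto
    ultimately show ?thesis by (simp only:)
  qed
  then show ?thesis by (rule that)
qed

lemma form_tendsto_0:
  assumes u: "\<And>n. u n \<in> D" and v: "\<And>n. v n \<in> D"
    and qu: "(\<lambda>n. q (u n)) \<longlonglongrightarrow> 0" and qv: "\<And>n. q (v n) \<le> B"
  shows "(\<lambda>n. a (u n) (v n)) \<longlonglongrightarrow> 0" "(\<lambda>n. a (v n) (u n)) \<longlonglongrightarrow> 0"
proof -
  have le: "2 * (1 + t) * (sqrt (q (u n)) * sqrt (q (v n))) \<le> 2 * (1 + t) * (sqrt (q (u n)) * sqrt B)" for n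
    using angle_nonneg b.nonneg[OF u, of n] qv[of n] by (intro mult_left_mono real_sqrt_le_mono) auto
  have "(\<lambda>n. 2 * (1 + t) * (sqrt (q (u n)) * sqrt B)) \<longlonglongrightarrow> 2 * (1 + t) * (sqrt 0 * sqrt B)"
    by (intro tendsto_intros qu)
  then have lim: "(\<lambda>n. 2 * (1 + t) * (sqrt (q (u n)) * sqrt B)) \<longlonglongrightarrow> 0" by simp
  have "cmod (a (u n) (v n)) \<le> 2 * (1 + t) * (sqrt (q (u n)) * sqrt B)" for n
    using cmod_le_q[OF u v, of n n] le[of n] by linarith
  then show "(\<lambda>n. a (u n) (v n)) \<longlonglongrightarrow> 0"
    by (intro Lim_null_comparison[OF _ lim] always_eventually allI)
  have "cmod (a (v n) (u n)) \<le> 2 * (1 + t) * (sqrt (q (u n)) * sqrt B)" for n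
    using cmod_le_q[OF v u, of n n] le[of n] by (simp only: mult.commute[of "sqrt (q (v n))"])
  then show "(\<lambda>n. a (v n) (u n)) \<longlonglongrightarrow> 0"
    by (intro Lim_null_comparison[OF _ lim] always_eventually allI)
qed

text \<open>The difference of two values splits into one term with a small first argument and one
  with a small second argument, while the remaining arguments are bounded because Cauchy sequences
  are.\<close>

lemma form_approx_convergent:
  assumes u: "approx u x" and v: "approx v y"
  shows "convergent (\<lambda>n. a (u n) (v n))"
proof -
  note uD = form_approxD(1)[OF u] and vD = form_approxD(1)[OF v]
  obtain A where A: "\<And>n. q (u n) \<le> A" using q_Cauchy_bounded[OF uD form_approxD(2)[OF u]] by blast
  obtain B where B: "\<And>n. q (v n) \<le> B" using q_Cauchy_bounded[OF vD form_approxD(2)[OF v]] by blast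
  have A0: "0 \<le> A" and B0: "0 \<le> B" using A B b.nonneg[OF uD] b.nonneg[OF vD] order_trans by blast+
  \<comment> \<open>The summand 1 makes \<open>K\<close> positive and leaves a strict inequality:
    the total error is \<open>(K - 1) * (e / K)\<close>, which is below \<open>e\<close>.\<close>
  define K where "K = 2 * (1 + t) * (sqrt A + sqrt B) + 1"
  have K: "K > 0" using angle_nonneg A0 B0 by (simp add: K_def add_nonneg_pos)
  have "Cauchy (\<lambda>n. a (u n) (v n))"
  proof (rule metric_CauchyI)
    fix e :: real assume e: "e > 0"
    then have "(e / K)\<^sup>2 > 0" using K by simp
    with form_approxD(2)[OF u] form_approxD(2)[OF v] obtain N N' where
      N: "\<forall>m\<ge>N. \<forall>n\<ge>N. q (\<lambda>x. u m x - u n x) < (e / K)\<^sup>2"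
      and N': "\<forall>m\<ge>N'. \<forall>n\<ge>N'. q (\<lambda>x. v m x - v n x) < (e / K)\<^sup>2"
      unfolding q_Cauchy_def by meson
    have "dist (a (u m) (v m)) (a (u n) (v n)) < e" if "m \<ge> max N N'" "n \<ge> max N N'" for m n
    proof -
      have eK: "0 \<le> e / K" using e K by simp
      have s: "sqrt (q (\<lambda>x. u m x - u n x)) \<le> e / K" "sqrt (q (\<lambda>x. v m x - v n x)) \<le> e / K"
        using N N' that eK by (auto intro!: real_le_lsqrt intro: less_imp_le)
      have 1: "cmod (a (\<lambda>x. u m x - u n x) (v m)) \<le> 2 * (1 + t) * (e / K * sqrt B)"
      proof (rule order_trans[OF cmod_le_q[OF minus_mem[OF uD uD] vD]])
        show "2 * (1 + t) * (sqrt (q (\<lambda>x. u m x - u n x)) * sqrt (q (v m))) \<le> 2 * (1 + t) * (e / K * sqrt B)"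
          using angle_nonneg s B[of m] eK b.nonneg[OF vD, of m] by (intro mult_left_mono mult_mono real_sqrt_le_mono) auto
      qed
      have 2: "cmod (a (u n) (\<lambda>x. v m x - v n x)) \<le> 2 * (1 + t) * (sqrt A * (e / K))"
      proof (rule order_trans[OF cmod_le_q[OF uD minus_mem[OF vD vD]]])
        show "2 * (1 + t) * (sqrt (q (u n)) * sqrt (q (\<lambda>x. v m x - v n x))) \<le> 2 * (1 + t) * (sqrt A * (e / K))"
          using angle_nonneg s A[of n] A0 b.nonneg[OF minus_mem[OF vD vD], of m n]
          by (intro mult_left_mono mult_mono real_sqrt_le_mono) auto
      qed
      have "a (u m) (v m) - a (u n) (v n) = a (\<lambda>x. u m x - u n x) (v m) + a (u n) (\<lambda>x. v m x - v n x)"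
        unfolding minus_left[OF uD uD vD] minus_right[OF vD vD uD] by simp
      then have "cmod (a (u m) (v m) - a (u n) (v n)) \<le> 2 * (1 + t) * (e / K * sqrt B) + 2 * (1 + t) * (sqrt A * (e / K))"
        using order_trans[OF norm_triangle_ineq add_mono[OF 1 2]] by simp
      also have "\<dots> = 2 * (1 + t) * (sqrt A + sqrt B) * (e / K)"
        by (simp add: distrib_left distrib_right mult_ac)
      also have "\<dots> = (K - 1) * (e / K)"
        by (subst (2) K_def) simp
      also have "\<dots> < e" using K e by (simp add: field_simps)
      finally show ?thesis by (simp add: dist_norm)
    qed
    then show "\<exists>N. \<forall>m\<ge>N. \<forall>n\<ge>N. dist (a (u m) (v m)) (a (u n) (v n)) < e" by blast
  qed
  then show ?thesis by (rule Cauchy_convergent)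
qed

context
  assumes closable: "closable M D a"
begin

lemma form_approx_0:
  assumes u: "approx u (\<lambda>_. 0)"
  shows "(\<lambda>n. q (u n)) \<longlonglongrightarrow> 0"
proof -
  have "(\<lambda>n. Re (a (u n) (u n)) + (\<integral>x. (cmod (u n x - 0))\<^sup>2 \<partial>M)) \<longlonglongrightarrow> Re 0 + 0"
    using closable u form_approxD(3)[OF u] unfolding closable_def L2_tendsto_iff
    by (intro tendsto_add tendsto_Re) blast+
  then show ?thesis by (simp add: Re_L2_inner_self)
qed

text \<open>The difference of two sequences with the same limit approximates 0, so closability sends
  it to 0 for \<open>q\<close>; paired with a bounded sequence it contributes nothing to the limit.
  This is what gives the definite description in \<open>closure_form\<close> a value.\<close>

lemma form_approx_limit_unique:
  assumes u: "approx u x" "approx u' x" "x \<in> L2 M"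
    and v: "approx v y" "approx v' y" "y \<in> L2 M"
    and lim: "(\<lambda>n. a (u n) (v n)) \<longlonglongrightarrow> l"
  shows "(\<lambda>n. a (u' n) (v' n)) \<longlonglongrightarrow> l"
proof -
  note D = form_approxD(1)[OF u(1)] form_approxD(1)[OF u(2)] form_approxD(1)[OF v(1)] form_approxD(1)[OF v(2)]
  obtain A where A: "\<And>n. q (u' n) \<le> A" using q_Cauchy_bounded[OF D(2) form_approxD(2)[OF u(2)]] by blast
  obtain B where B: "\<And>n. q (v n) \<le> B" using q_Cauchy_bounded[OF D(3) form_approxD(2)[OF v(1)]] by blast
  have "approx (\<lambda>n z. u n z - u' n z) (\<lambda>_. 0)" "approx (\<lambda>n z. v n z - v' n z) (\<lambda>_. 0)"
    using form_approx_diff[OF u(1,3) u(2,3)] form_approx_diff[OF v(1,3) v(2,3)] by simp_all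
  note 0 = form_approx_0[OF this(1)] form_approx_0[OF this(2)]
  have "(\<lambda>n. a (\<lambda>z. u n z - u' n z) (v n)) \<longlonglongrightarrow> 0" "(\<lambda>n. a (u' n) (\<lambda>z. v n z - v' n z)) \<longlonglongrightarrow> 0"
    by (rule form_tendsto_0(1)[OF minus_mem[OF D(1,2)] D(3) 0(1) B],
        rule form_tendsto_0(2)[OF minus_mem[OF D(3,4)] D(2) 0(2) A])
  from tendsto_diff[OF tendsto_diff[OF lim this(1)] this(2)]
  show ?thesis unfolding minus_left[OF D(1,2,3)] minus_right[OF D(3,4,2)] by simp
qed

lemma closure_form_tendsto:
  assumes u: "approx u x" "x \<in> L2 M" and v: "approx v y" "y \<in> L2 M"
  shows "(\<lambda>n. a (u n) (v n)) \<longlonglongrightarrow> closure_form M D a x y"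
proof -
  obtain l where l: "(\<lambda>n. a (u n) (v n)) \<longlonglongrightarrow> l"
    using form_approx_convergent[OF u(1) v(1)] by (auto simp: convergent_def)
  have "closure_form M D a x y = l" unfolding closure_form_def
  proof (rule the_equality)
    show "\<exists>u v. approx u x \<and> approx v y \<and> (\<lambda>n. a (u n) (v n)) \<longlonglongrightarrow> l"
      using u(1) v(1) l by blast
    fix c assume "\<exists>u v. approx u x \<and> approx v y \<and> (\<lambda>n. a (u n) (v n)) \<longlonglongrightarrow> c"
    then obtain u' v' where "approx u' x" "approx v' y" and c: "(\<lambda>n. a (u' n) (v' n)) \<longlonglongrightarrow> c"
      by blast
    from form_approx_limit_unique[OF u(1) this(1) u(2) v(1) this(2) v(2) l]
    show "c = l" by (rule LIMSEQ_unique[OF c])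
  qed
  with l show ?thesis by simp
qed

text \<open>The form norm of the closure is made accessible through approximants. The L2 part needs
  its own argument, since both entries of the inner product vary: the second one is split into its
  limit and an error that tends to 0 against a bounded sequence.\<close>

lemma closure_form_norm_tendsto:
  assumes w: "w \<in> D" and v: "approx v x" "x \<in> L2 M"
  shows "(\<lambda>m. sqrt (q (\<lambda>y. w y - v m y))) \<longlonglongrightarrow> form_norm M (closure_form M D a) (\<lambda>y. w y - x y)"
proof -
  note vD = form_approxD(1)[OF v(1)]
  have app: "approx (\<lambda>m y. w y - v m y) (\<lambda>y. w y - x y)"
    by (rule form_approx_diff[OF form_approx_const[OF w] L2[OF w] v])
  have wx: "(\<lambda>y. w y - x y) \<in> L2 M" by (rule L2_diff[OF L2[OF w] v(2)])
  have wv: "(\<lambda>y. w y - v m y) \<in> L2 M" for m by (rule L2_diff[OF L2[OF w] L2[OF vD]])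
  let ?z = "\<lambda>m y. w y - v m y" and ?x = "\<lambda>y. w y - x y"
  have tn: "L2_tendsto M ?z ?x" by (rule form_approxD(3)[OF app])
  obtain C where C: "\<And>m. q (?z m) \<le> C"
      using q_Cauchy_bounded[OF form_approxD(1,2)[OF app]] by blast
  have "(\<lambda>m. L2_inner M (?z m) ?x) \<longlonglongrightarrow> L2_inner M ?x ?x"
    by (rule L2_tendsto_inner[OF tn wv wx wx])
  moreover have "(\<lambda>m. L2_inner M (?z m) (\<lambda>y. ?z m y - ?x y)) \<longlonglongrightarrow> 0"
  proof (rule Lim_null_comparison)
    have "L2_norm M (?z m) \<le> sqrt C" for m
      unfolding L2_norm_def using order_trans[OF Re_le_q(2)[OF form_approxD(1)[OF app]] C]
      by (rule real_sqrt_le_mono)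
    then show "\<forall>\<^sub>F m in sequentially. norm (L2_inner M (?z m) (\<lambda>y. ?z m y - ?x y)) \<le> 2 * (sqrt C * L2_norm M (\<lambda>y. ?z m y - ?x y))"
      by (intro always_eventually allI order_trans[OF cmod_L2_inner_le[OF wv L2_diff[OF wv wx]]] mult_left_mono mult_right_mono)
        (auto simp: L2_norm_nonneg)
    have "(\<lambda>m. 2 * (sqrt C * L2_norm M (\<lambda>y. ?z m y - ?x y))) \<longlonglongrightarrow> 2 * (sqrt C * 0)"
      using tn unfolding L2_tendsto_def by (intro tendsto_intros)
    then show "(\<lambda>m. 2 * (sqrt C * L2_norm M (\<lambda>y. ?z m y - ?x y))) \<longlonglongrightarrow> 0" by simp
  qed
  ultimately have "(\<lambda>m. L2_inner M (?z m) (?z m)) \<longlonglongrightarrow> L2_inner M ?x ?x"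
    unfolding L2.minus_right[OF wv wx wv] using tendsto_add by fastforce
  with closure_form_tendsto[OF app wx app wx] show ?thesis
    unfolding form_norm_eq by (intro tendsto_intros)
qed

text \<open>Translates convergence in the domain of the closure, as it occurs in the definition of a
  trace, into sequences in the original domain. If \<open>w\<close> approximates \<open>x\<close>,
  the distance from \<open>w n\<close> to \<open>x\<close> is the limit of its distances to
  \<open>w m\<close>. Conversely \<open>w\<close> is compared with some sequence \<open>v\<close>
  known to approximate \<open>x\<close>.\<close>

lemma closure_norm_tendsto_0_iff:
  assumes w: "\<And>n. w n \<in> D" and x: "x \<in> closure_dom M D a"
  shows "(\<lambda>n. form_norm M (closure_form M D a) (\<lambda>y. w n y - x y)) \<longlonglongrightarrow> 0 \<longleftrightarrow> approx w x"
proof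
  let ?f = "\<lambda>n. form_norm M (closure_form M D a) (\<lambda>y. w n y - x y)"
  have xL: "x \<in> L2 M" using x by (simp add: closure_dom_def)
  show "?f \<longlonglongrightarrow> 0" if app: "approx w x"
  proof (rule LIMSEQ_I)
    fix e :: real assume e: "e > 0"
    then have "(e / 2)\<^sup>2 > 0" by simp
    with form_approxD(2)[OF app] obtain N where N: "\<forall>m\<ge>N. \<forall>n\<ge>N. q (\<lambda>x. w m x - w n x) < (e / 2)\<^sup>2"
      unfolding q_Cauchy_def by blast
    have "norm (?f n - 0) < e" if n: "n \<ge> N" for n
    proof -
      have "sqrt (q (\<lambda>y. w n y - w m y)) \<le> e / 2" if "m \<ge> N" for m
        using N n that e by (intro real_le_lsqrt less_imp_le) auto
      then have "?f n \<le> e / 2"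
        by (intro LIMSEQ_le_const2[OF closure_form_norm_tendsto[OF w app xL]]) blast
      moreover have "0 \<le> ?f n"
        by (intro LIMSEQ_le_const[OF closure_form_norm_tendsto[OF w app xL]])
          (use b.nonneg[OF minus_mem[OF w w]] in auto)
      ultimately show ?thesis using e by simp
    qed
    then show "\<exists>no. \<forall>n\<ge>no. norm (?f n - 0) < e" by blast
  qed
  assume f: "?f \<longlonglongrightarrow> 0"
  obtain v where v: "approx v x" using x by (auto simp: closure_dom_def)
  note vD = form_approxD(1)[OF v]
  \<comment> \<open>The threshold for \<open>m\<close> depends on \<open>n\<close>. This suffices,
    because each later comparison of \<open>w m\<close> with \<open>w n\<close> may use a fresh
    common index of \<open>v\<close>.\<close>
  have close: "\<exists>N. \<forall>n\<ge>N. \<exists>M0. \<forall>m\<ge>M0. q (\<lambda>y. w n y - v m y) < e" if e: "e > 0" for e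
  proof -
    have "sqrt e > 0" using e by simp
    from LIMSEQ_D[OF f this] obtain N where N: "\<And>n. n \<ge> N \<Longrightarrow> ?f n < sqrt e" by fastforce
    have "\<exists>M0. \<forall>m\<ge>M0. q (\<lambda>y. w n y - v m y) < e" if "n \<ge> N" for n
    proof -
      have "\<forall>\<^sub>F m in sequentially. sqrt (q (\<lambda>y. w n y - v m y)) < sqrt e"
        by (rule order_tendstoD(2)[OF closure_form_norm_tendsto[OF w v xL] N[OF that]])
      then show ?thesis unfolding eventually_sequentially real_sqrt_less_iff .
    qed
    then show ?thesis by blast
  qed
  have "q_Cauchy w" unfolding q_Cauchy_def
  proof (intro allI impI)
    fix e :: real assume "e > 0"
    then have "e / 4 > 0" by simp
    from close[OF this] obtain N where N: "\<forall>n\<ge>N. \<exists>M0. \<forall>m\<ge>M0. q (\<lambda>y. w n y - v m y) < e / 4" by blast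
    have "q (\<lambda>x. w m x - w n x) < e" if mn: "m \<ge> N" "n \<ge> N" for m n
    proof -
      obtain M1 where M1: "\<forall>k\<ge>M1. q (\<lambda>y. w m y - v k y) < e / 4" using N[rule_format, OF mn(1)] ..
      obtain M2 where M2: "\<forall>k\<ge>M2. q (\<lambda>y. w n y - v k y) < e / 4" using N[rule_format, OF mn(2)] ..
      let ?k = "max M1 M2"
      have "q (\<lambda>x. w m x - w n x) \<le> 2 * q (\<lambda>x. w m x - v ?k x) + 2 * q (\<lambda>x. v ?k x - w n x)"
        by (rule b.quadratic_triangle[OF w vD w])
      moreover have "q (\<lambda>x. v ?k x - w n x) = q (\<lambda>x. w n x - v ?k x)"
        by (simp only: b.quadratic_minus_commute[OF vD w])
      moreover have "q (\<lambda>y. w m y - v ?k y) < e / 4" "q (\<lambda>y. w n y - v ?k y) < e / 4"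
        using M1 M2 by auto
      ultimately show ?thesis by linarith
    qed
    then show "\<exists>N. \<forall>m\<ge>N. \<forall>n\<ge>N. q (\<lambda>x. w m x - w n x) < e" by blast
  qed
  moreover have "L2_tendsto M w x" unfolding L2_tendsto_iff
  proof (rule LIMSEQ_I)
    fix e :: real assume e: "e > 0"
    then have "e / 4 > 0" by simp
    from close[OF this] obtain N where N: "\<forall>n\<ge>N. \<exists>M0. \<forall>m\<ge>M0. q (\<lambda>y. w n y - v m y) < e / 4" by blast
    have vx: "(\<lambda>m. \<integral>y. (cmod (v m y - x y))\<^sup>2 \<partial>M) \<longlonglongrightarrow> 0"
      using form_approxD(3)[OF v] unfolding L2_tendsto_iff .
    from LIMSEQ_D[OF vx \<open>e / 4 > 0\<close>]
    obtain M2 where M2: "\<And>m. m \<ge> M2 \<Longrightarrow> (\<integral>y. (cmod (v m y - x y))\<^sup>2 \<partial>M) < e / 4" by fastforce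
    have "norm ((\<integral>y. (cmod (w n y - x y))\<^sup>2 \<partial>M) - 0) < e" if n: "n \<ge> N" for n
    proof -
      obtain M1 where M1: "\<forall>k\<ge>M1. q (\<lambda>y. w n y - v k y) < e / 4" using N[rule_format, OF n] ..
      let ?k = "max M1 M2"
      have "(\<integral>y. (cmod (w n y - x y))\<^sup>2 \<partial>M) \<le> 2 * (\<integral>y. (cmod (w n y - v ?k y))\<^sup>2 \<partial>M) + 2 * (\<integral>y. (cmod (v ?k y - x y))\<^sup>2 \<partial>M)"
        by (rule L2_tendsto_triangle[OF L2[OF w] L2[OF vD] xL])
      moreover have "(\<integral>y. (cmod (w n y - v ?k y))\<^sup>2 \<partial>M) \<le> q (\<lambda>y. w n y - v ?k y)"
        by (rule Re_le_q(2)[OF minus_mem[OF w vD]])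
      moreover have "q (\<lambda>y. w n y - v ?k y) < e / 4" using M1 by simp
      moreover have "(\<integral>y. (cmod (v ?k y - x y))\<^sup>2 \<partial>M) < e / 4" by (rule M2) simp
      moreover have "0 \<le> (\<integral>y. (cmod (w n y - x y))\<^sup>2 \<partial>M)" by simp
      ultimately have "(\<integral>y. (cmod (w n y - x y))\<^sup>2 \<partial>M) < e" by linarith
      then show ?thesis by simp
    qed
    then show "\<exists>no. \<forall>n\<ge>no. norm ((\<integral>y. (cmod (w n y - x y))\<^sup>2 \<partial>M) - 0) < e" by blast
  qed
  ultimately show "approx w x" using w by (simp add: form_approx_iff)
qed

end

end

lemma (in L2_form) form_approx_0I:
  assumes w: "\<And>n. w n \<in> D" and q0: "(\<lambda>n. q (w n)) \<longlonglongrightarrow> 0"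
  shows "approx w (\<lambda>_. 0)"
  unfolding form_approx_iff
proof (intro conjI allI w)
  show "q_Cauchy w" unfolding q_Cauchy_def
  proof (intro allI impI)
    fix e :: real assume "e > 0"
    then have "e / 4 > 0" by simp
    from order_tendstoD(2)[OF q0 this] obtain N where N: "\<And>n. n \<ge> N \<Longrightarrow> q (w n) < e / 4"
      unfolding eventually_sequentially by blast
    have "q (\<lambda>x. w m x - w n x) < e" if "m \<ge> N" "n \<ge> N" for m n
      using b.quadratic_diff_le[OF w w, of m n] N[OF that(1)] N[OF that(2)] by linarith
    then show "\<exists>N. \<forall>m\<ge>N. \<forall>n\<ge>N. q (\<lambda>x. w m x - w n x) < e" by blast
  qed
  show "L2_tendsto M w (\<lambda>_. 0)" unfolding L2_tendsto_iff
  proof (rule Lim_null_comparison[OF _ q0])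
    show "\<forall>\<^sub>F n in sequentially. norm (\<integral>y. (cmod (w n y - 0))\<^sup>2 \<partial>M) \<le> q (w n)"
      using Re_le_q(2)[OF w] by (intro always_eventually allI) simp
  qed
qed

section \<open>Weak derivatives and the Neumann form\<close>

lemma has_weak_deriv_weak_deriv:
  assumes "u \<in> H1 \<Omega>"
  shows "weak_deriv \<Omega> i u \<in> L2 (lebesgue_on \<Omega>)" "has_weak_deriv \<Omega> i u (weak_deriv \<Omega> i u)"
proof -
  have "\<exists>g. g \<in> L2 (lebesgue_on \<Omega>) \<and> has_weak_deriv \<Omega> i u g"
    using assms by (auto simp: H1_def)
  from someI_ex[OF this]
  show "weak_deriv \<Omega> i u \<in> L2 (lebesgue_on \<Omega>)" "has_weak_deriv \<Omega> i u (weak_deriv \<Omega> i u)"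
    by (auto simp: weak_deriv_def)
qed

lemma H1_L2: "u \<in> H1 \<Omega> \<Longrightarrow> u \<in> L2 (lebesgue_on \<Omega>)"
  by (simp add: H1_def)

lemma H1I: "u \<in> L2 (lebesgue_on \<Omega>) \<Longrightarrow> (\<And>i. g i \<in> L2 (lebesgue_on \<Omega>)) \<Longrightarrow> (\<And>i. has_weak_deriv \<Omega> i u (g i)) \<Longrightarrow> u \<in> H1 \<Omega>"
  unfolding H1_def by blast

context
  fixes \<Omega> :: "(real^'n) set"
  assumes \<Omega>: "open \<Omega>"
begin

lemma sets_\<Omega>: "\<Omega> \<in> sets lebesgue"
  using \<Omega> by simp

lemma test_function_L2_\<Omega>: "\<phi> \<in> test_functions \<Omega>' \<Longrightarrow> \<phi> \<in> L2 (lebesgue_on \<Omega>)"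
  by (rule test_function_L2[OF _ sets_\<Omega>])

lemma integrable_L2_test_function:
  "u \<in> L2 (lebesgue_on \<Omega>) \<Longrightarrow> \<phi> \<in> test_functions \<Omega>' \<Longrightarrow> integrable (lebesgue_on \<Omega>) (\<lambda>x. u x * \<phi> x)"
  by (rule integrable_inner_L2(2)[OF _ test_function_L2_\<Omega>])

lemma weak_deriv_unique:
  assumes "has_weak_deriv \<Omega> i u g" "g \<in> L2 (lebesgue_on \<Omega>)" "has_weak_deriv \<Omega> i u h" "h \<in> L2 (lebesgue_on \<Omega>)"
  shows "AE x in lebesgue_on \<Omega>. g x = h x"
proof -
  have "AE x in lebesgue_on \<Omega>. g x - h x = 0"
  proof (rule AE_eq_0_of_test_functions[OF \<Omega> L2_diff[OF assms(2,4)]])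
    fix \<phi> assume \<phi>: "\<phi> \<in> test_functions \<Omega>"
    have "- (\<integral>x. g x * \<phi> x \<partial>lebesgue_on \<Omega>) = - (\<integral>x. h x * \<phi> x \<partial>lebesgue_on \<Omega>)"
      using assms(1,3) \<phi> unfolding has_weak_deriv_def by metis
    then show "(\<integral>x. (g x - h x) * \<phi> x \<partial>lebesgue_on \<Omega>) = 0"
      using integrable_L2_test_function[OF assms(2) \<phi>] integrable_L2_test_function[OF assms(4) \<phi>]
      by (simp add: left_diff_distrib)
  qed
  then show ?thesis by simp
qed

lemma has_weak_deriv_add:
  assumes "has_weak_deriv \<Omega> i u g" "has_weak_deriv \<Omega> i v h"
    and L2: "u \<in> L2 (lebesgue_on \<Omega>)" "g \<in> L2 (lebesgue_on \<Omega>)" "v \<in> L2 (lebesgue_on \<Omega>)" "h \<in> L2 (lebesgue_on \<Omega>)"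
  shows "has_weak_deriv \<Omega> i (\<lambda>x. u x + v x) (\<lambda>x. g x + h x)"
  unfolding has_weak_deriv_def
proof
  fix \<phi> assume \<phi>: "\<phi> \<in> test_functions \<Omega>"
  note d = test_function_partial_deriv[OF \<phi>, of i]
  show "(\<integral>x. (u x + v x) * partial_deriv i \<phi> x \<partial>lebesgue_on \<Omega>) = - (\<integral>x. (g x + h x) * \<phi> x \<partial>lebesgue_on \<Omega>)"
    using integrable_L2_test_function[OF L2(1) d] integrable_L2_test_function[OF L2(3) d]
      integrable_L2_test_function[OF L2(2) \<phi>] integrable_L2_test_function[OF L2(4) \<phi>]
      assms(1,2) \<phi> by (simp add: distrib_right has_weak_deriv_def)
qed

lemma has_weak_deriv_scale:
  assumes "has_weak_deriv \<Omega> i u g"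
  shows "has_weak_deriv \<Omega> i (\<lambda>x. k * u x) (\<lambda>x. k * g x)"
  using assms by (simp add: has_weak_deriv_def mult.assoc)

text \<open>The product \<open>\<eta> * \<phi>\<close> is itself a test function, so the weak
  derivative of \<open>u\<close> may be tested with it; the classical product rule for
  \<open>\<eta> * \<phi>\<close> does the rest.\<close>

lemma has_weak_deriv_mult:
  assumes u: "has_weak_deriv \<Omega> i u g" "u \<in> L2 (lebesgue_on \<Omega>)" "g \<in> L2 (lebesgue_on \<Omega>)"
    and \<eta>: "\<eta> \<in> test_functions UNIV"
  shows "has_weak_deriv \<Omega> i (\<lambda>x. \<eta> x * u x) (\<lambda>x. \<eta> x * g x + partial_deriv i \<eta> x * u x)"
  unfolding has_weak_deriv_def
proof
  fix \<phi> assume \<phi>: "\<phi> \<in> test_functions \<Omega>"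
  have \<eta>\<phi>: "(\<lambda>x. \<eta> x * \<phi> x) \<in> test_functions \<Omega>"
    "(\<lambda>x. \<eta> x * partial_deriv i \<phi> x) \<in> test_functions \<Omega>"
    "(\<lambda>x. partial_deriv i \<eta> x * \<phi> x) \<in> test_functions \<Omega>"
    by (intro test_function_mult test_function_partial_deriv \<phi> test_function_Ck[OF \<eta>]
        test_function_Ck[OF test_function_partial_deriv[OF \<eta>]])+
  note int = integrable_L2_test_function[OF u(2) \<eta>\<phi>(2)] integrable_L2_test_function[OF u(2) \<eta>\<phi>(3)]
    integrable_L2_test_function[OF u(3) \<eta>\<phi>(1)]
  have "partial_deriv i (\<lambda>x. \<eta> x * \<phi> x) = (\<lambda>x. \<eta> x * partial_deriv i \<phi> x + partial_deriv i \<eta> x * \<phi> x)"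
    by (intro ext partial_deriv_mult test_function_differentiable[OF \<eta>] test_function_differentiable[OF \<phi>])
  moreover have "(\<integral>x. u x * partial_deriv i (\<lambda>x. \<eta> x * \<phi> x) x \<partial>lebesgue_on \<Omega>)
    = - (\<integral>x. g x * (\<eta> x * \<phi> x) \<partial>lebesgue_on \<Omega>)"
    using u(1) \<eta>\<phi>(1) unfolding has_weak_deriv_def by (rule bspec)
  ultimately have "(\<integral>x. u x * (\<eta> x * partial_deriv i \<phi> x + partial_deriv i \<eta> x * \<phi> x) \<partial>lebesgue_on \<Omega>)
    = - (\<integral>x. g x * (\<eta> x * \<phi> x) \<partial>lebesgue_on \<Omega>)"
    by (simp only:)
  then have eq: "(\<integral>x. u x * (\<eta> x * partial_deriv i \<phi> x) \<partial>lebesgue_on \<Omega>) + (\<integral>x. u x * (partial_deriv i \<eta> x * \<phi> x) \<partial>lebesgue_on \<Omega>)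
    = - (\<integral>x. g x * (\<eta> x * \<phi> x) \<partial>lebesgue_on \<Omega>)"
    unfolding distrib_left Bochner_Integration.integral_add[OF int(1,2)] .
  have cancel: "A + B = - C \<Longrightarrow> A = - (C + B)" for A B C :: complex
    by algebra
  have "(\<integral>x. \<eta> x * u x * partial_deriv i \<phi> x \<partial>lebesgue_on \<Omega>) = (\<integral>x. u x * (\<eta> x * partial_deriv i \<phi> x) \<partial>lebesgue_on \<Omega>)"
    by (simp add: mult_ac)
  also have "\<dots> = - ((\<integral>x. g x * (\<eta> x * \<phi> x) \<partial>lebesgue_on \<Omega>) + (\<integral>x. u x * (partial_deriv i \<eta> x * \<phi> x) \<partial>lebesgue_on \<Omega>))"
    by (rule cancel[OF eq])
  also have "(\<integral>x. g x * (\<eta> x * \<phi> x) \<partial>lebesgue_on \<Omega>) + (\<integral>x. u x * (partial_deriv i \<eta> x * \<phi> x) \<partial>lebesgue_on \<Omega>)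
    = (\<integral>x. g x * (\<eta> x * \<phi> x) + u x * (partial_deriv i \<eta> x * \<phi> x) \<partial>lebesgue_on \<Omega>)"
    by (rule Bochner_Integration.integral_add[OF int(3,2), symmetric])
  also have "\<dots> = (\<integral>x. (\<eta> x * g x + partial_deriv i \<eta> x * u x) * \<phi> x \<partial>lebesgue_on \<Omega>)"
    by (simp add: algebra_simps)
  finally show "(\<integral>x. \<eta> x * u x * partial_deriv i \<phi> x \<partial>lebesgue_on \<Omega>)
    = - (\<integral>x. (\<eta> x * g x + partial_deriv i \<eta> x * u x) * \<phi> x \<partial>lebesgue_on \<Omega>)" .
qed

lemma L2_test_function_mult:
  assumes \<eta>: "\<eta> \<in> test_functions UNIV" and u: "u \<in> L2 (lebesgue_on \<Omega>)"
  shows "(\<lambda>x. \<eta> x * u x) \<in> L2 (lebesgue_on \<Omega>)"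
proof -
  note [measurable] = L2_measurable[OF u] borel_measurable_lebesgue_onI[OF test_function_borel[OF \<eta>]]
  obtain B where B: "\<And>x. cmod (\<eta> x) \<le> B" using test_function_bounded[OF \<eta>] by blast
  show ?thesis
    by (rule L2_dominated[OF u, of _ B]) (auto simp: norm_mult intro!: AE_I2 mult_right_mono B)
qed

lemma H1_zero: "(\<lambda>_. 0) \<in> H1 \<Omega>"
  by (rule H1I[of _ _ "\<lambda>_ _. 0"]) (auto simp: L2_zero has_weak_deriv_def)

lemma H1_add: "u \<in> H1 \<Omega> \<Longrightarrow> v \<in> H1 \<Omega> \<Longrightarrow> (\<lambda>x. u x + v x) \<in> H1 \<Omega>"
  by (rule H1I[of _ _ "\<lambda>i x. weak_deriv \<Omega> i u x + weak_deriv \<Omega> i v x"])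
    (simp_all add: L2_add has_weak_deriv_add has_weak_deriv_weak_deriv H1_L2)

lemma H1_scale: "u \<in> H1 \<Omega> \<Longrightarrow> (\<lambda>x. k * u x) \<in> H1 \<Omega>"
  by (rule H1I[of _ _ "\<lambda>i x. k * weak_deriv \<Omega> i u x"])
    (simp_all add: L2_scale has_weak_deriv_scale has_weak_deriv_weak_deriv H1_L2)

lemma H1_mult: "u \<in> H1 \<Omega> \<Longrightarrow> \<eta> \<in> test_functions UNIV \<Longrightarrow> (\<lambda>x. \<eta> x * u x) \<in> H1 \<Omega>"
  by (rule H1I[of _ _ "\<lambda>i x. \<eta> x * weak_deriv \<Omega> i u x + partial_deriv i \<eta> x * u x"])
    (simp_all add: L2_add L2_test_function_mult has_weak_deriv_mult has_weak_deriv_weak_deriv H1_L2 test_function_partial_deriv)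

lemma test_functions_H1: "\<phi> \<in> test_functions \<Omega>' \<Longrightarrow> \<phi> \<in> H1 \<Omega>"
  by (rule H1I[of _ _ "\<lambda>i. partial_deriv i \<phi>"])
    (auto intro: test_function_L2_\<Omega> test_function_partial_deriv has_weak_deriv_test_function[OF \<Omega>])

end

section \<open>Sectoriality of the Neumann form\<close>

lemma sector_imp:
  assumes "z \<in> sector \<theta>" "0 \<le> \<theta>" "\<theta> < pi / 2"
  shows "0 \<le> Re z" "\<bar>Im z\<bar> \<le> tan \<theta> * Re z"
proof -
  obtain r \<alpha> where z: "z = of_real r * cis \<alpha>" "r \<ge> 0" "\<bar>\<alpha>\<bar> \<le> \<theta>"
    using assms(1) by (auto simp: sector_def)
  have cos: "cos \<alpha> > 0" using z(3) assms by (intro cos_gt_zero_pi) auto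
  then show "0 \<le> Re z" using z by simp
  have "tan \<bar>\<alpha>\<bar> \<le> tan \<theta>" using z(3) assms by (intro tan_mono_le) auto
  moreover have "tan \<alpha> \<le> tan \<bar>\<alpha>\<bar>" "- tan \<alpha> \<le> tan \<bar>\<alpha>\<bar>"
    using tan_pos_pi2_le[of "\<bar>\<alpha>\<bar>"] z(3) assms by (auto simp: abs_if split: if_splits)
  ultimately have "\<bar>tan \<alpha>\<bar> \<le> tan \<theta>" by linarith
  moreover have "sin \<alpha> = tan \<alpha> * cos \<alpha>" using cos by (simp add: tan_def)
  ultimately have "\<bar>sin \<alpha>\<bar> \<le> tan \<theta> * cos \<alpha>"
    using cos by (simp add: abs_mult mult_right_mono)
  then show "\<bar>Im z\<bar> \<le> tan \<theta> * Re z"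
    using z(2) by (simp add: z(1) abs_mult mult_left_mono mult.left_commute)
qed

locale elliptic =
  fixes \<Omega> :: "(real^'n) set"
    and c :: "'n \<Rightarrow> 'n \<Rightarrow> real^'n \<Rightarrow> complex"
    and \<theta> :: real
  assumes \<Omega>: "open \<Omega>"
    and c: "\<And>i j. c i j \<in> Linfty (lebesgue_on \<Omega>)"
    and \<theta>: "0 \<le> \<theta>" "\<theta> < pi / 2"
    and sector: "\<And>\<xi> :: complex^'n. AE x in lebesgue_on \<Omega>.
           (\<Sum>i\<in>UNIV. \<Sum>j\<in>UNIV. c i j x * (\<xi> $ i) * cnj (\<xi> $ j)) \<in> sector \<theta>"
begin

abbreviation M :: "(real^'n) measure" where "M \<equiv> lebesgue_on \<Omega>"

abbreviation a_N :: "(real^'n) form" where "a_N \<equiv> neumann_form \<Omega> c"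

text \<open>The integrand of the Neumann form at a point. Vectors are plain functions of the index,
  so the values of derivative representatives can be inserted directly.\<close>

definition Q :: "real^'n \<Rightarrow> ('n \<Rightarrow> complex) \<Rightarrow> ('n \<Rightarrow> complex) \<Rightarrow> complex" where
  "Q x \<xi> \<zeta> = (\<Sum>i\<in>UNIV. \<Sum>j\<in>UNIV. \<xi> i * c i j x * cnj (\<zeta> j))"

text \<open>In the hypothesis the exceptional null set may depend on \<xi>, but the gradients to be
  inserted vary with \<open>x\<close>. A countable dense set of vectors and continuity of the
  quadratic form yield one null set for all of them.\<close>

lemma AE_Q: "AE x in M. \<forall>\<xi>. 0 \<le> Re (Q x \<xi> \<xi>) \<and> \<bar>Im (Q x \<xi> \<xi>)\<bar> \<le> tan \<theta> * Re (Q x \<xi> \<xi>)"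
proof -
  let ?Q = "\<lambda>x (\<xi>::complex^'n). Q x (\<lambda>i. \<xi> $ i) (\<lambda>i. \<xi> $ i)"
  obtain D :: "(complex^'n) set" where D: "countable D" "\<And>X. open X \<Longrightarrow> X \<noteq> {} \<Longrightarrow> \<exists>d\<in>D. d \<in> X"
    using countable_dense_setE by blast
  have "AE x in M. 0 \<le> Re (?Q x \<xi>) \<and> \<bar>Im (?Q x \<xi>)\<bar> \<le> tan \<theta> * Re (?Q x \<xi>)" for \<xi>
    using sector[of \<xi>]
  proof eventually_elim
    case (elim x)
    then have "?Q x \<xi> \<in> sector \<theta>" by (simp add: Q_def mult.commute[of "c _ _ _"])
    from sector_imp[OF this \<theta>] show ?case by simp
  qed
  then have "AE x in M. \<forall>\<xi>\<in>D. 0 \<le> Re (?Q x \<xi>) \<and> \<bar>Im (?Q x \<xi>)\<bar> \<le> tan \<theta> * Re (?Q x \<xi>)"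
    unfolding AE_ball_countable[OF D(1)] by blast
  then show ?thesis
  proof eventually_elim
    case (elim x)
    let ?S = "{\<xi>. 0 \<le> Re (?Q x \<xi>) \<and> \<bar>Im (?Q x \<xi>)\<bar> \<le> tan \<theta> * Re (?Q x \<xi>)}"
    have cont: "continuous_on UNIV (?Q x)" unfolding Q_def by (intro continuous_intros)
    have "closed ?S" by (intro closed_Collect_conj closed_Collect_le continuous_intros cont)
    then have "- ?S = {}" using D(2)[of "- ?S"] elim by (auto simp: open_Compl)
    then have S: "\<xi> \<in> ?S" for \<xi> by blast
    show ?case
    proof
      fix \<xi> :: "'n \<Rightarrow> complex"
      have "($) (\<chi> i. \<xi> i) = \<xi>" by (rule ext) simp
      with S[of "\<chi> i. \<xi> i"] show "0 \<le> Re (Q x \<xi> \<xi>) \<and> \<bar>Im (Q x \<xi> \<xi>)\<bar> \<le> tan \<theta> * Re (Q x \<xi> \<xi>)"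
        by simp
    qed
  qed
qed

lemma Q_add_le:
  assumes "\<forall>\<xi>. 0 \<le> Re (Q x \<xi> \<xi>)"
  shows "Re (Q x (\<lambda>i. \<xi> i + \<zeta> i) (\<lambda>i. \<xi> i + \<zeta> i)) \<le> 2 * Re (Q x \<xi> \<xi>) + 2 * Re (Q x \<zeta> \<zeta>)"
proof -
  have "Q x (\<lambda>i. \<xi> i + \<zeta> i) (\<lambda>i. \<xi> i + \<zeta> i) + Q x (\<lambda>i. \<xi> i - \<zeta> i) (\<lambda>i. \<xi> i - \<zeta> i) = 2 * Q x \<xi> \<xi> + 2 * Q x \<zeta> \<zeta>"
    unfolding Q_def sum.distrib[symmetric] sum_distrib_left
    by (intro sum.cong refl) (simp add: algebra_simps)
  from arg_cong[OF this, of Re] assms show ?thesis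
    by simp (smt (verit))
qed

lemma Q_scale: "Q x (\<lambda>i. k * \<xi> i) (\<lambda>i. k * \<xi> i) = of_real ((cmod k)\<^sup>2) * Q x \<xi> \<xi>"
  unfolding complex_norm_square Q_def sum_distrib_left
  by (intro sum.cong refl) (simp add: algebra_simps)

lemma c_bound:
  obtains C where "C \<ge> 0" "AE x in M. \<forall>i j. cmod (c i j x) \<le> C"
proof -
  have "\<exists>C. AE x in M. cmod (c i j x) \<le> C" for i j using c[of i j] by (simp add: Linfty_def)
  then obtain C where C: "\<And>i j. AE x in M. cmod (c i j x) \<le> C i j" by metis
  have "AE x in M. \<forall>i j. cmod (c i j x) \<le> C i j"
    using C by (simp add: AE_all_countable)
  then have "AE x in M. \<forall>i j. cmod (c i j x) \<le> (\<Sum>i\<in>UNIV. \<Sum>j\<in>UNIV. \<bar>C i j\<bar>)"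
  proof eventually_elim
    case (elim x)
    have "\<bar>C i j\<bar> \<le> (\<Sum>j\<in>UNIV. \<bar>C i j\<bar>)" for i j by (rule member_le_sum) auto
    moreover have "(\<Sum>j\<in>UNIV. \<bar>C i j\<bar>) \<le> (\<Sum>i\<in>UNIV. \<Sum>j\<in>UNIV. \<bar>C i j\<bar>)" for i
      by (rule member_le_sum[of i UNIV "\<lambda>i. \<Sum>j\<in>UNIV. \<bar>C i j\<bar>"]) (auto intro: sum_nonneg)
    ultimately show ?case using elim by (meson abs_ge_self order_trans)
  qed
  then show ?thesis by (intro that[of "\<Sum>i\<in>UNIV. \<Sum>j\<in>UNIV. \<bar>C i j\<bar>"]) (auto intro: sum_nonneg)
qed

lemma integrable_Q_summand:
  assumes "p \<in> L2 M" "r \<in> L2 M"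
  shows "integrable M (\<lambda>x. p x * c i j x * cnj (r x))"
proof -
  obtain C where C: "C \<ge> 0" "AE x in M. \<forall>i j. cmod (c i j x) \<le> C" by (rule c_bound)
  have [measurable]: "c i j \<in> borel_measurable M" using c[of i j] by (simp add: Linfty_def)
  note [measurable] = assms[THEN L2_measurable]
  show ?thesis
  proof (rule integrable_product_L2[OF assms])
    show "AE x in M. cmod (p x * c i j x * cnj (r x)) \<le> C * (cmod (p x) * cmod (r x))"
      using C(2)
    proof eventually_elim
      case (elim x)
      then have "cmod (c i j x) * (cmod (p x) * cmod (r x)) \<le> C * (cmod (p x) * cmod (r x))"
        by (intro mult_right_mono) auto
      then show ?case by (simp add: norm_mult mult_ac)
    qed
  qed measurable
qed

text \<open>The weak derivatives in the Neumann form are arbitrary representatives.\<close>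

lemma neumann_form_eq:
  assumes u: "u \<in> H1 \<Omega>" "\<And>i. p i \<in> L2 M" "\<And>i. has_weak_deriv \<Omega> i u (p i)"
    and v: "v \<in> H1 \<Omega>" "\<And>i. r i \<in> L2 M" "\<And>i. has_weak_deriv \<Omega> i v (r i)"
  shows "a_N u v = (\<Sum>i\<in>UNIV. \<Sum>j\<in>UNIV. \<integral>x. p i x * c i j x * cnj (r j x) \<partial>M)"
  unfolding neumann_form_def
proof (intro sum.cong refl)
  fix i j
  note du = has_weak_deriv_weak_deriv[OF u(1), of i] and dv = has_weak_deriv_weak_deriv[OF v(1), of j]
  have [measurable]: "c i j \<in> borel_measurable M" using c[of i j] by (simp add: Linfty_def)
  note [measurable] = L2_measurable[OF u(2)] L2_measurable[OF v(2)] L2_measurable[OF du(1)] L2_measurable[OF dv(1)]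
  have "AE x in M. weak_deriv \<Omega> i u x = p i x" "AE x in M. weak_deriv \<Omega> j v x = r j x"
    by (rule weak_deriv_unique[OF \<Omega> du(2,1) u(3,2)], rule weak_deriv_unique[OF \<Omega> dv(2,1) v(3,2)])
  then have "AE x in M. weak_deriv \<Omega> i u x * c i j x * cnj (weak_deriv \<Omega> j v x) = p i x * c i j x * cnj (r j x)"
    by eventually_elim simp
  then show "(\<integral>x. weak_deriv \<Omega> i u x * c i j x * cnj (weak_deriv \<Omega> j v x) \<partial>M) = (\<integral>x. p i x * c i j x * cnj (r j x) \<partial>M)"
    by (intro integral_cong_AE) measurable
qed

lemma neumann_form_eq_Q:
  assumes u: "u \<in> H1 \<Omega>" "\<And>i. p i \<in> L2 M" "\<And>i. has_weak_deriv \<Omega> i u (p i)"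
  shows "integrable M (\<lambda>x. Q x (\<lambda>i. p i x) (\<lambda>i. p i x))"
    "a_N u u = (\<integral>x. Q x (\<lambda>i. p i x) (\<lambda>i. p i x) \<partial>M)"
  unfolding neumann_form_eq[OF u u] Q_def
  using u(2) by (simp_all add: integrable_Q_summand)

lemma Re_neumann_form_eq:
  assumes u: "u \<in> H1 \<Omega>" "\<And>i. p i \<in> L2 M" "\<And>i. has_weak_deriv \<Omega> i u (p i)"
  shows "integrable M (\<lambda>x. Re (Q x (\<lambda>i. p i x) (\<lambda>i. p i x)))"
    "Re (a_N u u) = (\<integral>x. Re (Q x (\<lambda>i. p i x) (\<lambda>i. p i x)) \<partial>M)"
  using neumann_form_eq_Q[OF u] by simp_all

text \<open>The chosen \<open>weak_deriv\<close> is linear only up to null sets. Sums and multiples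
  of representatives are therefore inserted by \<open>neumann_form_eq\<close>, and the sign and the
  sector follow by integrating the pointwise estimates.\<close>

lemma nonneg_form_neumann: "nonneg_form (H1 \<Omega>) (a_N) (tan \<theta>)"
proof
  show "0 \<le> tan \<theta>" using \<theta> by (intro tan_pos_pi2_le) auto
next
  fix u v w k assume H1: "u \<in> H1 \<Omega>" "v \<in> H1 \<Omega>" "w \<in> H1 \<Omega>"
  let ?d = "\<lambda>u i. weak_deriv \<Omega> i u"
  note du = has_weak_deriv_weak_deriv[OF H1(1)] and dv = has_weak_deriv_weak_deriv[OF H1(2)]
    and dw = has_weak_deriv_weak_deriv[OF H1(3)]
  have uv: "(\<lambda>x. u x + v x) \<in> H1 \<Omega>" "\<And>i. (\<lambda>x. ?d u i x + ?d v i x) \<in> L2 M"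
    "\<And>i. has_weak_deriv \<Omega> i (\<lambda>x. u x + v x) (\<lambda>x. ?d u i x + ?d v i x)"
    by (intro H1_add[OF \<Omega>] L2_add has_weak_deriv_add[OF \<Omega>] H1 du dv H1_L2)+
  show "a_N (\<lambda>x. u x + v x) w = a_N u w + a_N v w"
    unfolding neumann_form_eq[OF uv H1(3) dw] neumann_form_eq[OF H1(1) du H1(3) dw] neumann_form_eq[OF H1(2) dv H1(3) dw]
    by (simp add: sum.distrib[symmetric] distrib_right integrable_Q_summand du dv dw)
  show "a_N w (\<lambda>x. u x + v x) = a_N w u + a_N w v"
    unfolding neumann_form_eq[OF H1(3) dw uv] neumann_form_eq[OF H1(3) dw H1(1) du] neumann_form_eq[OF H1(3) dw H1(2) dv]
    by (simp add: sum.distrib[symmetric] distrib_left integrable_Q_summand du dv dw)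
next
  fix u w k assume H1: "u \<in> H1 \<Omega>" "w \<in> H1 \<Omega>"
  let ?d = "\<lambda>u i. weak_deriv \<Omega> i u"
  note du = has_weak_deriv_weak_deriv[OF H1(1)] and dw = has_weak_deriv_weak_deriv[OF H1(2)]
  have ku: "(\<lambda>x. k * u x) \<in> H1 \<Omega>" "\<And>i. (\<lambda>x. k * ?d u i x) \<in> L2 M"
    "\<And>i. has_weak_deriv \<Omega> i (\<lambda>x. k * u x) (\<lambda>x. k * ?d u i x)"
    by (intro H1_scale[OF \<Omega>] L2_scale has_weak_deriv_scale[OF \<Omega>] H1 du)+
  show "a_N (\<lambda>x. k * u x) w = k * a_N u w"
    unfolding neumann_form_eq[OF ku H1(2) dw] neumann_form_eq[OF H1(1) du H1(2) dw]
    by (simp add: sum_distrib_left mult.assoc)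
  show "a_N w (\<lambda>x. k * u x) = cnj k * a_N w u"
    unfolding neumann_form_eq[OF H1(2) dw ku] neumann_form_eq[OF H1(2) dw H1(1) du]
    by (simp add: sum_distrib_left mult.left_commute)
next
  fix u assume u: "u \<in> H1 \<Omega>"
  note du = u has_weak_deriv_weak_deriv[OF u]
  let ?q = "\<lambda>x. Q x (\<lambda>i. weak_deriv \<Omega> i u x) (\<lambda>i. weak_deriv \<Omega> i u x)"
  show "0 \<le> Re (a_N u u)"
    unfolding Re_neumann_form_eq(2)[OF du]
    by (rule integral_nonneg_AE) (use AE_Q in \<open>auto elim!: eventually_mono\<close>)
  have "\<bar>\<integral>x. Im (?q x) \<partial>M\<bar> \<le> (\<integral>x. \<bar>Im (?q x)\<bar> \<partial>M)"
    using integral_norm_bound[of M "\<lambda>x. Im (?q x)"] by simp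
  also have "\<dots> \<le> (\<integral>x. tan \<theta> * Re (?q x) \<partial>M)"
    by (rule integral_mono_AE) (use AE_Q neumann_form_eq_Q(1)[OF du] in \<open>auto elim!: eventually_mono\<close>)
  also have "\<dots> = tan \<theta> * Re (a_N u u)"
    unfolding Re_neumann_form_eq(2)[OF du] by simp
  also have "(\<integral>x. Im (?q x) \<partial>M) = Im (a_N u u)"
    using neumann_form_eq_Q[OF du] by simp
  finally show "\<bar>Im (a_N u u)\<bar> \<le> tan \<theta> * Re (a_N u u)" .
qed (auto intro: H1_zero[OF \<Omega>] H1_add[OF \<Omega>] H1_scale[OF \<Omega>])

sublocale N: L2_form "H1 \<Omega>" "a_N" "tan \<theta>" M
  by (intro L2_form.intro nonneg_form_neumann L2_form_axioms.intro) (auto simp: H1_L2)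

text \<open>The coefficients may be degenerate, so the real part of the form need not control the
  gradient of \<open>u\<close>. Hence the term with \<open>\<eta>\<close> times the gradient is kept
  inside \<open>Q\<close>, where it scales, and only the term with the gradient of
  \<open>\<eta>\<close> is estimated by absolute values. The last property lets the same
  \<open>K\<close> serve for the boundary values.\<close>

lemma neumann_form_mult_bound:
  assumes \<eta>: "\<eta> \<in> test_functions UNIV"
  obtains K where "K > 0" "\<And>u. u \<in> H1 \<Omega> \<Longrightarrow> N.q (\<lambda>x. \<eta> x * u x) \<le> K * N.q u"
    "\<And>x. (cmod (\<eta> x))\<^sup>2 \<le> K"
proof -
  obtain B where B: "B > 0" "\<And>x. cmod (\<eta> x) \<le> B" using test_function_bounded[OF \<eta>] by blast
  have "\<exists>B'. \<forall>x. cmod (partial_deriv i \<eta> x) \<le> B'" for i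
    using test_function_bounded[OF test_function_partial_deriv[OF \<eta>, of i]] by metis
  then obtain B' where B': "\<And>i x. cmod (partial_deriv i \<eta> x) \<le> B' i" by metis
  obtain C where C: "C \<ge> 0" "AE x in M. \<forall>i j. cmod (c i j x) \<le> C" by (rule c_bound)
  \<comment> \<open>Bounds the form \<open>Q\<close> at the gradient of \<open>\<eta>\<close>. In
    the final constant, \<open>2 * B\<^sup>2\<close> and \<open>2 * C'\<close> come from the two
    parts of the product rule and the last \<open>B\<^sup>2\<close> from the L2 norm.\<close>
  define C' where "C' = (\<Sum>i\<in>UNIV. \<Sum>j\<in>UNIV. B' i * C * B' j)"
  have B'0: "0 \<le> B' i" for i using B'[of i] norm_ge_zero order_trans by blast
  have C'0: "0 \<le> C'" unfolding C'_def using C(1) B'0 by (intro sum_nonneg) auto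
  have B2: "(cmod (\<eta> x))\<^sup>2 \<le> B\<^sup>2" for x using B by (intro power_mono) auto
  have bound: "N.q (\<lambda>x. \<eta> x * u x) \<le> (2 * B\<^sup>2 + 2 * C' + B\<^sup>2) * N.q u" if u: "u \<in> H1 \<Omega>" for u
  proof -
    let ?d = "\<lambda>i x. weak_deriv \<Omega> i u x" and ?e = "\<lambda>i x. \<eta> x * weak_deriv \<Omega> i u x + partial_deriv i \<eta> x * u x"
    note du = u has_weak_deriv_weak_deriv[OF u]
    have uL: "u \<in> L2 M" by (rule H1_L2[OF u])
    have e: "(\<lambda>x. \<eta> x * u x) \<in> H1 \<Omega>" "\<And>i. ?e i \<in> L2 M" "\<And>i. has_weak_deriv \<Omega> i (\<lambda>x. \<eta> x * u x) (?e i)"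
      by (intro H1_mult[OF \<Omega>] L2_add L2_test_function_mult[OF \<Omega>] has_weak_deriv_mult[OF \<Omega>] du uL \<eta>
          test_function_partial_deriv)+
    have "Re (a_N (\<lambda>x. \<eta> x * u x) (\<lambda>x. \<eta> x * u x)) = (\<integral>x. Re (Q x (\<lambda>i. ?e i x) (\<lambda>i. ?e i x)) \<partial>M)"
      by (rule Re_neumann_form_eq(2)[OF e])
    also have "\<dots> \<le> (\<integral>x. 2 * B\<^sup>2 * Re (Q x (\<lambda>i. ?d i x) (\<lambda>i. ?d i x)) + 2 * C' * (cmod (u x))\<^sup>2 \<partial>M)"
    proof (rule integral_mono_AE)
      show "AE x in M. Re (Q x (\<lambda>i. ?e i x) (\<lambda>i. ?e i x)) \<le> 2 * B\<^sup>2 * Re (Q x (\<lambda>i. ?d i x) (\<lambda>i. ?d i x)) + 2 * C' * (cmod (u x))\<^sup>2"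
        using AE_Q C(2)
      proof eventually_elim
        case (elim x)
        let ?n = "\<lambda>i. partial_deriv i \<eta> x"
        have "Re (Q x (\<lambda>i. ?e i x) (\<lambda>i. ?e i x)) \<le> 2 * Re (Q x (\<lambda>i. \<eta> x * ?d i x) (\<lambda>i. \<eta> x * ?d i x))
           + 2 * Re (Q x (\<lambda>i. u x * ?n i) (\<lambda>i. u x * ?n i))"
          using Q_add_le[of x "\<lambda>i. \<eta> x * ?d i x" "\<lambda>i. u x * ?n i"] elim(1) by (simp add: mult.commute[of "u x"])
        also have "\<dots> = 2 * ((cmod (\<eta> x))\<^sup>2 * Re (Q x (\<lambda>i. ?d i x) (\<lambda>i. ?d i x))) + 2 * ((cmod (u x))\<^sup>2 * Re (Q x ?n ?n))"
          unfolding Q_scale by (simp del: of_real_power)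
        also have "\<dots> \<le> 2 * (B\<^sup>2 * Re (Q x (\<lambda>i. ?d i x) (\<lambda>i. ?d i x))) + 2 * ((cmod (u x))\<^sup>2 * C')"
        proof (intro add_mono mult_left_mono mult_right_mono B2)
          have "Re (Q x ?n ?n) \<le> cmod (Q x ?n ?n)" by (rule complex_Re_le_cmod)
          also have "\<dots> \<le> (\<Sum>i\<in>UNIV. \<Sum>j\<in>UNIV. cmod (?n i * c i j x * cnj (?n j)))"
            unfolding Q_def by (intro order_trans[OF norm_sum] sum_mono order_refl)
          also have "\<dots> \<le> C'"
            unfolding C'_def norm_mult complex_mod_cnj
            using B' B'0 C(1) elim(2) by (intro sum_mono mult_mono) auto
          finally show "Re (Q x ?n ?n) \<le> C'" .
        qed (use elim in auto)
        finally show ?case by (simp add: mult_ac)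
      qed
    qed (use Re_neumann_form_eq(1)[OF e] Re_neumann_form_eq(1)[OF du] L2_square_integrable[OF uL] in auto)
    also have "\<dots> = 2 * B\<^sup>2 * Re (a_N u u) + 2 * C' * (\<integral>x. (cmod (u x))\<^sup>2 \<partial>M)"
      unfolding Re_neumann_form_eq(2)[OF du]
      using Re_neumann_form_eq(1)[OF du] L2_square_integrable[OF uL] by simp
    finally have 1: "Re (a_N (\<lambda>x. \<eta> x * u x) (\<lambda>x. \<eta> x * u x))
      \<le> 2 * B\<^sup>2 * Re (a_N u u) + 2 * C' * (\<integral>x. (cmod (u x))\<^sup>2 \<partial>M)" .
    have "(\<integral>x. (cmod (\<eta> x * u x))\<^sup>2 \<partial>M) \<le> (\<integral>x. B\<^sup>2 * (cmod (u x))\<^sup>2 \<partial>M)"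
      using L2_square_integrable[OF uL] L2_square_integrable[OF H1_L2[OF e(1)]]
      by (intro integral_mono) (auto simp: norm_mult power_mult_distrib intro!: mult_right_mono B2)
    then have 2: "(\<integral>x. (cmod (\<eta> x * u x))\<^sup>2 \<partial>M) \<le> B\<^sup>2 * (\<integral>x. (cmod (u x))\<^sup>2 \<partial>M)" by simp
    have nn: "0 \<le> Re (a_N u u)" "0 \<le> (\<integral>x. (cmod (u x))\<^sup>2 \<partial>M)"
      using N.nonneg[OF u] by auto
    have le: "Re (a_N u u) \<le> N.q u" "(\<integral>x. (cmod (u x))\<^sup>2 \<partial>M) \<le> N.q u"
      using N.Re_le_q[OF u] by auto
    have "N.q (\<lambda>x. \<eta> x * u x) \<le> 2 * B\<^sup>2 * Re (a_N u u) + 2 * C' * (\<integral>x. (cmod (u x))\<^sup>2 \<partial>M) + B\<^sup>2 * (\<integral>x. (cmod (u x))\<^sup>2 \<partial>M)"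
      using 1 2 by (simp add: Re_L2_inner_self)
    also have "\<dots> \<le> 2 * B\<^sup>2 * N.q u + 2 * C' * N.q u + B\<^sup>2 * N.q u"
      using C'0 le by (intro add_mono mult_left_mono) auto
    finally show ?thesis by (simp add: distrib_right)
  qed
  show ?thesis
  proof (rule that[OF _ bound])
    have "B\<^sup>2 > 0" using B(1) by simp
    then show "2 * B\<^sup>2 + 2 * C' + B\<^sup>2 > 0" using C'0 by linarith
    show "(cmod (\<eta> x))\<^sup>2 \<le> 2 * B\<^sup>2 + 2 * C' + B\<^sup>2" for x
      using B2[of x] C'0 \<open>B\<^sup>2 > 0\<close> by linarith
  qed
qed

end

section \<open>Traces\<close>

lemma Ck_cnj: "Ck k f \<Longrightarrow> Ck k (\<lambda>x. cnj (f x))"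
proof (induction k arbitrary: f)
  case 0
  then show ?case by (auto intro: continuous_intros)
next
  case (Suc k)
  have d: "((\<lambda>x. cnj (f x)) has_derivative (\<lambda>h. cnj (frechet_derivative f (at x) h))) (at x)" for x
    using Suc.prems by (intro has_derivative_cnj has_derivative_frechet) simp
  have "partial_deriv i (\<lambda>x. cnj (f x)) = (\<lambda>x. cnj (partial_deriv i f x))" for i
    by (intro ext, subst partial_deriv_eq[OF d]) (simp add: partial_deriv_def)
  then show ?case using Suc d by (auto simp: differentiable_def)
qed

text \<open>Weak equations are tested with conjugated functions, the fundamental lemma with
  unconjugated ones.\<close>

lemma test_function_cnj: "\<phi> \<in> test_functions \<Omega> \<Longrightarrow> (\<lambda>x. cnj (\<phi> x)) \<in> test_functions \<Omega>"
  by (rule test_functions_subset_support[of \<phi>])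
    (auto intro: Ck_cnj test_function_Ck closure_subset[THEN subsetD])

text \<open>Midpoints are all that the parallelogram argument requires. With the hull as an
  intersection, a property passes to it as soon as it is stable under midpoints, and no finite
  convex combinations have to be written down.\<close>

definition midpoint_hull :: "('a \<Rightarrow> complex) set \<Rightarrow> ('a \<Rightarrow> complex) set" where
  "midpoint_hull S = \<Inter>{X. S \<subseteq> X \<and> (\<forall>u\<in>X. \<forall>v\<in>X. (\<lambda>x. (u x + v x) / 2) \<in> X)}"

lemma midpoint_hull_superset: "S \<subseteq> midpoint_hull S"
  by (auto simp: midpoint_hull_def)

lemma midpoint_hull_mono: "S \<subseteq> S' \<Longrightarrow> midpoint_hull S \<subseteq> midpoint_hull S'"
  unfolding midpoint_hull_def by (intro Inter_anti_mono) auto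

lemma midpoint_hull_midpoint:
  "u \<in> midpoint_hull S \<Longrightarrow> v \<in> midpoint_hull S \<Longrightarrow> (\<lambda>x. (u x + v x) / 2) \<in> midpoint_hull S"
  by (auto simp: midpoint_hull_def)

lemma midpoint_hull_least:
  "S \<subseteq> X \<Longrightarrow> (\<And>u v. u \<in> X \<Longrightarrow> v \<in> X \<Longrightarrow> (\<lambda>x. (u x + v x) / 2) \<in> X) \<Longrightarrow> midpoint_hull S \<subseteq> X"
  unfolding midpoint_hull_def by (rule Inter_lower) simp

lemma L2_tendsto_bounded:
  assumes "L2_tendsto M w x" "\<And>n. w n \<in> L2 M" "x \<in> L2 M"
  obtains B where "\<And>n. (\<integral>y. (cmod (w n y))\<^sup>2 \<partial>M) \<le> B"
proof -
  have "Bseq (\<lambda>n. \<integral>y. (cmod (w n y - x y))\<^sup>2 \<partial>M)"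
    using assms(1) unfolding L2_tendsto_iff by (intro convergent_imp_Bseq convergentI)
  then obtain K where K: "\<And>n. norm (\<integral>y. (cmod (w n y - x y))\<^sup>2 \<partial>M) \<le> K" by (auto simp: Bseq_def)
  have "(\<integral>y. (cmod (w n y))\<^sup>2 \<partial>M) \<le> 2 * K + 2 * (\<integral>y. (cmod (x y))\<^sup>2 \<partial>M)" for n
    using L2_tendsto_triangle[OF assms(2,3) L2_zero, of n] K[of n] by simp
  then show ?thesis by (rule that)
qed

section \<open>The form with boundary term as a sectorial form\<close>

locale robin = elliptic \<Omega> c \<theta> for \<Omega> :: "(real^'n) set" and c \<theta> +
  fixes \<mu> :: "(real^'n) measure"
  assumes sets_\<mu>: "sets \<mu> = sets (restrict_space borel (frontier \<Omega>))"
    and compact_finite: "\<And>K. compact K \<Longrightarrow> K \<subseteq> frontier \<Omega> \<Longrightarrow> emeasure \<mu> K < \<infinity>"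
    and closable: "closable (lebesgue_on \<Omega>) (H1 \<Omega>) (neumann_form \<Omega> c)"
begin

abbreviation V :: "(real^'n \<Rightarrow> complex) set" where "V \<equiv> form_dom \<Omega> \<mu>"

abbreviation a_R :: "(real^'n) form" where "a_R \<equiv> robin_form \<Omega> c \<mu>"

lemma space_\<mu>: "space \<mu> = frontier \<Omega>"
  using sets_eq_imp_space_eq[OF sets_\<mu>] by (simp add: space_restrict_space)

lemma borel_measurable_\<mu>I: "continuous_on (frontier \<Omega>) u \<Longrightarrow> u \<in> borel_measurable \<mu>"
  unfolding measurable_cong_sets[OF sets_\<mu> refl] by (rule borel_measurable_continuous_on_restrict)

lemma borel_measurable_\<mu>_ident: "(\<lambda>x. x) \<in> borel_measurable \<mu>"
  by (rule borel_measurable_\<mu>I) (rule continuous_on_id)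

lemma sigma_finite_\<mu>: "sigma_finite_measure \<mu>"
proof
  let ?K = "\<lambda>n::nat. frontier \<Omega> \<inter> cball 0 (real n)"
  show "\<exists>A. countable A \<and> A \<subseteq> sets \<mu> \<and> \<Union>A = space \<mu> \<and> (\<forall>a\<in>A. emeasure \<mu> a \<noteq> \<infinity>)"
  proof (intro exI[of _ "range ?K"] conjI ballI)
    show "range ?K \<subseteq> sets \<mu>"
      unfolding sets_\<mu> sets_restrict_space by (intro image_subsetI imageI) simp
    show "\<Union>(range ?K) = space \<mu>"
    proof -
      have "\<exists>n. x \<in> cball 0 (real n)" for x :: "real^'n"
        using real_arch_simple[of "norm x"] by auto
      then show ?thesis unfolding space_\<mu> by blast
    qed
    fix a assume "a \<in> range ?K"
    then obtain n where "a = ?K n" by blast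
    moreover have "compact (?K n)" by (intro closed_Int_compact) auto
    ultimately show "emeasure \<mu> a \<noteq> \<infinity>"
      using compact_finite[of "?K n"] by auto
  qed simp
qed

lemma form_dom_iff:
  "w \<in> V \<longleftrightarrow> w \<in> H1 \<Omega> \<and> continuous_on (closure \<Omega>) w \<and> w \<in> L2 \<mu>"
proof -
  have "w \<in> L2 \<mu> \<longleftrightarrow> (\<integral>\<^sup>+x. ennreal ((cmod (w x))\<^sup>2) \<partial>\<mu>) < \<infinity>" if "continuous_on (closure \<Omega>) w"
  proof -
    have [measurable]: "w \<in> borel_measurable \<mu>"
      using that by (intro borel_measurable_\<mu>I) (rule continuous_on_subset, auto simp: frontier_def)
    show ?thesis by (simp add: L2_def integrable_iff_bounded)
  qed
  then show ?thesis by (auto simp: form_dom_def)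
qed

lemma form_dom_H1: "w \<in> V \<Longrightarrow> w \<in> H1 \<Omega>"
  and form_dom_L2_\<mu>: "w \<in> V \<Longrightarrow> w \<in> L2 \<mu>"
  by (simp_all add: form_dom_iff)

lemma robin_form_eq: "a_R u v = a_N u v + L2_inner \<mu> u v"
  by (simp add: robin_form_def L2_inner_def)

lemma nonneg_form_dom: "nonneg_form (V) (a_N) (tan \<theta>)"
  by (rule nonneg_form_subset[OF nonneg_form_neumann])
    (auto simp: form_dom_iff N.mem L2_zero L2_add L2_scale intro!: continuous_intros)

sublocale R: L2_form V a_R "max (tan \<theta>) 0" "lebesgue_on \<Omega>"
proof (intro L2_form.intro L2_form_axioms.intro)
  have "nonneg_form (V) (\<lambda>u v. a_N u v + L2_inner \<mu> u v) (max (tan \<theta>) 0)"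
    by (rule nonneg_form_sum[OF nonneg_form_dom nonneg_form_L2_inner]) (auto simp: form_dom_iff)
  then show "nonneg_form (V) (a_R) (max (tan \<theta>) 0)"
    by (simp add: robin_form_eq[abs_def])
  show "V \<subseteq> L2 (lebesgue_on \<Omega>)" by (auto intro: form_dom_H1 H1_L2)
qed

lemma R_q_eq: "R.q w = N.q w + (\<integral>x. (cmod (w x))\<^sup>2 \<partial>\<mu>)"
  by (simp add: robin_form_eq Re_L2_inner_self)

lemma test_functions_form_dom:
  assumes "\<phi> \<in> test_functions \<Omega>"
  shows "\<phi> \<in> V" "x \<in> frontier \<Omega> \<Longrightarrow> \<phi> x = 0"
proof -
  have 0: "\<phi> x = 0" if "x \<in> frontier \<Omega>" for x
    using test_function_outside[OF assms] that \<Omega> by (auto simp: frontier_def interior_open)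
  then show "x \<in> frontier \<Omega> \<Longrightarrow> \<phi> x = 0" .
  have m: "\<phi> \<in> borel_measurable \<mu>"
    by (intro borel_measurable_\<mu>I test_function_continuous[OF assms])
  have "\<phi> \<in> L2 \<mu>"
    by (rule L2_dominated[OF L2_zero m, of 1]) (use 0 space_\<mu> in auto)
  then show "\<phi> \<in> V"
    using assms by (simp add: form_dom_iff test_functions_H1[OF \<Omega>] test_function_continuous)
qed

lemma L2_\<mu>_test_function_mult:
  assumes \<eta>: "\<eta> \<in> test_functions UNIV" and u: "u \<in> L2 \<mu>"
  shows "(\<lambda>x. \<eta> x * u x) \<in> L2 \<mu>"
proof -
  have [measurable]: "\<eta> \<in> borel_measurable \<mu>" by (intro borel_measurable_\<mu>I test_function_continuous[OF \<eta>])
  note [measurable] = L2_measurable[OF u]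
  obtain B where B: "\<And>x. cmod (\<eta> x) \<le> B" using test_function_bounded[OF \<eta>] by blast
  show ?thesis
    by (rule L2_dominated[OF u, of _ B]) (auto simp: norm_mult intro!: AE_I2 mult_right_mono B)
qed

lemma form_dom_mult:
  assumes w: "w \<in> V" and \<eta>: "\<eta> \<in> test_functions UNIV"
  shows "(\<lambda>x. \<eta> x * w x) \<in> V"
  using w by (auto simp: form_dom_iff H1_mult[OF \<Omega> _ \<eta>] L2_\<mu>_test_function_mult[OF \<eta>]
      intro!: continuous_on_mult test_function_continuous[OF \<eta>])

text \<open>From here on traces are handled by sequences in the form domain alone, without the norm
  of the closure.\<close>

lemma is_trace_iff:
  "is_trace \<Omega> c \<mu> u \<phi> \<longleftrightarrow> u \<in> L2 M \<and> \<phi> \<in> L2 \<mu> \<and>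
    (\<exists>w. (\<forall>n. w n \<in> V) \<and> N.approx w u \<and> L2_tendsto \<mu> w \<phi>)"
  (is "?lhs \<longleftrightarrow> ?rhs")
proof
  assume ?lhs
  then show ?rhs
    using N.closure_norm_tendsto_0_iff[OF closable form_dom_H1]
    by (auto simp: is_trace_def neumann_closure_dom_def neumann_closure_def closure_dom_def)
next
  assume rhs: ?rhs
  then have "u \<in> closure_dom M (H1 \<Omega>) (a_N)" by (auto simp: closure_dom_def)
  with rhs show ?lhs
    using N.closure_norm_tendsto_0_iff[OF closable form_dom_H1]
    by (auto simp: is_trace_def neumann_closure_dom_def neumann_closure_def)
qed

lemma is_trace_diff:
  assumes "is_trace \<Omega> c \<mu> u \<phi>" "is_trace \<Omega> c \<mu> v \<psi>"
  shows "is_trace \<Omega> c \<mu> (\<lambda>x. u x - v x) (\<lambda>x. \<phi> x - \<psi> x)"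
proof -
  obtain w w' where w: "\<And>n. w n \<in> V" "N.approx w u" "L2_tendsto \<mu> w \<phi>"
    and w': "\<And>n. w' n \<in> V" "N.approx w' v" "L2_tendsto \<mu> w' \<psi>"
    using assms unfolding is_trace_iff by blast
  have L: "u \<in> L2 M" "v \<in> L2 M" "\<phi> \<in> L2 \<mu>" "\<psi> \<in> L2 \<mu>" using assms by (auto simp: is_trace_iff)
  show ?thesis unfolding is_trace_iff
    by (intro conjI L2_diff L exI[of _ "\<lambda>n x. w n x - w' n x"] allI R.minus_mem w(1) w'(1)
        N.form_approx_diff w(2) w'(2) L2_tendsto_diff w(3) w'(3) form_dom_L2_\<mu>)
qed

section \<open>The traces of 0\<close>

definition T :: "(real^'n \<Rightarrow> complex) set" where
  "T = {\<phi>. is_trace \<Omega> c \<mu> (\<lambda>_. 0) \<phi>}"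

text \<open>The description by \<epsilon> instead of sequences spares diagonal sequences when
  closedness is shown. Closability enters in the forward direction, where an approximation of 0 must
  become small for the form.\<close>

lemma T_iff:
  "\<phi> \<in> T \<longleftrightarrow> \<phi> \<in> L2 \<mu> \<and> (\<forall>e>0. \<exists>w\<in>V. N.q w < e \<and> (\<integral>x. (cmod (w x - \<phi> x))\<^sup>2 \<partial>\<mu>) < e)"
  (is "_ \<longleftrightarrow> ?r")
proof
  assume "\<phi> \<in> T"
  then obtain w where w: "\<And>n. w n \<in> V" "N.approx w (\<lambda>_. 0)"
    "L2_tendsto \<mu> w \<phi>" and \<phi>: "\<phi> \<in> L2 \<mu>"
    unfolding T_def mem_Collect_eq is_trace_iff by blast
  have "\<exists>w\<in>V. N.q w < e \<and> (\<integral>x. (cmod (w x - \<phi> x))\<^sup>2 \<partial>\<mu>) < e" if "e > 0" for e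
  proof -
    have "\<forall>\<^sub>F n in sequentially. N.q (w n) < e \<and> (\<integral>x. (cmod (w n x - \<phi> x))\<^sup>2 \<partial>\<mu>) < e"
      using w(3) that unfolding L2_tendsto_iff
      by (intro eventually_conj order_tendstoD(2)[OF N.form_approx_0[OF closable w(2)]] order_tendstoD(2))
    then show ?thesis unfolding eventually_sequentially using w(1) by blast
  qed
  with \<phi> show ?r
    by blast
next
  assume r: ?r
  have "\<forall>n. \<exists>w. w \<in> V \<and> N.q w < inverse (real (Suc n)) \<and> (\<integral>x. (cmod (w x - \<phi> x))\<^sup>2 \<partial>\<mu>) < inverse (real (Suc n))"
  proof
    fix n
    have "inverse (real (Suc n)) > 0" by simp
    with r show "\<exists>w. w \<in> V \<and> N.q w < inverse (real (Suc n)) \<and> (\<integral>x. (cmod (w x - \<phi> x))\<^sup>2 \<partial>\<mu>) < inverse (real (Suc n))"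
      by blast
  qed
  from choice[OF this] obtain w where w: "\<And>n. w n \<in> V" "\<And>n. N.q (w n) < inverse (real (Suc n))"
    "\<And>n. (\<integral>x. (cmod (w n x - \<phi> x))\<^sup>2 \<partial>\<mu>) < inverse (real (Suc n))" by blast
  have "(\<lambda>n. N.q (w n)) \<longlonglongrightarrow> 0"
  proof (rule tendsto_sandwich[OF _ _ tendsto_const LIMSEQ_inverse_real_of_nat])
    show "\<forall>\<^sub>F n in sequentially. 0 \<le> N.q (w n)"
      by (intro always_eventually allI N.b.nonneg form_dom_H1 w)
    show "\<forall>\<^sub>F n in sequentially. N.q (w n) \<le> inverse (real (Suc n))"
      by (intro always_eventually allI less_imp_le w)
  qed
  then have "N.approx w (\<lambda>_. 0)"
    by (intro N.form_approx_0I form_dom_H1 w)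
  moreover have "L2_tendsto \<mu> w \<phi>" unfolding L2_tendsto_iff
  proof (rule tendsto_sandwich[OF _ _ tendsto_const LIMSEQ_inverse_real_of_nat])
    show "\<forall>\<^sub>F n in sequentially. 0 \<le> (\<integral>x. (cmod (w n x - \<phi> x))\<^sup>2 \<partial>\<mu>)" by simp
    show "\<forall>\<^sub>F n in sequentially. (\<integral>x. (cmod (w n x - \<phi> x))\<^sup>2 \<partial>\<mu>) \<le> inverse (real (Suc n))"
      by (intro always_eventually allI less_imp_le w)
  qed
  ultimately show "\<phi> \<in> T" using r w(1) unfolding T_def mem_Collect_eq is_trace_iff by (blast intro: L2_zero)
qed

lemma T_approx:
  assumes "\<phi> \<in> T" "e > 0"
  obtains w where "w \<in> V" "N.q w < e" "(\<integral>x. (cmod (w x - \<phi> x))\<^sup>2 \<partial>\<mu>) < e"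
  using assms unfolding T_iff by blast

lemma closed_L2_subspace_T: "closed_L2_subspace \<mu> T"
  unfolding closed_L2_subspace_def
proof (intro conjI ballI allI impI)
  show "T \<subseteq> L2 \<mu>" by (auto simp: T_iff)
  show "(\<lambda>_. 0) \<in> T" unfolding T_iff
  proof (intro conjI allI impI L2_zero bexI[OF _ R.zero_mem])
    have "N.q (\<lambda>_. 0) = 0" using N.b.zero_form(1)[OF N.zero_mem] by simp
    then show "N.q (\<lambda>_. 0) < e" "(\<integral>x. (cmod (0 - 0))\<^sup>2 \<partial>\<mu>) < e" if "e > 0" for e :: real
      using that by simp_all
  qed
next
  fix \<phi> \<psi> assume \<phi>: "\<phi> \<in> T" and \<psi>: "\<psi> \<in> T"
  have L: "\<phi> \<in> L2 \<mu>" "\<psi> \<in> L2 \<mu>" using \<phi> \<psi> by (auto simp: T_iff)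
  show "(\<lambda>x. \<phi> x + \<psi> x) \<in> T" unfolding T_iff
  proof (intro conjI allI impI L2_add L)
    fix e :: real assume "e > 0"
    \<comment> \<open>The triangle inequality for squares doubles each of its two terms.\<close>
    then have e: "e / 4 > 0" by simp
    obtain w where w: "w \<in> V" "N.q w < e / 4" "(\<integral>x. (cmod (w x - \<phi> x))\<^sup>2 \<partial>\<mu>) < e / 4"
      by (rule T_approx[OF \<phi> e])
    obtain v where v: "v \<in> V" "N.q v < e / 4" "(\<integral>x. (cmod (v x - \<psi> x))\<^sup>2 \<partial>\<mu>) < e / 4"
      by (rule T_approx[OF \<psi> e])
    have "N.q (\<lambda>x. w x + v x) < e"
      using N.b.quadratic_add_le[OF form_dom_H1[OF w(1)] form_dom_H1[OF v(1)]] w(2) v(2) by linarith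
    moreover have "(\<integral>x. (cmod (w x + v x - (\<phi> x + \<psi> x)))\<^sup>2 \<partial>\<mu>) < e"
    proof -
      have eq: "w x + v x - (\<phi> x + \<psi> x) = (w x - \<phi> x) + (v x - \<psi> x)" for x by simp
      have "(\<integral>x. (cmod ((w x - \<phi> x) + (v x - \<psi> x)))\<^sup>2 \<partial>\<mu>)
        \<le> 2 * (\<integral>x. (cmod (w x - \<phi> x))\<^sup>2 \<partial>\<mu>) + 2 * (\<integral>x. (cmod (v x - \<psi> x))\<^sup>2 \<partial>\<mu>)"
        using L2.quadratic_add_le[OF L2_diff[OF form_dom_L2_\<mu>[OF w(1)] L(1)] L2_diff[OF form_dom_L2_\<mu>[OF v(1)] L(2)]]
        by (simp only: Re_L2_inner_self)
      with w(3) v(3) show ?thesis unfolding eq by linarith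
    qed
    ultimately show "\<exists>w\<in>V. N.q w < e \<and> (\<integral>x. (cmod (w x - (\<phi> x + \<psi> x)))\<^sup>2 \<partial>\<mu>) < e"
      by (intro bexI[OF _ R.add_mem[OF w(1) v(1)]]) blast
  qed
next
  fix \<phi> k assume \<phi>: "\<phi> \<in> T"
  have L: "\<phi> \<in> L2 \<mu>" using \<phi> by (auto simp: T_iff)
  show "(\<lambda>x. k * \<phi> x) \<in> T" unfolding T_iff
  proof (intro conjI allI impI L2_scale L)
    fix e :: real assume e: "e > 0"
    \<comment> \<open>The summand 1 covers the case \<open>k = 0\<close>.\<close>
    have k: "(cmod k)\<^sup>2 + 1 > 0" by (simp add: add_nonneg_pos)
    then have "e / ((cmod k)\<^sup>2 + 1) > 0" using e by simp
    from T_approx[OF \<phi> this] obtain w where w: "w \<in> V" "N.q w < e / ((cmod k)\<^sup>2 + 1)"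
      "(\<integral>x. (cmod (w x - \<phi> x))\<^sup>2 \<partial>\<mu>) < e / ((cmod k)\<^sup>2 + 1)" by blast
    have less: "(cmod k)\<^sup>2 * s < e" if "s < e / ((cmod k)\<^sup>2 + 1)" "s \<ge> 0" for s
    proof -
      have "(cmod k)\<^sup>2 * s \<le> ((cmod k)\<^sup>2 + 1) * s" using that(2) by (simp add: distrib_right)
      also have "\<dots> < e" using that(1) k by (simp add: pos_less_divide_eq mult.commute)
      finally show ?thesis .
    qed
    have "N.q (\<lambda>x. k * w x) = (cmod k)\<^sup>2 * N.q w"
      by (rule N.b.quadratic_scale[OF form_dom_H1[OF w(1)]])
    then have "N.q (\<lambda>x. k * w x) < e"
      using less[OF w(2) N.b.nonneg[OF form_dom_H1[OF w(1)]]] by simp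
    moreover have "(\<integral>x. (cmod (k * w x - k * \<phi> x))\<^sup>2 \<partial>\<mu>) < e"
      unfolding right_diff_distrib[symmetric] norm_mult power_mult_distrib
      using less[OF w(3)] by simp
    ultimately show "\<exists>w\<in>V. N.q w < e \<and> (\<integral>x. (cmod (w x - k * \<phi> x))\<^sup>2 \<partial>\<mu>) < e"
      by (intro bexI[OF _ R.scale_mem[OF w(1)]]) blast
  qed
next
  fix u \<phi> assume u: "\<forall>n. u n \<in> T" and L: "\<phi> \<in> L2 \<mu>" and lim: "L2_tendsto \<mu> u \<phi>"
  show "\<phi> \<in> T" unfolding T_iff
  proof (intro conjI allI impI L)
    fix e :: real assume e': "e > 0"
    then have e: "e / 4 > 0" by simp
    from order_tendstoD(2)[OF lim[unfolded L2_tendsto_iff] e]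
    obtain n where n: "(\<integral>x. (cmod (u n x - \<phi> x))\<^sup>2 \<partial>\<mu>) < e / 4"
      unfolding eventually_sequentially by blast
    have un: "u n \<in> T" using u by blast
    then have unL: "u n \<in> L2 \<mu>" by (auto simp: T_iff)
    obtain w where w: "w \<in> V" "N.q w < e / 4" "(\<integral>x. (cmod (w x - u n x))\<^sup>2 \<partial>\<mu>) < e / 4"
      by (rule T_approx[OF un e])
    have "(\<integral>x. (cmod (w x - \<phi> x))\<^sup>2 \<partial>\<mu>) < e"
      using L2_tendsto_triangle[OF form_dom_L2_\<mu>[OF w(1)] unL L] n w(3) by linarith
    moreover have "N.q w < e" using w(2) e' by linarith
    ultimately show "\<exists>w\<in>V. N.q w < e \<and> (\<integral>x. (cmod (w x - \<phi> x))\<^sup>2 \<partial>\<mu>) < e"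
      using w(1) by blast
  qed
qed

lemma T_mult:
  assumes \<eta>: "\<eta> \<in> test_functions UNIV" and \<phi>: "\<phi> \<in> T"
  shows "(\<lambda>x. \<eta> x * \<phi> x) \<in> T"
  unfolding T_iff
proof (intro conjI allI impI)
  have L: "\<phi> \<in> L2 \<mu>" using \<phi> by (auto simp: T_iff)
  then show "(\<lambda>x. \<eta> x * \<phi> x) \<in> L2 \<mu>" by (rule L2_\<mu>_test_function_mult[OF \<eta>])
  fix e :: real assume e: "e > 0"
  obtain K where K: "K > 0" "\<And>u. u \<in> H1 \<Omega> \<Longrightarrow> N.q (\<lambda>x. \<eta> x * u x) \<le> K * N.q u"
    "\<And>x. (cmod (\<eta> x))\<^sup>2 \<le> K" using neumann_form_mult_bound[OF \<eta>] by blast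
  have "e / K > 0" using e K(1) by simp
  from T_approx[OF \<phi> this] obtain w where w: "w \<in> V" "N.q w < e / K"
    "(\<integral>x. (cmod (w x - \<phi> x))\<^sup>2 \<partial>\<mu>) < e / K" by blast
  have wm: "(\<lambda>x. \<eta> x * w x) \<in> V" by (rule form_dom_mult[OF w(1) \<eta>])
  have less: "K * s < e" if "s < e / K" for s
    using that K(1) by (simp add: pos_less_divide_eq mult.commute)
  have "N.q (\<lambda>x. \<eta> x * w x) < e"
    using K(2)[OF form_dom_H1[OF w(1)]] less[OF w(2)] by linarith
  moreover have "(\<integral>x. (cmod (\<eta> x * w x - \<eta> x * \<phi> x))\<^sup>2 \<partial>\<mu>) \<le> (\<integral>x. K * (cmod (w x - \<phi> x))\<^sup>2 \<partial>\<mu>)"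
  proof (rule integral_mono)
    show "integrable \<mu> (\<lambda>x. (cmod (\<eta> x * w x - \<eta> x * \<phi> x))\<^sup>2)"
      by (intro L2_square_integrable L2_diff L2_\<mu>_test_function_mult[OF \<eta>] L form_dom_L2_\<mu>[OF w(1)])
    show "integrable \<mu> (\<lambda>x. K * (cmod (w x - \<phi> x))\<^sup>2)"
      by (intro integrable_mult_right L2_square_integrable L2_diff L form_dom_L2_\<mu>[OF w(1)])
    show "(cmod (\<eta> x * w x - \<eta> x * \<phi> x))\<^sup>2 \<le> K * (cmod (w x - \<phi> x))\<^sup>2" for x
      unfolding right_diff_distrib[symmetric] norm_mult power_mult_distrib
      by (intro mult_right_mono K) simp
  qed
  then have "(\<integral>x. (cmod (\<eta> x * w x - \<eta> x * \<phi> x))\<^sup>2 \<partial>\<mu>) < e"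
    using less[OF w(3)] by simp
  ultimately show "\<exists>w\<in>V. N.q w < e \<and> (\<integral>x. (cmod (w x - \<eta> x * \<phi> x))\<^sup>2 \<partial>\<mu>) < e"
    by (intro bexI[OF _ wm]) blast
qed

text \<open>Existence of such a set is what makes the choice in \<open>trace_set\<close> meaningful;
  it follows from \<open>indicator_invariant_subspace\<close>, as \<open>T\<close> is closed and
  invariant under smooth multipliers.\<close>

lemma trace_set_spec:
  "trace_set \<Omega> c \<mu> \<in> sets \<mu>"
  "T = {\<phi> \<in> L2 \<mu>. AE x in \<mu>. x \<in> trace_set \<Omega> c \<mu> \<longrightarrow> \<phi> x = 0}"
proof -
  have inv: "(\<lambda>x. indicator A x * u x) \<in> T" if A: "A \<in> sets \<mu>" and u: "u \<in> T" for A u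
  proof -
    \<comment> \<open>Invariance is available for Borel sets of the whole space; on the boundary
      \<open>A'\<close> and \<open>A\<close> have the same indicator.\<close>
    obtain A' where A': "A' \<in> sets borel" "A = frontier \<Omega> \<inter> A'"
      using A unfolding sets_\<mu> sets_restrict_space by auto
    have "(\<lambda>x. indicator A' x * u x) \<in> T"
      by (rule closed_L2_subspace_mult_invariant[OF closed_L2_subspace_T borel_measurable_\<mu>_ident T_mult A'(1) u])
    moreover have "(\<lambda>x. indicator A x * u x) \<in> borel_measurable \<mu>"
      using A u L2_measurable[of u \<mu>] by (auto simp: T_iff)
    moreover have "AE x in \<mu>. indicator A' x * u x = indicator A x * u x"
      by (rule AE_I2) (simp add: A'(2) space_\<mu> indicator_def)
    ultimately show ?thesis by (rule subspace_AE_eq[OF closed_L2_subspace_T])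
  qed
  obtain G where "G \<in> sets \<mu>" "T = {u \<in> L2 \<mu>. AE x in \<mu>. x \<in> G \<longrightarrow> u x = 0}"
    using indicator_invariant_subspace[OF closed_L2_subspace_T sigma_finite_\<mu> inv] by blast
  then have "\<exists>G. G \<in> sets \<mu> \<and> {\<phi>. is_trace \<Omega> c \<mu> (\<lambda>_. 0) \<phi>} = {\<phi> \<in> L2 \<mu>. AE x in \<mu>. x \<in> G \<longrightarrow> \<phi> x = 0}"
    unfolding T_def by blast
  from someI_ex[OF this] show "trace_set \<Omega> c \<mu> \<in> sets \<mu>"
    "T = {\<phi> \<in> L2 \<mu>. AE x in \<mu>. x \<in> trace_set \<Omega> c \<mu> \<longrightarrow> \<phi> x = 0}"
    unfolding trace_set_def T_def by auto
qed

text \<open>Any trace can be normalized: its part outside \<open>trace_set\<close> is a trace of 0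
  and may be subtracted. The result is the witness that the choice in \<open>Tr\<close>
  needs.\<close>

lemma Tr_spec:
  assumes "u \<in> H1_trace \<Omega> c \<mu>"
  shows "Tr \<Omega> c \<mu> u \<in> L2 \<mu>" "\<And>x. x \<in> frontier \<Omega> \<Longrightarrow> x \<notin> trace_set \<Omega> c \<mu> \<Longrightarrow> Tr \<Omega> c \<mu> u x = 0"
    "is_trace \<Omega> c \<mu> u (Tr \<Omega> c \<mu> u)"
proof -
  let ?G = "trace_set \<Omega> c \<mu>"
  obtain \<phi> where \<phi>: "\<phi> \<in> L2 \<mu>" "is_trace \<Omega> c \<mu> u \<phi>" using assms by (auto simp: H1_trace_def)
  note [measurable] = L2_measurable[OF \<phi>(1)] trace_set_spec(1)
  have "(\<lambda>x. indicator (space \<mu> - ?G) x * \<phi> x) \<in> L2 \<mu>"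
    by (rule L2_dominated[OF \<phi>(1), of _ 1]) (auto simp: norm_mult indicator_def)
  then have "(\<lambda>x. indicator (space \<mu> - ?G) x * \<phi> x) \<in> T"
    unfolding trace_set_spec(2) by (auto simp: indicator_def)
  from is_trace_diff[OF \<phi>(2) this[unfolded T_def mem_Collect_eq]]
  have t: "is_trace \<Omega> c \<mu> u (\<lambda>x. \<phi> x - indicator (space \<mu> - ?G) x * \<phi> x)" by simp
  then have "\<exists>\<phi>. \<phi> \<in> L2 \<mu> \<and> (\<forall>x\<in>frontier \<Omega> - ?G. \<phi> x = 0) \<and> is_trace \<Omega> c \<mu> u \<phi>"
    by (intro exI[of _ "\<lambda>x. \<phi> x - indicator (space \<mu> - ?G) x * \<phi> x"]) (auto simp: space_\<mu> is_trace_iff)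
  from someI_ex[OF this] show "Tr \<Omega> c \<mu> u \<in> L2 \<mu>"
    "\<And>x. x \<in> frontier \<Omega> \<Longrightarrow> x \<notin> ?G \<Longrightarrow> Tr \<Omega> c \<mu> u x = 0" "is_trace \<Omega> c \<mu> u (Tr \<Omega> c \<mu> u)"
    unfolding Tr_def by auto
qed

text \<open>The chosen representative and \<open>f\<close> satisfy the same weak equation, so the
  fundamental lemma identifies them almost everywhere.\<close>

lemma weak_operator_integral:
  assumes f: "weakly_eq \<Omega> c u f" and v: "v \<in> L2 M"
  shows "(\<integral>x. weak_operator \<Omega> c u x * cnj (v x) \<partial>M) = (\<integral>x. f x * cnj (v x) \<partial>M)"
proof -
  let ?g = "weak_operator \<Omega> c u"
  have g: "weakly_eq \<Omega> c u ?g"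
    unfolding weak_operator_def by (rule someI[of "weakly_eq \<Omega> c u", OF f])
  have L: "f \<in> L2 M" "?g \<in> L2 M" using f g by (auto simp: weakly_eq_def)
  have "AE x in M. ?g x - f x = 0"
  proof (rule AE_eq_0_of_test_functions[OF \<Omega> L2_diff[OF L(2,1)]])
    fix \<phi> assume \<phi>: "\<phi> \<in> test_functions \<Omega>"
    have eq: "neumann_closure \<Omega> c u (\<lambda>x. cnj (\<phi> x)) = (\<integral>x. h x * cnj (cnj (\<phi> x)) \<partial>M)"
      if "weakly_eq \<Omega> c u h" for h
      using that test_function_cnj[OF \<phi>] unfolding weakly_eq_def by blast
    have "(\<integral>x. ?g x * cnj (cnj (\<phi> x)) \<partial>M) = (\<integral>x. f x * cnj (cnj (\<phi> x)) \<partial>M)"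
      by (rule trans[OF eq[OF g, symmetric] eq[OF f]])
    then show "(\<integral>x. (?g x - f x) * \<phi> x \<partial>M) = 0"
      using integrable_L2_test_function[OF \<Omega> L(1) \<phi>] integrable_L2_test_function[OF \<Omega> L(2) \<phi>]
      by (simp add: left_diff_distrib)
  qed
  then have ae: "AE x in M. f x = ?g x" by eventually_elim simp
  note [measurable] = L2_measurable[OF v] L[THEN L2_measurable]
  have "AE x in M. ?g x * cnj (v x) = f x * cnj (v x)"
    using ae by eventually_elim simp
  then show ?thesis by (intro integral_cong_AE) measurable
qed

end

section \<open>Limits in the form with boundary term\<close>

context robin
begin

lemma form_approx_tendsto_robin:
  assumes g: "\<And>n. g n \<in> V" "N.approx g u" "u \<in> L2 M"
    and \<phi>: "L2_tendsto \<mu> g \<phi>" "\<phi> \<in> L2 \<mu>" and v: "v \<in> V"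
  shows "(\<lambda>n. a_R (g n) v) \<longlonglongrightarrow> neumann_closure \<Omega> c u v + L2_inner \<mu> \<phi> v"
  unfolding robin_form_eq neumann_closure_def
  by (intro tendsto_add N.closure_form_tendsto[OF closable g(2,3) N.form_approx_const] H1_L2
      L2_tendsto_inner \<phi> form_dom_H1 form_dom_L2_\<mu> g v)

text \<open>Continuity of the closure in its second argument, obtained from the approximants of
  \<open>u\<close>; it will be applied to a sequence \<open>v\<close> that tends to 0.\<close>

lemma cmod_neumann_closure_le:
  assumes g: "N.approx g u" "u \<in> L2 M" and B: "\<And>n. N.q (g n) \<le> B"
    and v: "v \<in> H1 \<Omega>"
  shows "cmod (neumann_closure \<Omega> c u v) \<le> 2 * (1 + tan \<theta>) * (sqrt B * sqrt (N.q v))"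
proof (rule LIMSEQ_le_const2)
  show "(\<lambda>n. cmod (a_N (g n) v)) \<longlonglongrightarrow> cmod (neumann_closure \<Omega> c u v)"
    unfolding neumann_closure_def
    by (intro tendsto_norm N.closure_form_tendsto[OF closable g N.form_approx_const] v H1_L2)
  have "cmod (a_N (g n) v) \<le> 2 * (1 + tan \<theta>) * (sqrt B * sqrt (N.q v))" for n
  proof (rule order_trans[OF N.cmod_le_q[OF N.form_approxD(1)[OF g(1)] v]])
    show "2 * (1 + tan \<theta>) * (sqrt (N.q (g n)) * sqrt (N.q v)) \<le> 2 * (1 + tan \<theta>) * (sqrt B * sqrt (N.q v))"
      using N.angle_nonneg N.b.nonneg[OF v] by (intro mult_left_mono mult_right_mono real_sqrt_le_mono B) auto
  qed
  then show "\<exists>N. \<forall>n\<ge>N. cmod (a_N (g n) v) \<le> 2 * (1 + tan \<theta>) * (sqrt B * sqrt (N.q v))"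
    by blast
qed

section \<open>The operator\<close>

text \<open>Passing to midpoint combinations turns the weak convergence in the definition of the operator
  into convergence with respect to the form norm.\<close>

lemma form_operator_strong_approx:
  assumes op: "(u, f) \<in> form_operator M (V) (a_R)"
  obtains g \<phi> where "\<And>n. g n \<in> V" "N.approx g u"
    "L2_tendsto \<mu> g \<phi>" "\<phi> \<in> L2 \<mu>"
    "\<And>v. v \<in> V \<Longrightarrow> (\<lambda>n. a_R (g n) v) \<longlonglongrightarrow> L2_inner M f v"
proof -
    obtain w where u: "u \<in> L2 M" and f: "f \<in> L2 M" and w: "\<And>n. w n \<in> V"
    "bounded (range (\<lambda>n. Re (a_R (w n) (w n))))" "L2_tendsto M w u"
    "\<And>v. v \<in> V \<Longrightarrow> (\<lambda>n. a_R (w n) v) \<longlonglongrightarrow> L2_inner M f v"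
    using op unfolding form_operator_def by blast
  have wL: "w n \<in> L2 M" for n by (rule R.L2[OF w(1)])
  obtain B1 where B1: "\<And>n. \<bar>Re (a_R (w n) (w n))\<bar> \<le> B1" using w(2) by (auto simp: bounded_iff)
  obtain B2 where B2: "\<And>n. (\<integral>x. (cmod (w n x))\<^sup>2 \<partial>M) \<le> B2" using L2_tendsto_bounded[OF w(3) wL u] by blast
  have B: "R.q (w n) \<le> B1 + B2" for n
    using B1[of n] B2[of n] by (simp add: Re_L2_inner_self)
  \<comment> \<open>Hulls of tails: every limit of \<open>w\<close> must be inherited by any
    sequence that picks its n-th member from \<open>C n\<close>.\<close>
  define C where "C n = midpoint_hull (w ` {n..})" for n
  \<comment> \<open>The inheritance principle: a midpoint-stable property shared by all
    \<open>w k\<close> with \<open>k \<ge> n\<close> holds throughout \<open>C n\<close>. It is used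
    for membership in the form domain and for each of the two limits.\<close>
  have C_least: "C n \<subseteq> X" if "\<And>k. k \<ge> n \<Longrightarrow> w k \<in> X"
    "\<And>p p'. p \<in> X \<Longrightarrow> p' \<in> X \<Longrightarrow> (\<lambda>x. (p x + p' x) / 2) \<in> X" for n X
    unfolding C_def using that by (intro midpoint_hull_least) auto
  have w_C: "w n \<in> C n" for n
    unfolding C_def by (rule subsetD[OF midpoint_hull_superset]) simp
  have half_D: "(\<lambda>x. (p x + p' x) / 2) \<in> V" if "p \<in> V" "p' \<in> V" for p p'
    using R.half_mem[OF R.add_mem[OF that]] .
  have C_D: "C n \<subseteq> V" for n by (rule C_least) (auto intro: w half_D)
  obtain g where g: "\<And>n. g n \<in> C n"
    and g_Cauchy: "\<And>e. e > 0 \<Longrightarrow> \<exists>N. \<forall>m\<ge>N. \<forall>n\<ge>N. R.q (\<lambda>x. g m x - g n x) < e"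
  proof (rule R.b.almost_minimizers_Cauchy[of C "B1 + B2"])
    show "C n \<subseteq> V" for n by (rule C_D)
    show "C (Suc n) \<subseteq> C n" for n unfolding C_def by (intro midpoint_hull_mono image_mono) auto
    show "C n \<noteq> {}" for n using w_C by blast
    show "(\<lambda>x. (p x + p' x) / 2) \<in> C n" if "p \<in> C n" "p' \<in> C n" for n p p'
      using that unfolding C_def by (rule midpoint_hull_midpoint)
    show "\<exists>p\<in>C n. R.q p \<le> B1 + B2" for n using w_C B by blast
  qed (rule that)
  have gD: "g n \<in> V" for n using g C_D by blast
  have conv: "(\<lambda>n. a_R (g n) v) \<longlonglongrightarrow> L2_inner M f v" if v: "v \<in> V" for v
  proof (rule LIMSEQ_I)
    fix e :: real assume "e > 0"
    from LIMSEQ_D[OF w(4)[OF v] this] obtain N where N: "\<And>n. n \<ge> N \<Longrightarrow> norm (a_R (w n) v - L2_inner M f v) < e" by blast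
    have "norm (a_R (g n) v - L2_inner M f v) < e" if n: "n \<ge> N" for n
    proof -
      let ?X = "{p \<in> V. norm (a_R p v - L2_inner M f v) < e}"
      have "C n \<subseteq> ?X"
      proof (rule C_least)
        fix p p' assume p: "p \<in> ?X" "p' \<in> ?X"
        have "a_R (\<lambda>x. (p x + p' x) / 2) v = (a_R p v + a_R p' v) / 2"
          using p v by (simp add: R.half_left R.add_left R.add_mem)
        then have eq: "a_R (\<lambda>x. (p x + p' x) / 2) v - L2_inner M f v
          = ((a_R p v - L2_inner M f v) + (a_R p' v - L2_inner M f v)) / 2"
          by (simp add: field_simps)
        have "norm (a_R (\<lambda>x. (p x + p' x) / 2) v - L2_inner M f v) < e"
          unfolding eq using norm_triangle_ineq[of "a_R p v - L2_inner M f v" "a_R p' v - L2_inner M f v"] p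
          by (simp add: norm_divide)
        then show "(\<lambda>x. (p x + p' x) / 2) \<in> ?X"
          using p half_D by simp
      qed (use w N n in auto)
      with g[of n] show ?thesis by blast
    qed
    then show "\<exists>no. \<forall>n\<ge>no. norm (a_R (g n) v - L2_inner M f v) < e" by blast
  qed
  have gu: "L2_tendsto M g u" unfolding L2_tendsto_iff
  proof (rule LIMSEQ_I)
    let ?I = "\<lambda>p. \<integral>x. (cmod (p x - u x))\<^sup>2 \<partial>M"
    fix e :: real assume "e > 0"
    from order_tendstoD(2)[OF w(3)[unfolded L2_tendsto_iff] this]
    obtain N where N: "\<And>n. n \<ge> N \<Longrightarrow> ?I (w n) < e" unfolding eventually_sequentially by blast
    have "norm (?I (g n) - 0) < e" if n: "n \<ge> N" for n
    proof -
      let ?X = "{p \<in> V. ?I p < e}"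
      have "C n \<subseteq> ?X"
      proof (rule C_least)
        fix p p' assume p: "p \<in> ?X" "p' \<in> ?X"
        have L: "(\<lambda>x. p x - u x) \<in> L2 M" "(\<lambda>x. p' x - u x) \<in> L2 M"
          using p R.L2 by (auto intro: L2_diff u)
        have eq: "(p x + p' x) / 2 - u x = ((p x - u x) + (p' x - u x)) / 2" for x
          by (simp add: field_simps)
        \<comment> \<open>At a midpoint the squared distance to \<open>u\<close> is at most the mean
          of the two given ones: the parallelogram law with its nonnegative difference term
          dropped.\<close>
        have "4 * (\<integral>x. (cmod (((p x - u x) + (p' x - u x)) / 2))\<^sup>2 \<partial>M) \<le> 2 * ?I p + 2 * ?I p'"
          using L2.quadratic_midpoint[OF L] L2.nonneg[OF L2_diff[OF L]] unfolding Re_L2_inner_self by linarith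
        then have "?I (\<lambda>x. (p x + p' x) / 2) < e" unfolding eq using p by simp
        then show "(\<lambda>x. (p x + p' x) / 2) \<in> ?X"
          using p half_D by simp
      qed (use w N n in auto)
      with g[of n] have "?I (g n) < e" by blast
      then show ?thesis by simp
    qed
    then show "\<exists>no. \<forall>n\<ge>no. norm (?I (g n) - 0) < e" by blast
  qed
  \<comment> \<open>Since \<open>R.q\<close> is the sum of \<open>N.q\<close> and the boundary
    integral, the Cauchy property splits: one part yields the approximation of \<open>u\<close>, the
    other the boundary limit \<phi>.\<close>
  have R_q_ge: "N.q p \<le> R.q p" "(\<integral>x. (cmod (p x))\<^sup>2 \<partial>\<mu>) \<le> R.q p" if "p \<in> V" for p
    unfolding R_q_eq using N.b.nonneg[OF form_dom_H1[OF that]] by simp_all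
  have gm: "(\<lambda>x. g m x - g n x) \<in> V" for m n by (rule R.minus_mem[OF gD gD])
  have app: "N.approx g u"
    unfolding N.form_approx_iff N.q_Cauchy_def
  proof (intro conjI allI impI gu form_dom_H1 gD)
    fix e :: real assume "e > 0"
    from g_Cauchy[OF this] obtain N where "\<forall>m\<ge>N. \<forall>n\<ge>N. R.q (\<lambda>x. g m x - g n x) < e" by blast
    then show "\<exists>N. \<forall>m\<ge>N. \<forall>n\<ge>N. N.q (\<lambda>x. g m x - g n x) < e"
      using le_less_trans[OF R_q_ge(1)[OF gm]] by blast
  qed
  obtain \<phi> where \<phi>: "\<phi> \<in> L2 \<mu>" "L2_tendsto \<mu> g \<phi>"
  proof (rule L2_complete[OF form_dom_L2_\<mu>[OF gD]])
    fix e :: real assume "e > 0"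
    from g_Cauchy[OF this] obtain N where "\<forall>m\<ge>N. \<forall>n\<ge>N. R.q (\<lambda>x. g m x - g n x) < e" by blast
    then show "\<exists>N. \<forall>m\<ge>N. \<forall>n\<ge>N. (\<integral>x. (cmod (g m x - g n x))\<^sup>2 \<partial>\<mu>) < e"
      using le_less_trans[OF R_q_ge(2)[OF gm]] by blast
  qed (rule that)
  show ?thesis by (rule that[OF gD app \<phi>(2,1) conv])
qed

text \<open>The strongly convergent sequence gives Green's formula with some trace \<phi> of
  \<open>u\<close>. What remains is to recognize \<phi> as the normalized trace, for which
  orthogonality to the traces of 0 is decisive.\<close>

lemma form_operator_imp:
  assumes op: "(u, f) \<in> form_operator M (V) (a_R)"
  shows "u \<in> H1_trace \<Omega> c \<mu>" "weakly_eq \<Omega> c u f"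
    "v \<in> V \<Longrightarrow> neumann_closure \<Omega> c u v - L2_inner M f v = - L2_inner \<mu> (Tr \<Omega> c \<mu> u) v"
proof -
  let ?G = "trace_set \<Omega> c \<mu>"
  have u: "u \<in> L2 M" and f: "f \<in> L2 M" using op by (auto simp: form_operator_def)
  obtain g \<phi> where g: "\<And>n. g n \<in> V" "N.approx g u"
    and \<phi>: "L2_tendsto \<mu> g \<phi>" "\<phi> \<in> L2 \<mu>"
    and conv: "\<And>v. v \<in> V \<Longrightarrow> (\<lambda>n. a_R (g n) v) \<longlonglongrightarrow> L2_inner M f v"
    by (rule form_operator_strong_approx[OF op]) blast
  have green: "neumann_closure \<Omega> c u v + L2_inner \<mu> \<phi> v = L2_inner M f v" if "v \<in> V" for v
    by (rule LIMSEQ_unique[OF form_approx_tendsto_robin[OF g u \<phi> that] conv[OF that]])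
  have trace: "is_trace \<Omega> c \<mu> u \<phi>" unfolding is_trace_iff using u \<phi> g by blast
  then show H1_trace: "u \<in> H1_trace \<Omega> c \<mu>"
    using \<phi>(2) by (auto simp: H1_trace_def is_trace_def)
  show "weakly_eq \<Omega> c u f" unfolding weakly_eq_def
  proof (intro conjI ballI f)
    show "u \<in> neumann_closure_dom \<Omega> c" using trace by (simp add: is_trace_def)
    fix v assume v: "v \<in> test_functions \<Omega>"
    \<comment> \<open>Test functions vanish on the boundary, so Green's formula reduces to the weak
      equation.\<close>
    have "L2_inner \<mu> \<phi> v = (\<integral>x. 0 \<partial>\<mu>)"
      unfolding L2_inner_def using test_functions_form_dom(2)[OF v]
      by (intro Bochner_Integration.integral_cong) (auto simp: space_\<mu>)
    then show "neumann_closure \<Omega> c u v = (\<integral>x. f x * cnj (v x) \<partial>M)"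
      using green[OF test_functions_form_dom(1)[OF v]] by (simp add: L2_inner_def)
  qed
  \<comment> \<open>Insert a sequence \<open>v n\<close> that tends to 0 for the Neumann form and
    whose boundary values tend to \<open>\<psi>\<close>. Both interior terms of Green's formula tend
    to 0, hence so does the boundary term.\<close>
  have orth: "L2_inner \<mu> \<phi> \<psi> = 0" if "\<psi> \<in> T" for \<psi>
  proof -
    obtain v where v: "\<And>n. v n \<in> V" "N.approx v (\<lambda>_. 0)" "L2_tendsto \<mu> v \<psi>"
      and \<psi>: "\<psi> \<in> L2 \<mu>" using \<open>\<psi> \<in> T\<close> unfolding T_def mem_Collect_eq is_trace_iff by blast
    obtain B where B: "\<And>n. N.q (g n) \<le> B" using N.q_Cauchy_bounded[OF N.form_approxD(1,2)[OF g(2)]] by blast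
    have "(\<lambda>n. 2 * (1 + tan \<theta>) * (sqrt B * sqrt (N.q (v n)))) \<longlonglongrightarrow> 2 * (1 + tan \<theta>) * (sqrt B * sqrt 0)"
      by (intro tendsto_intros N.form_approx_0[OF closable v(2)])
    then have 0: "(\<lambda>n. 2 * (1 + tan \<theta>) * (sqrt B * sqrt (N.q (v n)))) \<longlonglongrightarrow> 0" by simp
    have "(\<lambda>n. neumann_closure \<Omega> c u (v n)) \<longlonglongrightarrow> 0"
      by (rule Lim_null_comparison[OF always_eventually[OF allI[OF
            cmod_neumann_closure_le[OF g(2) u B form_dom_H1[OF v(1)]]]] 0])
    moreover have "(\<lambda>n. L2_inner M f (v n)) \<longlonglongrightarrow> L2_inner M f (\<lambda>_. 0)"
      by (rule L2_tendsto_inner_right[OF N.form_approxD(3)[OF v(2)] R.L2[OF v(1)] L2_zero f])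
    ultimately have "(\<lambda>n. L2_inner M f (v n) - neumann_closure \<Omega> c u (v n)) \<longlonglongrightarrow> L2_inner M f (\<lambda>_. 0) - 0"
      by (rule tendsto_diff[rotated])
    moreover have "L2_inner M f (v n) - neumann_closure \<Omega> c u (v n) = L2_inner \<mu> \<phi> (v n)" for n
      using green[OF v(1), of n] by (simp add: algebra_simps)
    ultimately have "(\<lambda>n. L2_inner \<mu> \<phi> (v n)) \<longlonglongrightarrow> 0" using L2.zero_form(2)[OF f] by simp
    moreover have "(\<lambda>n. L2_inner \<mu> \<phi> (v n)) \<longlonglongrightarrow> L2_inner \<mu> \<phi> \<psi>"
      by (rule L2_tendsto_inner_right[OF v(3) form_dom_L2_\<mu>[OF v(1)] \<psi> \<phi>(2)])
    ultimately show ?thesis by (rule LIMSEQ_unique[rotated])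
  qed
  \<comment> \<open>The part \<open>?\<psi>\<close> of \<phi> off the trace set is a trace of 0, and
    \<phi> is orthogonal to it, so its norm is 0. On the trace set \<open>?\<tau>\<close> and \<phi>
    agree because their difference is a trace of 0.\<close>
  let ?\<tau> = "Tr \<Omega> c \<mu> u" and ?\<psi> = "\<lambda>x. indicator (space \<mu> - ?G) x * \<phi> x"
  note \<tau> = Tr_spec[OF H1_trace]
  note [measurable] = L2_measurable[OF \<phi>(2)] L2_measurable[OF \<tau>(1)] trace_set_spec(1)
  have \<psi>L: "?\<psi> \<in> L2 \<mu>"
    by (rule L2_dominated[OF \<phi>(2), of _ 1]) (auto simp: norm_mult indicator_def)
  then have "?\<psi> \<in> T" unfolding trace_set_spec(2) by (auto simp: indicator_def)
  from orth[OF this] have "L2_inner \<mu> \<phi> ?\<psi> = 0" .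
  moreover have "?\<psi> x * cnj (?\<psi> x) = \<phi> x * cnj (?\<psi> x)" for x
    by (auto simp: indicator_def)
  ultimately have "L2_inner \<mu> ?\<psi> ?\<psi> = 0"
    unfolding L2_inner_def by (simp only:)
  then have "(\<integral>x. (cmod (?\<psi> x))\<^sup>2 \<partial>\<mu>) = 0" unfolding L2_inner_self by simp
  then have "AE x in \<mu>. (cmod (?\<psi> x))\<^sup>2 = 0"
    using integral_nonneg_eq_0_iff_AE[OF L2_square_integrable[OF \<psi>L]] by simp
  moreover have "(\<lambda>x. ?\<tau> x - \<phi> x) \<in> T"
    using is_trace_diff[OF \<tau>(3) trace] by (simp add: T_def)
  then have "AE x in \<mu>. x \<in> ?G \<longrightarrow> ?\<tau> x - \<phi> x = 0" unfolding trace_set_spec(2) by blast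
  ultimately have "AE x in \<mu>. ?\<tau> x = \<phi> x"
    using AE_space
  proof eventually_elim
    case (elim x)
    show ?case
    proof (cases "x \<in> ?G")
      case False
      then have "\<phi> x = 0" using elim by simp
      moreover have "?\<tau> x = 0" using \<tau>(2)[of x] False elim(3) by (simp add: space_\<mu>)
      ultimately show ?thesis by simp
    qed (use elim in simp)
  qed
  then have ae: "AE x in \<mu>. ?\<tau> x * cnj (v x) = \<phi> x * cnj (v x)" by eventually_elim simp
  show "neumann_closure \<Omega> c u v - L2_inner M f v = - L2_inner \<mu> ?\<tau> v" if v: "v \<in> V"
  proof -
    note [measurable] = L2_measurable[OF form_dom_L2_\<mu>[OF v]]
    have "L2_inner \<mu> ?\<tau> v = L2_inner \<mu> \<phi> v"
      unfolding L2_inner_def using ae by (intro integral_cong_AE) measurable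
    with green[OF v] show ?thesis by (simp add: algebra_simps)
  qed
qed

text \<open>The sequence that witnesses \<open>Tr\<close> as a trace of \<open>u\<close> meets the
  definition of the operator: it is bounded for the form because both parts of the norm converge,
  and the limit against \<open>v\<close> is identified by Green's formula.\<close>

lemma form_operatorI:
  assumes u: "u \<in> H1_trace \<Omega> c \<mu>" and uL: "u \<in> L2 M" and fL: "f \<in> L2 M"
    and green: "\<And>v. v \<in> V \<Longrightarrow> neumann_closure \<Omega> c u v - L2_inner M f v = - L2_inner \<mu> (Tr \<Omega> c \<mu> u) v"
  shows "(u, f) \<in> form_operator M (V) (a_R)"
proof -
  note \<tau> = Tr_spec[OF u]
  obtain w where w: "\<And>n. w n \<in> V" "N.approx w u"
    "L2_tendsto \<mu> w (Tr \<Omega> c \<mu> u)"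
    using \<tau>(3) unfolding is_trace_iff by blast
  obtain B1 where B1: "\<And>n. N.q (w n) \<le> B1" using N.q_Cauchy_bounded[OF N.form_approxD(1,2)[OF w(2)]] by blast
  obtain B2 where B2: "\<And>n. (\<integral>x. (cmod (w n x))\<^sup>2 \<partial>\<mu>) \<le> B2"
    using L2_tendsto_bounded[OF w(3) form_dom_L2_\<mu>[OF w(1)] \<tau>(1)] by blast
  have "norm (Re (a_R (w n) (w n))) \<le> B1 + B2" for n
    using R.nonneg[OF w(1), of n] R.Re_le_q(1)[OF w(1), of n] B1[of n] B2[of n] unfolding R_q_eq by simp
  then have "bounded (range (\<lambda>n. Re (a_R (w n) (w n))))"
    unfolding bounded_iff by blast
  moreover have "(\<lambda>n. a_R (w n) v) \<longlonglongrightarrow> L2_inner M f v" if v: "v \<in> V" for v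
  proof -
    have "neumann_closure \<Omega> c u v + L2_inner \<mu> (Tr \<Omega> c \<mu> u) v = L2_inner M f v"
      using green[OF v] by (simp add: algebra_simps)
    with form_approx_tendsto_robin[OF w(1,2) uL w(3) \<tau>(1) v] show ?thesis by simp
  qed
  moreover have "L2_tendsto M w u" by (rule N.form_approxD(3)[OF w(2)])
  ultimately show ?thesis using w(1) uL fL unfolding form_operator_def by blast
qed

end

theorem proposition4p15:
  fixes \<Omega> :: "(real^'n) set"
    and c :: "'n \<Rightarrow> 'n \<Rightarrow> real^'n \<Rightarrow> complex"
    and \<theta> :: real
    and \<mu> :: "(real^'n) measure"
    and u f :: "real^'n \<Rightarrow> complex"
  assumes "open \<Omega>"
    and "\<And>i j. c i j \<in> Linfty (lebesgue_on \<Omega>)"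
    and "0 \<le> \<theta>" and "\<theta> < pi / 2"
    and "\<And>\<xi> :: complex^'n. AE x in lebesgue_on \<Omega>.
           (\<Sum>i\<in>UNIV. \<Sum>j\<in>UNIV. c i j x * (\<xi> $ i) * cnj (\<xi> $ j)) \<in> sector \<theta>"
    and "sets \<mu> = sets (restrict_space borel (frontier \<Omega>))"
    and "\<And>K. compact K \<Longrightarrow> K \<subseteq> frontier \<Omega> \<Longrightarrow> emeasure \<mu> K < \<infinity>"
    and "closable (lebesgue_on \<Omega>) (H1 \<Omega>) (neumann_form \<Omega> c)"
    and "u \<in> L2 (lebesgue_on \<Omega>)" and "f \<in> L2 (lebesgue_on \<Omega>)"
  shows "(u, f) \<in> form_operator (lebesgue_on \<Omega>) (form_dom \<Omega> \<mu>) (robin_form \<Omega> c \<mu>) \<longleftrightarrow>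
    u \<in> H1_trace \<Omega> c \<mu> \<and> weakly_eq \<Omega> c u f \<and>
    (\<forall>v\<in>form_dom \<Omega> \<mu>.
       neumann_closure \<Omega> c u v - (\<integral>x. weak_operator \<Omega> c u x * cnj (v x) \<partial>lebesgue_on \<Omega>)
         = - (\<integral>x. Tr \<Omega> c \<mu> u x * cnj (v x) \<partial>\<mu>))"
proof -
  interpret robin \<Omega> c \<theta> \<mu>
    using assms by unfold_locales
  \<comment> \<open>Once the weak equation holds, the chosen representative of \<A>u may be replaced
    by \<open>f\<close> under the integral.\<close>
  have green_iff: "neumann_closure \<Omega> c u v - (\<integral>x. weak_operator \<Omega> c u x * cnj (v x) \<partial>lebesgue_on \<Omega>)
      = - (\<integral>x. Tr \<Omega> c \<mu> u x * cnj (v x) \<partial>\<mu>) \<longleftrightarrow>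
    neumann_closure \<Omega> c u v - L2_inner (lebesgue_on \<Omega>) f v = - L2_inner \<mu> (Tr \<Omega> c \<mu> u) v"
    if "weakly_eq \<Omega> c u f" "v \<in> form_dom \<Omega> \<mu>" for v
    unfolding L2_inner_def weak_operator_integral[OF that(1) R.L2[OF that(2)]] ..
  show ?thesis
    using form_operator_imp[of u f] form_operatorI[of u f] assms(9,10) green_iff by blast
qed

end
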